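(* Let $(\Omega,\mathcal{B},\mu)$ be a $\sigma$-finite measure space with $\mu(\Omega)=\infty$, let $T:\Omega\to\Omega$ be a non-singular, invertible, ergodic, conservative transformation, let $f:\Omega\to\mathbb{R}$ be bounded and measurable, and for $\omega\in\Omega$ let $H_\omega$ be the bounded self-adjoint operator on $\ell^2(\mathbb{Z})$ given by $(H_\omega u)_n=u_{n-1}+u_{n+1}+f(T^n\omega)u_n$. Let $\Sigma_{\mathrm{ac}}\subseteq\mathbb{R}$ be the compact set such that $\sigma_{\mathrm{ac}}(H_\omega)=\Sigma_{\mathrm{ac}}$ for $\mu$-a.e. $\omega$, and let $\overline{L}^{\pm}(E)$ be the upper Lyapunov exponents. Then $$\Sigma_{\mathrm{ac}}\subset\overline{\{E\in\mathbb{R}:\overline{L}^+(E)=0\text{ or }\overline{L}^-(E)=0\}}^{\,\mathrm{ess}}.$$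
   Context: A measurable transformation $T$ is: invertible if it is bijective and $T^{-1}$ is measurable; non-singular if, for $E\in\mathcal{B}$, $\mu(E)=0$ if and only if $\mu(T^{-1}E)=0$; ergodic if $T^{-1}E=E$ (with $E\in\mathcal{B}$) implies $\mu(E)=0$ or $\mu(\Omega\setminus E)=0$; conservative if there is no $W\in\mathcal{B}$ with $\mu(W)>0$ such that the sets $T^{-n}W$, $n\ge 0$, are pairwise disjoint. Transfer matrices: $A(E,\omega)=\begin{pmatrix}E-f(\omega)&-1\\1&0\end{pmatrix}$, and $A(E,n,\omega)=A(E,T^{n-1}\omega)\cdots A(E,\omega)$ for $n>0$, $A(E,0,\omega)=I$, $A(E,n,\omega)=A(E,T^{-|n|}\omega)^{-1}\cdots A(E,T^{-1}\omega)^{-1}$ for $n<0$. For each $E$, $\overline{L}^\pm(E)$ are the finite constants (which exist) such that $\limsup_{n\to\pm\infty}\frac1{|n|}\log\|A(E,n,\omega)\|=\overline{L}^\pm(E)$ for $\mu$-a.e. $\omega$. $\sigma_{\mathrm{ac}}(H)$ is the spectrum of the restriction of $H$ to its absolutely continuous subspace (vectors whose spectral measure is absolutely continuous with respect to Lebesgue measure). For $S\subseteq\mathbb{R}$, the essential closure is $\overline{S}^{\,\mathrm{ess}}=\{E\in\mathbb{R}: |S\cap(E-\varepsilon,E+\varepsilon)|>0\text{ for every }\varepsilon>0\}$, where $|\cdot|$ is Lebesgue measure. *)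

theory Defs
  imports "HOL-Analysis.Analysis"
begin

section \<open>Transformations of a measure space\<close>

definition invertible_transformation :: "'a measure \<Rightarrow> ('a \<Rightarrow> 'a) \<Rightarrow> bool" where
  "invertible_transformation M T \<longleftrightarrow>
     T \<in> measurable M M \<and> bij_betw T (space M) (space M) \<and>
     inv_into (space M) T \<in> measurable M M"

definition nonsingular_transformation :: "'a measure \<Rightarrow> ('a \<Rightarrow> 'a) \<Rightarrow> bool" where
  "nonsingular_transformation M T \<longleftrightarrow>
     (\<forall>E\<in>sets M. emeasure M E = 0 \<longleftrightarrow> emeasure M (T -` E \<inter> space M) = 0)"

definition ergodic_transformation :: "'a measure \<Rightarrow> ('a \<Rightarrow> 'a) \<Rightarrow> bool" where
  "ergodic_transformation M T \<longleftrightarrow>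
     (\<forall>E\<in>sets M. T -` E \<inter> space M = E \<longrightarrow> emeasure M E = 0 \<or> emeasure M (space M - E) = 0)"

definition conservative_transformation :: "'a measure \<Rightarrow> ('a \<Rightarrow> 'a) \<Rightarrow> bool" where
  "conservative_transformation M T \<longleftrightarrow>
     \<not> (\<exists>W\<in>sets M. emeasure M W > 0 \<and>
          disjoint_family (\<lambda>n::nat. (T ^^ n) -` W \<inter> space M))"

definition int_iterate :: "'a measure \<Rightarrow> ('a \<Rightarrow> 'a) \<Rightarrow> int \<Rightarrow> 'a \<Rightarrow> 'a" where
  "int_iterate M T n \<omega> =
     (if n \<ge> 0 then (T ^^ nat n) \<omega> else (inv_into (space M) T ^^ nat (- n)) \<omega>)"

section \<open>The Hilbert space of square-summable complex sequences on the integers\<close>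

definition ell2 :: "(int \<Rightarrow> complex) set" where
  "ell2 = {u. (\<lambda>n. (cmod (u n))\<^sup>2) summable_on UNIV}"

definition ell2_inner :: "(int \<Rightarrow> complex) \<Rightarrow> (int \<Rightarrow> complex) \<Rightarrow> complex" where
  "ell2_inner u v = (\<Sum>\<^sub>\<infinity>n. cnj (u n) * v n)"

definition ell2_norm :: "(int \<Rightarrow> complex) \<Rightarrow> real" where
  "ell2_norm u = sqrt (\<Sum>\<^sub>\<infinity>n. (cmod (u n))\<^sup>2)"

text \<open>Spectrum of the restriction of \<open>A\<close> to a subspace \<open>S\<close>: the complement of the set of all \<open>z\<close>
  for which \<open>A - z\<close> maps \<open>S\<close> bijectively onto itself with bounded inverse. In particular the
  spectrum is empty for the zero subspace.\<close>

definition spectrum_on ::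
  "((int \<Rightarrow> complex) \<Rightarrow> (int \<Rightarrow> complex)) \<Rightarrow> (int \<Rightarrow> complex) set \<Rightarrow> complex set" where
  "spectrum_on A S = {z. \<not> (bij_betw (\<lambda>u n. A u n - z * u n) S S \<and>
     (\<exists>C. \<forall>u\<in>S. ell2_norm u \<le> C * ell2_norm (\<lambda>n. A u n - z * u n)))}"

text \<open>The spectral measure of the vector \<open>u\<close> for a bounded self-adjoint operator \<open>A\<close> is the unique
  finite Borel measure \<open>\<nu>\<close> carried by the spectrum of \<open>A\<close> with
  \<open>\<langle>u, g(A) u\<rangle> = \<integral> g d\<nu>\<close> in the functional calculus. As the spectrum is compact, it
  suffices to require this for all powers (hence for all polynomials, hence for all continuous \<open>g\<close>).\<close>

definition spectral_measure ::
  "((int \<Rightarrow> complex) \<Rightarrow> (int \<Rightarrow> complex)) \<Rightarrow> (int \<Rightarrow> complex) \<Rightarrow> real measure \<Rightarrow> bool" where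
  "spectral_measure A u \<nu> \<longleftrightarrow>
     sets \<nu> = sets borel \<and> finite_measure \<nu> \<and>
     (AE x in \<nu>. complex_of_real x \<in> spectrum_on A ell2) \<and>
     (\<forall>k::nat. ell2_inner u ((A ^^ k) u) = complex_of_real (\<integral>x. x ^ k \<partial>\<nu>))"

definition ac_subspace ::
  "((int \<Rightarrow> complex) \<Rightarrow> (int \<Rightarrow> complex)) \<Rightarrow> (int \<Rightarrow> complex) set" where
  "ac_subspace A = {u \<in> ell2. \<exists>\<nu>. spectral_measure A u \<nu> \<and> absolutely_continuous lborel \<nu>}"

definition ac_spectrum :: "((int \<Rightarrow> complex) \<Rightarrow> (int \<Rightarrow> complex)) \<Rightarrow> complex set" where
  "ac_spectrum A = spectrum_on A (ac_subspace A)"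

section \<open>Schroedinger operators and transfer matrices\<close>

definition schroedinger ::
  "'a measure \<Rightarrow> ('a \<Rightarrow> 'a) \<Rightarrow> ('a \<Rightarrow> real) \<Rightarrow> 'a \<Rightarrow> (int \<Rightarrow> complex) \<Rightarrow> (int \<Rightarrow> complex)" where
  "schroedinger M T f \<omega> u =
     (\<lambda>n. u (n - 1) + u (n + 1) + complex_of_real (f (int_iterate M T n \<omega>)) * u n)"

definition one_step_matrix :: "('a \<Rightarrow> real) \<Rightarrow> real \<Rightarrow> 'a \<Rightarrow> real^2^2" where
  "one_step_matrix f E \<omega> = vector [vector [E - f \<omega>, -1], vector [1, 0]]"

primrec forward_transfer ::
  "'a measure \<Rightarrow> ('a \<Rightarrow> 'a) \<Rightarrow> ('a \<Rightarrow> real) \<Rightarrow> real \<Rightarrow> nat \<Rightarrow> 'a \<Rightarrow> real^2^2" where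
  "forward_transfer M T f E 0 \<omega> = mat 1"
| "forward_transfer M T f E (Suc n) \<omega> =
     one_step_matrix f E (int_iterate M T (int n) \<omega>) ** forward_transfer M T f E n \<omega>"

primrec backward_transfer ::
  "'a measure \<Rightarrow> ('a \<Rightarrow> 'a) \<Rightarrow> ('a \<Rightarrow> real) \<Rightarrow> real \<Rightarrow> nat \<Rightarrow> 'a \<Rightarrow> real^2^2" where
  "backward_transfer M T f E 0 \<omega> = mat 1"
| "backward_transfer M T f E (Suc n) \<omega> =
     matrix_inv (one_step_matrix f E (int_iterate M T (- int (Suc n)) \<omega>))
       ** backward_transfer M T f E n \<omega>"

definition transfer_matrix ::
  "'a measure \<Rightarrow> ('a \<Rightarrow> 'a) \<Rightarrow> ('a \<Rightarrow> real) \<Rightarrow> real \<Rightarrow> int \<Rightarrow> 'a \<Rightarrow> real^2^2" where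
  "transfer_matrix M T f E n \<omega> =
     (if n \<ge> 0 then forward_transfer M T f E (nat n) \<omega>
      else backward_transfer M T f E (nat (- n)) \<omega>)"

text \<open>The matrix norm is the Euclidean operator norm; the exponents do not depend on this choice.\<close>

definition growth_rate ::
  "'a measure \<Rightarrow> ('a \<Rightarrow> 'a) \<Rightarrow> ('a \<Rightarrow> real) \<Rightarrow> real \<Rightarrow> 'a \<Rightarrow> int \<Rightarrow> real" where
  "growth_rate M T f E \<omega> n =
     1 / real_of_int \<bar>n\<bar> * ln (onorm ((*v) (transfer_matrix M T f E n \<omega>)))"

text \<open>\<open>L\<close> gives the upper Lyapunov exponents at \<open>+\<infinity>\<close> (\<open>F = at_top\<close>) or \<open>-\<infinity>\<close>
  (\<open>F = at_bot\<close>). Values are real because the exponents are finite; for \<open>\<mu> \<noteq> 0\<close> they are unique.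
  The exceptional null set may depend on \<open>E\<close>.\<close>

definition is_upper_lyapunov ::
  "int filter \<Rightarrow> 'a measure \<Rightarrow> ('a \<Rightarrow> 'a) \<Rightarrow> ('a \<Rightarrow> real) \<Rightarrow> (real \<Rightarrow> real) \<Rightarrow> bool" where
  "is_upper_lyapunov F M T f L \<longleftrightarrow>
     (\<forall>E. AE \<omega> in M. Limsup F (\<lambda>n. ereal (growth_rate M T f E \<omega> n)) = ereal (L E))"

section \<open>Essential closure\<close>

text \<open>Meant for Lebesgue measurable \<open>S\<close> (\<open>emeasure\<close> vanishes on non-measurable sets). The zero
  sets of the upper Lyapunov exponents are Borel, since the growth rate is jointly measurable in
  energy and phase and the phase space is \<open>\<sigma>\<close>-finite.\<close>

definition essential_closure :: "real set \<Rightarrow> real set" where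
  "essential_closure S = {E. \<forall>\<epsilon>>0. emeasure lebesgue (S \<inter> {E - \<epsilon><..<E + \<epsilon>}) > 0}"

end

theory Submission
  imports Defs "HOL-Complex_Analysis.Cauchy_Integral_Formula" "HOL-Real_Asymp.Real_Asymp"
    "HOL-Computational_Algebra.Polynomial"
begin

text \<open>Fix a phase and write \<open>H\<close> for its operator. For Lebesgue almost every energy \<open>E\<close> and
  every site \<open>j\<close> there is a polynomially bounded solution \<open>g\<close> of \<open>(H - E) g = \<delta>\<^sub>j\<close>: the diagonal
  Green's functions of finite boxes are Herglotz functions, so that their square roots have bounded
  means near the real axis, and Fatou's lemma with compactness gives \<open>g\<close> in the limit. If for such
  an \<open>E\<close> there is also a nonzero polynomially bounded solution \<open>\<phi>\<close> of \<open>H \<phi> = E \<phi>\<close>, then on one of the two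
  half-lines \<open>\<phi>\<close> and some \<open>g\<close> are linearly independent; hence all solutions are polynomially bounded
  there and the corresponding exponent vanishes.

  Conversely, the spectral measure \<open>\<nu>\<close> of a vector \<open>u\<close> is carried by energies with polynomially bounded
  solutions: by the Riesz theorem in \<open>L\<^sup>2(\<nu>)\<close> one has \<open>(p(H) u)(n) = \<integral> p h\<^sub>n d\<nu>\<close> with \<open>h\<^sub>n\<close> bounded in
  \<open>L\<^sup>2(\<nu>)\<close> uniformly in \<open>n\<close>, and \<open>n \<mapsto> h\<^sub>n(E)\<close> is such a solution, not identically zero for \<open>\<nu>\<close>-almost
  every \<open>E\<close>. If both exponents are positive almost everywhere on an interval, then by Fubini, for almost
  every phase, no absolutely continuous spectral measure charges this interval, and the functional
  calculus inverts \<open>H - E\<close> on the absolutely continuous subspace for \<open>E\<close> inside it.\<close>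

section \<open>The Hilbert space of square-summable sequences\<close>

text \<open>The exponents are upper limits, and \<open>T\<close> is only non-singular on an infinite
  measure space, so a positive exponent does not by itself supply a decaying solution on a
  half-line. The Green's functions take over that role: off its source, \<open>g\<close> is a
  solution to be compared with \<open>\<phi>\<close>. The comparison succeeds on one half-line only,
  and which one depends on the phase and the energy; hence the alternative in the statement.

  The square root is forced by the boundary: the modulus of a Herglotz function, pulled back to the
  disc, can have unbounded means over circles of radius tending to 1, as
  \<open>(1 + w) / (1 - w)\<close> shows. Square roots are controlled by the value at the centre,
  and the resolvent bound there is the same for all boxes. Off-diagonal Green's functions are not
  Herglotz, so they enter by polarization.

  The absolutely continuous subspace is handled one vector at a time: each vector has its own
  measure \<open>\<nu>\<close>, and everything needed is a function of the operator applied to that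
  vector.\<close>

typedef l2 = ell2
  morphisms seq_of l2_of
  by (rule exI[of _ "\<lambda>_. 0"]) (simp add: ell2_def)

lemma ell2D: "u \<in> ell2 \<Longrightarrow> (\<lambda>n. (cmod (u n))\<^sup>2) summable_on UNIV"
  by (simp add: ell2_def)

lemma seq_of_ell2 [simp]: "seq_of u \<in> ell2"
  by (rule seq_of)

lemma ell2_zero: "(\<lambda>_. 0) \<in> ell2"
  by (simp add: ell2_def)

lemma ell2_add:
  assumes "u \<in> ell2" "v \<in> ell2"
  shows "(\<lambda>n. u n + v n) \<in> ell2"
proof -
  have "(\<lambda>n. 2 * (cmod (u n))\<^sup>2 + 2 * (cmod (v n))\<^sup>2) summable_on UNIV"
    using assms by (auto simp: ell2_def intro!: summable_on_add summable_on_cmult_right)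
  then show ?thesis
    unfolding ell2_def mem_Collect_eq
  proof (rule summable_on_comparison_test)
    fix n
    have "(cmod (u n + v n))\<^sup>2 \<le> (cmod (u n) + cmod (v n))\<^sup>2"
      by (intro power_mono norm_triangle_ineq) auto
    also have "\<dots> \<le> 2 * (cmod (u n))\<^sup>2 + 2 * (cmod (v n))\<^sup>2"
      using sum_squares_bound[of "cmod (u n)" "cmod (v n)"] by (simp add: power2_sum)
    finally show "(cmod (u n + v n))\<^sup>2 \<le> 2 * (cmod (u n))\<^sup>2 + 2 * (cmod (v n))\<^sup>2" .
  qed auto
qed

lemma ell2_mult_bounded:
  assumes "u \<in> ell2" "\<And>n. cmod (a n) \<le> K"
  shows "(\<lambda>n. a n * u n) \<in> ell2"
proof -
  have "(\<lambda>n. K\<^sup>2 * (cmod (u n))\<^sup>2) summable_on UNIV"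
    using assms(1) by (auto simp: ell2_def intro!: summable_on_cmult_right)
  then show ?thesis
    unfolding ell2_def mem_Collect_eq
    by (rule summable_on_comparison_test)
      (auto simp: norm_mult power_mult_distrib intro!: mult_right_mono power_mono assms(2))
qed

lemma ell2_scaleR: "u \<in> ell2 \<Longrightarrow> (\<lambda>n. r *\<^sub>R u n) \<in> ell2"
  using ell2_mult_bounded[of u "\<lambda>_. complex_of_real r" "\<bar>r\<bar>"] by (simp add: scaleR_conv_of_real)

lemma ell2_shift:
  assumes "u \<in> ell2"
  shows "(\<lambda>n. u (n + k)) \<in> ell2"
proof -
  have "bij (\<lambda>n::int. n + k)"
    by (rule bij_betw_byWitness[of _ "\<lambda>n. n - k"]) auto
  then show ?thesis
    using assms summable_on_reindex_bij_betw[of "\<lambda>n. n + k" UNIV UNIV "\<lambda>n. (cmod (u n))\<^sup>2"]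
    by (simp add: ell2_def)
qed

lemma ell2_inner_summable:
  assumes "u \<in> ell2" "v \<in> ell2"
  shows "(\<lambda>n. norm (cnj (u n) * v n)) summable_on UNIV"
proof -
  have "(\<lambda>n. (cmod (u n))\<^sup>2 + (cmod (v n))\<^sup>2) summable_on UNIV"
    using assms by (auto simp: ell2_def intro!: summable_on_add)
  then show ?thesis
  proof (rule summable_on_comparison_test)
    fix n
    show "norm (cnj (u n) * v n) \<le> (cmod (u n))\<^sup>2 + (cmod (v n))\<^sup>2"
      using sum_squares_bound[of "cmod (u n)" "cmod (v n)"] mult_nonneg_nonneg[OF norm_ge_zero norm_ge_zero, of "u n" "v n"]
      unfolding norm_mult complex_mod_cnj by linarith
  qed auto
qed

lemma ell2_real_inner_summable:
  assumes "u \<in> ell2" "v \<in> ell2"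
  shows "(\<lambda>n. u n \<bullet> v n) summable_on UNIV"
  using summable_on_Re[OF abs_summable_summable[OF ell2_inner_summable[OF assms]]]
  by (simp add: inner_complex_def)

lemma Re_ell2_inner:
  assumes "u \<in> ell2" "v \<in> ell2"
  shows "Re (ell2_inner u v) = (\<Sum>\<^sub>\<infinity>n. u n \<bullet> v n)"
  using infsum_Re[OF abs_summable_summable[OF ell2_inner_summable[OF assms]]]
  by (simp add: ell2_inner_def inner_complex_def)

text \<open>A real structure suffices, because the energies and the polynomials applied to the
  operator are real; only the real part of the complex inner product is kept.\<close>

instantiation l2 :: real_inner
begin

definition "0 = l2_of (\<lambda>_. 0)"
definition "u + v = l2_of (\<lambda>n. seq_of u n + seq_of v n)"
definition "r *\<^sub>R u = l2_of (\<lambda>n. r *\<^sub>R seq_of u n)"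
definition "- u = (-1::real) *\<^sub>R (u::l2)"
definition "u - v = u + (- v :: l2)"
definition "u \<bullet> v = (\<Sum>\<^sub>\<infinity>n. seq_of u n \<bullet> seq_of v n)"
definition "norm (u::l2) = sqrt (u \<bullet> u)"
definition "sgn (u::l2) = inverse (norm u) *\<^sub>R u"
definition "dist (u::l2) v = norm (u - v)"
definition "(uniformity :: (l2 \<times> l2) filter) = (INF e\<in>{0<..}. principal {(x, y). dist x y < e})"
definition "open (U :: l2 set) = (\<forall>x\<in>U. \<forall>\<^sub>F (x', y) in uniformity. x' = x \<longrightarrow> y \<in> U)"

lemma seq_of_zero: "seq_of 0 = (\<lambda>_. 0)"
  by (simp add: zero_l2_def l2_of_inverse ell2_zero)

lemma seq_of_add: "seq_of (u + v) = (\<lambda>n. seq_of u n + seq_of v n)"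
  by (simp add: plus_l2_def l2_of_inverse ell2_add)

lemma seq_of_scaleR: "seq_of (r *\<^sub>R u) = (\<lambda>n. r *\<^sub>R seq_of u n)"
  by (simp add: scaleR_l2_def l2_of_inverse ell2_scaleR)

lemma seq_of_uminus: "seq_of (- u) = (\<lambda>n. - seq_of u n)"
  by (simp add: uminus_l2_def seq_of_scaleR)

lemma seq_of_diff: "seq_of (u - v) = (\<lambda>n. seq_of u n - seq_of v n)"
  by (simp add: minus_l2_def seq_of_uminus seq_of_add)

instance
proof
  fix u v w :: l2 and a b :: real
  have r: "x = y \<longleftrightarrow> seq_of x = seq_of y" for x y
    by (simp add: seq_of_inject)
  note s = seq_of_zero seq_of_add seq_of_scaleR seq_of_uminus seq_of_diff
  show "u + v + w = u + (v + w)" "u + v = v + u" "0 + u = u" "- u + u = 0" "u - v = u + - v"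
    "a *\<^sub>R (u + v) = a *\<^sub>R u + a *\<^sub>R v" "(a + b) *\<^sub>R u = a *\<^sub>R u + b *\<^sub>R u"
    "a *\<^sub>R b *\<^sub>R u = (a * b) *\<^sub>R u" "1 *\<^sub>R u = u"
    unfolding r s by (simp_all add: algebra_simps)
  show "u \<bullet> v = v \<bullet> u"
    by (simp add: inner_l2_def inner_commute)
  show "(u + v) \<bullet> w = u \<bullet> w + v \<bullet> w"
    by (simp add: inner_l2_def s inner_add_left infsum_add ell2_real_inner_summable)
  show "a *\<^sub>R u \<bullet> v = a * (u \<bullet> v)"
    by (simp add: inner_l2_def s infsum_cmult_right ell2_real_inner_summable)
  show "0 \<le> u \<bullet> u"
    unfolding inner_l2_def by (rule infsum_nonneg) simp
  show "(u \<bullet> u = 0) = (u = 0)"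
  proof
    assume "u \<bullet> u = 0"
    then have "seq_of u n \<bullet> seq_of u n = 0" for n
      unfolding inner_l2_def
      by (intro nonneg_infsum_le_0D[of "\<lambda>n. seq_of u n \<bullet> seq_of u n" UNIV])
        (auto simp: ell2_real_inner_summable)
    then show "u = 0"
      unfolding r s by (simp add: fun_eq_iff)
  qed (simp add: inner_l2_def s)
qed (rule sgn_l2_def dist_l2_def uniformity_l2_def open_l2_def norm_l2_def)+

end

lemma norm_eq_ell2_norm: "norm u = ell2_norm (seq_of u)"
  by (simp add: norm_l2_def inner_l2_def ell2_norm_def dot_square_norm)

lemma power2_norm_l2: "(norm u)\<^sup>2 = (\<Sum>\<^sub>\<infinity>n. (cmod (seq_of u n))\<^sup>2)"
  unfolding power2_norm_eq_inner inner_l2_def by (simp add: dot_square_norm)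

lemma finite_sum_le_power2_norm_l2:
  assumes "finite F"
  shows "(\<Sum>n\<in>F. (cmod (seq_of u n))\<^sup>2) \<le> (norm u)\<^sup>2"
  unfolding power2_norm_l2 by (rule finite_sum_le_infsum) (use assms ell2D[OF seq_of_ell2] in auto)

lemma norm_seq_of_le: "cmod (seq_of u n) \<le> norm u"
  using finite_sum_le_power2_norm_l2[of "{n}" u] by (simp add: power2_le_iff_abs_le)

lemma l2_norm_leI:
  assumes "\<And>F. finite F \<Longrightarrow> (\<Sum>n\<in>F. (cmod (seq_of u n))\<^sup>2) \<le> C\<^sup>2" "0 \<le> C"
  shows "norm u \<le> C"
proof -
  have "(norm u)\<^sup>2 \<le> C\<^sup>2"
    unfolding power2_norm_l2 by (rule infsum_le_finite_sums) (use assms ell2D[OF seq_of_ell2] in auto)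
  then show ?thesis
    using assms(2) by simp
qed

lemma tendsto_seq_of: "X \<longlonglongrightarrow> u \<Longrightarrow> (\<lambda>k. seq_of (X k) n) \<longlonglongrightarrow> seq_of u n"
proof -
  assume "X \<longlonglongrightarrow> u"
  then have "(\<lambda>k. norm (X k - u)) \<longlonglongrightarrow> 0"
    by (simp add: LIM_zero tendsto_norm_zero)
  then have "(\<lambda>k. seq_of (X k) n - seq_of u n) \<longlonglongrightarrow> 0"
    by (rule Lim_null_comparison[rotated])
      (use norm_seq_of_le[of "X _ - u" n] in \<open>auto simp: seq_of_diff\<close>)
  then show ?thesis
    by (simp add: LIM_zero_cancel)
qed

instance l2 :: banach
proof
  fix X :: "nat \<Rightarrow> l2"
  assume X: "Cauchy X"
  have "Cauchy (\<lambda>k. seq_of (X k) n)" for n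
    unfolding Cauchy_def
  proof (intro allI impI)
    fix e :: real assume "e > 0"
    then obtain M where M: "\<forall>m\<ge>M. \<forall>k\<ge>M. dist (X m) (X k) < e"
      using X by (auto simp: Cauchy_def)
    have "dist (seq_of (X m) n) (seq_of (X k) n) < e" if "m \<ge> M" "k \<ge> M" for m k
      using norm_seq_of_le[of "X m - X k" n] M that
      unfolding dist_norm seq_of_diff by (blast intro: le_less_trans)
    then show "\<exists>M. \<forall>m\<ge>M. \<forall>k\<ge>M. dist (seq_of (X m) n) (seq_of (X k) n) < e"
      by blast
  qed
  then have "\<forall>n. \<exists>c. (\<lambda>k. seq_of (X k) n) \<longlonglongrightarrow> c"
    by (simp add: Cauchy_convergent_iff convergent_def)
  then obtain w where w: "(\<lambda>k. seq_of (X k) n) \<longlonglongrightarrow> w n" for n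
    using choice[of "\<lambda>n c. (\<lambda>k. seq_of (X k) n) \<longlonglongrightarrow> c"] by blast
  \<comment> \<open>Cauchy bounds survive the coordinatewise limit on finite sets, with a constant
    independent of \<open>F\<close>; this yields both square summability of \<open>w\<close> and
    convergence in norm.\<close>
  have tail: "(\<Sum>n\<in>F. (cmod (seq_of (X k) n - w n))\<^sup>2) \<le> e\<^sup>2"
    if "finite F" "\<And>m. m \<ge> k \<Longrightarrow> norm (X k - X m) \<le> e" for F k e
  proof (rule tendsto_upperbound)
    show "(\<lambda>m. \<Sum>n\<in>F. (cmod (seq_of (X k) n - seq_of (X m) n))\<^sup>2) \<longlonglongrightarrow>
      (\<Sum>n\<in>F. (cmod (seq_of (X k) n - w n))\<^sup>2)"
      by (intro tendsto_sum tendsto_power tendsto_norm tendsto_diff tendsto_const w)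
    show "\<forall>\<^sub>F m in sequentially. (\<Sum>n\<in>F. (cmod (seq_of (X k) n - seq_of (X m) n))\<^sup>2) \<le> e\<^sup>2"
      using eventually_ge_at_top[of k]
    proof eventually_elim
      case (elim m)
      have "(\<Sum>n\<in>F. (cmod (seq_of (X k) n - seq_of (X m) n))\<^sup>2) \<le> (norm (X k - X m))\<^sup>2"
        using finite_sum_le_power2_norm_l2[OF that(1), of "X k - X m"] by (simp add: seq_of_diff)
      also have "\<dots> \<le> e\<^sup>2"
        using that(2)[OF elim] by (intro power_mono) auto
      finally show ?case .
    qed
  qed auto
  have close: "\<exists>k. \<forall>m\<ge>k. \<forall>j\<ge>m. norm (X m - X j) \<le> e" if "e > 0" for e
  proof -
    obtain k where k: "norm (X m - X j) < e" if "m \<ge> k" "j \<ge> k" for m j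
      using X \<open>e > 0\<close> unfolding Cauchy_def dist_norm by blast
    have "norm (X m - X j) \<le> e" if "m \<ge> k" "j \<ge> m" for m j
      using k[of m j] that by simp
    then show ?thesis by blast
  qed
  obtain k where k: "\<forall>m\<ge>k. \<forall>j\<ge>m. norm (X m - X j) \<le> 1"
    using close[of 1] by auto
  have "(\<lambda>n. seq_of (X k) n - w n) \<in> ell2"
    unfolding ell2_def mem_Collect_eq
    by (rule nonneg_bdd_above_summable_on)
      (use tail[of _ k 1] k in \<open>auto intro!: bdd_aboveI[of _ 1]\<close>)
  from ell2_add[OF ell2_scaleR[OF this, of "-1"] seq_of_ell2[of "X k"]]
  have "w \<in> ell2" by (simp add: scaleR_minus_left)
  then have sw: "seq_of (l2_of w) = w"
    by (rule l2_of_inverse)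
  have "X \<longlonglongrightarrow> l2_of w"
  proof (rule metric_LIMSEQ_I)
    fix e :: real assume e: "e > 0"
    obtain k where k: "\<forall>m\<ge>k. \<forall>j\<ge>m. norm (X m - X j) \<le> e / 2"
      using close[of "e/2"] e by auto
    have "norm (X m - l2_of w) \<le> e / 2" if "m \<ge> k" for m
      using tail[of _ m "e/2"] k that e by (intro l2_norm_leI) (auto simp: seq_of_diff sw)
    then show "\<exists>k. \<forall>m\<ge>k. dist (X m) (l2_of w) < e"
      using e by (intro exI[of _ k]) (auto simp: dist_norm intro: le_less_trans[of _ "e/2"])
  qed
  then show "convergent X"
    by (rule convergentI)
qed

section \<open>Jacobi operators with bounded potential\<close>

definition jacobi :: "(int \<Rightarrow> real) \<Rightarrow> (int \<Rightarrow> complex) \<Rightarrow> int \<Rightarrow> complex" where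
  "jacobi V u = (\<lambda>n. u (n - 1) + u (n + 1) + complex_of_real (V n) * u n)"

definition jacobi_l2 :: "(int \<Rightarrow> real) \<Rightarrow> l2 \<Rightarrow> l2" where
  "jacobi_l2 V u = l2_of (jacobi V (seq_of u))"

lemma jacobi_ell2:
  assumes "\<forall>n. \<bar>V n\<bar> \<le> K" "u \<in> ell2"
  shows "jacobi V u \<in> ell2"
proof -
  have "(\<lambda>n. complex_of_real (V n) * u n) \<in> ell2"
    by (rule ell2_mult_bounded[OF assms(2), of _ K]) (use assms(1) in auto)
  from ell2_add[OF ell2_add[OF ell2_shift[OF assms(2), of "-1"] ell2_shift[OF assms(2), of 1]] this]
  show ?thesis
    by (simp add: jacobi_def)
qed

lemma seq_of_jacobi_l2:
  assumes "\<forall>n. \<bar>V n\<bar> \<le> K"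
  shows "seq_of (jacobi_l2 V u) = jacobi V (seq_of u)"
  unfolding jacobi_l2_def by (rule l2_of_inverse) (rule jacobi_ell2[OF assms seq_of_ell2])

lemma norm_shift_l2: "norm (l2_of (\<lambda>n. seq_of u (n + k))) = norm u"
proof -
  have "bij (\<lambda>n::int. n + k)"
    by (rule bij_betw_byWitness[of _ "\<lambda>n. n - k"]) auto
  then show ?thesis
    using infsum_reindex_bij_betw[of "\<lambda>n. n + k" UNIV UNIV "\<lambda>n. (cmod (seq_of u n))\<^sup>2"]
    by (simp add: norm_eq_ell2_norm ell2_norm_def l2_of_inverse[OF ell2_shift[OF seq_of_ell2]])
qed

text \<open>The two shifts are isometries and multiplication by \<open>V\<close> has norm at most
  \<open>K\<close>.\<close>

lemma norm_jacobi_l2_le: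
  assumes V: "\<forall>n. \<bar>V n\<bar> \<le> K"
  shows "norm (jacobi_l2 V u) \<le> (K + 2) * norm u"
proof -
  have K: "0 \<le> K" using V by (meson abs_ge_zero order_trans)
  let ?a = "l2_of (\<lambda>n. seq_of u (n + (-1)))" and ?b = "l2_of (\<lambda>n. seq_of u (n + 1))"
    and ?c = "l2_of (\<lambda>n. complex_of_real (V n) * seq_of u n)"
  have sc: "seq_of ?c = (\<lambda>n. complex_of_real (V n) * seq_of u n)"
    by (rule l2_of_inverse, rule ell2_mult_bounded[OF seq_of_ell2, of _ K]) (use V in auto)
  have sa: "seq_of ?a = (\<lambda>n. seq_of u (n + (-1)))" and sb: "seq_of ?b = (\<lambda>n. seq_of u (n + 1))"
    by (rule l2_of_inverse, rule ell2_shift[OF seq_of_ell2])+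
  have "norm ?c \<le> K * norm u"
  proof (rule l2_norm_leI)
    fix F :: "int set" assume F: "finite F"
    have "(\<Sum>n\<in>F. (cmod (seq_of ?c n))\<^sup>2) \<le> (\<Sum>n\<in>F. K\<^sup>2 * (cmod (seq_of u n))\<^sup>2)"
      unfolding sc norm_mult power_mult_distrib
      by (intro sum_mono mult_right_mono) (use V K in \<open>auto simp: abs_le_square_iff[symmetric]\<close>)
    also have "\<dots> \<le> (K * norm u)\<^sup>2"
      unfolding sum_distrib_left[symmetric] power_mult_distrib
      by (intro mult_left_mono finite_sum_le_power2_norm_l2 F) auto
    finally show "(\<Sum>n\<in>F. (cmod (seq_of ?c n))\<^sup>2) \<le> (K * norm u)\<^sup>2" .
  qed (use K in auto)
  moreover have "jacobi_l2 V u = ?a + ?b + ?c"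
    unfolding seq_of_inject[symmetric] seq_of_jacobi_l2[OF V] seq_of_add sa sb sc
    by (simp add: jacobi_def)
  ultimately show ?thesis
    using norm_triangle_ineq[of "?a + ?b" ?c] norm_triangle_ineq[of ?a ?b]
      norm_shift_l2[of u 1] norm_shift_l2[of u "-1"]
    by (simp add: algebra_simps)
qed

lemma bounded_linear_jacobi_l2:
  assumes V: "\<forall>n. \<bar>V n\<bar> \<le> K"
  shows "bounded_linear (jacobi_l2 V)"
proof (rule bounded_linear_intro)
  show "norm (jacobi_l2 V u) \<le> norm u * (K + 2)" for u
    using norm_jacobi_l2_le[OF V, of u] by (simp add: mult.commute)
next
  fix u v :: l2 and r :: real
  have "seq_of (jacobi_l2 V (u + v)) = seq_of (jacobi_l2 V u + jacobi_l2 V v)"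
    unfolding seq_of_jacobi_l2[OF V] seq_of_add unfolding jacobi_def by (rule ext) algebra
  then show "jacobi_l2 V (u + v) = jacobi_l2 V u + jacobi_l2 V v"
    by (simp add: seq_of_inject)
  have "seq_of (jacobi_l2 V (r *\<^sub>R u)) = seq_of (r *\<^sub>R jacobi_l2 V u)"
    unfolding seq_of_jacobi_l2[OF V] seq_of_scaleR unfolding jacobi_def scaleR_conv_of_real
    by (rule ext) algebra
  then show "jacobi_l2 V (r *\<^sub>R u) = r *\<^sub>R jacobi_l2 V u"
    by (simp add: seq_of_inject)
qed

lemma infsum_shift: "(\<Sum>\<^sub>\<infinity>n. f (n + k)) = (\<Sum>\<^sub>\<infinity>n. f (n::int))"
proof -
  have "bij (\<lambda>n::int. n + k)"
    by (rule bij_betw_byWitness[of _ "\<lambda>n. n - k"]) auto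
  from infsum_reindex_bij_betw[OF this, of f] show ?thesis
    by simp
qed

text \<open>The two shift terms trade places under reindexing, and the potential is real.\<close>

lemma ell2_inner_jacobi:
  assumes V: "\<forall>n. \<bar>V n\<bar> \<le> K" and "u \<in> ell2" "v \<in> ell2"
  shows "ell2_inner (jacobi V u) v = ell2_inner u (jacobi V v)"
proof -
  have s: "(\<lambda>n. cnj (a n) * b n) summable_on UNIV" if "a \<in> ell2" "b \<in> ell2" for a b :: "int \<Rightarrow> complex"
    by (rule abs_summable_summable[OF ell2_inner_summable[OF that]])
  have sh: "(\<lambda>n. a (n + 1)) \<in> ell2" "(\<lambda>n. a (n - 1)) \<in> ell2" if "a \<in> ell2" for a :: "int \<Rightarrow> complex"
    using ell2_shift[OF that, of 1] ell2_shift[OF that, of "-1"] by simp_all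
  have m: "(\<lambda>n. complex_of_real (V n) * u n) \<in> ell2"
    by (rule ell2_mult_bounded[OF assms(2), of _ K]) (use assms in auto)
  define A where "A = (\<lambda>n. cnj (u (n - 1)) * v n)"
  define B where "B = (\<lambda>n. cnj (u (n + 1)) * v n)"
  define C where "C = (\<lambda>n. cnj (complex_of_real (V n) * u n) * v n)"
  define A' where "A' = (\<lambda>n. cnj (u n) * v (n + 1))"
  define B' where "B' = (\<lambda>n. cnj (u n) * v (n - 1))"
  have sA: "A summable_on UNIV" and sB: "B summable_on UNIV" and sC: "C summable_on UNIV"
    and sA': "A' summable_on UNIV" and sB': "B' summable_on UNIV"
    unfolding A_def B_def C_def A'_def B'_def
    using s[OF sh(2)[OF assms(2)] assms(3)] s[OF sh(1)[OF assms(2)] assms(3)] s[OF m assms(3)]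
      s[OF assms(2) sh(1)[OF assms(3)]] s[OF assms(2) sh(2)[OF assms(3)]] by blast+
  have "ell2_inner (jacobi V u) v = (\<Sum>\<^sub>\<infinity>n. A n + B n + C n)"
    by (simp add: ell2_inner_def jacobi_def A_def B_def C_def algebra_simps)
  also have "\<dots> = infsum A UNIV + infsum B UNIV + infsum C UNIV"
    using infsum_add[OF summable_on_add[OF sA sB] sC] infsum_add[OF sA sB] by simp
  also have "infsum A UNIV = infsum A' UNIV"
    using infsum_shift[of A 1] by (simp add: A_def A'_def)
  also have "infsum B UNIV = infsum B' UNIV"
    using infsum_shift[of B "-1"] by (simp add: B_def B'_def)
  also have "infsum A' UNIV + infsum B' UNIV + infsum C UNIV = (\<Sum>\<^sub>\<infinity>n. A' n + B' n + C n)"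
    using infsum_add[OF summable_on_add[OF sA' sB'] sC] infsum_add[OF sA' sB'] by simp
  also have "\<dots> = ell2_inner u (jacobi V v)"
    by (simp add: ell2_inner_def jacobi_def A'_def B'_def C_def algebra_simps)
  finally show ?thesis .
qed

lemma inner_l2_eq: "u \<bullet> v = Re (ell2_inner (seq_of u) (seq_of v))"
  by (simp add: inner_l2_def Re_ell2_inner)

lemma inner_jacobi_l2:
  assumes "\<forall>n. \<bar>V n\<bar> \<le> K"
  shows "jacobi_l2 V u \<bullet> v = u \<bullet> jacobi_l2 V v"
  by (simp add: inner_l2_eq seq_of_jacobi_l2[OF assms] ell2_inner_jacobi[OF assms])

section \<open>Finite-volume Green's functions\<close>

text \<open>Stage \<open>n\<close> holds the values at the sites \<open>n\<close> and
  \<open>n + 1\<close>, which makes the second order recurrence primitive recursive;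
  \<open>sol_down\<close> holds those at \<open>- n\<close> and \<open>- n + 1\<close>.\<close>

primrec sol_up :: "(int \<Rightarrow> real) \<Rightarrow> complex \<Rightarrow> complex \<Rightarrow> complex \<Rightarrow> nat \<Rightarrow> complex \<times> complex" where
  "sol_up V z a b 0 = (a, b)"
| "sol_up V z a b (Suc n) = (snd (sol_up V z a b n),
     (z - complex_of_real (V (int n + 1))) * snd (sol_up V z a b n) - fst (sol_up V z a b n))"

primrec sol_down :: "(int \<Rightarrow> real) \<Rightarrow> complex \<Rightarrow> complex \<Rightarrow> complex \<Rightarrow> nat \<Rightarrow> complex \<times> complex" where
  "sol_down V z a b 0 = (a, b)"
| "sol_down V z a b (Suc n) =
     ((z - complex_of_real (V (- int n))) * fst (sol_down V z a b n) - snd (sol_down V z a b n),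
      fst (sol_down V z a b n))"

definition sol :: "(int \<Rightarrow> real) \<Rightarrow> complex \<Rightarrow> complex \<Rightarrow> complex \<Rightarrow> int \<Rightarrow> complex" where
  "sol V z a b n = (if n \<ge> 0 then fst (sol_up V z a b (nat n)) else fst (sol_down V z a b (nat (- n))))"

lemma sol_0 [simp]: "sol V z a b 0 = a" and sol_1 [simp]: "sol V z a b 1 = b"
  by (simp_all add: sol_def)

lemma jacobi_sol: "jacobi V (sol V z a b) n = z * sol V z a b n"
proof -
  consider m where "n = int (Suc m)" | "n = 0" | m where "n = - int (Suc m)"
    by (metis int_cases nat.exhaust of_nat_0)
  then show ?thesis
  proof cases
    case 1
    then have "nat n = Suc m" "nat (n - 1) = m" "nat (n + 1) = Suc (Suc m)" by auto
    with 1 show ?thesis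
      by (simp add: jacobi_def sol_def algebra_simps)
  next
    case 2
    then show ?thesis
      by (simp add: jacobi_def sol_def algebra_simps)
  next
    case 3
    then have e: "nat (- n) = Suc m" "nat (- (n - 1)) = Suc (Suc m)" "nat (- (n + 1)) = m" by auto
    have "sol V z a b (n + 1) = fst (sol_down V z a b m)"
      using 3 e(3) by (cases m) (auto simp: sol_def)
    moreover have "sol V z a b n = fst (sol_down V z a b (Suc m))"
      "sol V z a b (n - 1) = fst (sol_down V z a b (Suc (Suc m)))"
      using 3 e by (simp_all add: sol_def del: sol_down.simps)
    moreover have "- int (Suc m) = n" using 3 by simp
    ultimately have "sol V z a b (n - 1) = (z - complex_of_real (V n)) * sol V z a b n - sol V z a b (n + 1)"
      by simp
    then show ?thesis
      by (simp add: jacobi_def algebra_simps)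
  qed
qed

lemma sol_holomorphic: "(\<lambda>z. sol V z a b n) holomorphic_on A"
proof -
  have "(\<lambda>z. fst (sol_up V z a b m)) holomorphic_on A \<and> (\<lambda>z. snd (sol_up V z a b m)) holomorphic_on A" for m
    by (induction m) (auto intro!: holomorphic_intros)
  moreover have "(\<lambda>z. fst (sol_down V z a b m)) holomorphic_on A \<and> (\<lambda>z. snd (sol_down V z a b m)) holomorphic_on A" for m
    by (induction m) (auto intro!: holomorphic_intros)
  ultimately show ?thesis
    unfolding sol_def by (cases "n \<ge> 0") simp_all
qed

text \<open>The discrete Wronskian.\<close>

definition casoratian :: "(int \<Rightarrow> complex) \<Rightarrow> (int \<Rightarrow> complex) \<Rightarrow> int \<Rightarrow> complex" where
  "casoratian u v n = u (n + 1) * v n - u n * v (n + 1)"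

text \<open>Both uses come from here: for two solutions the right-hand side vanishes, and for a
  Green's function against a solution it is the value of the solution at the source.\<close>

lemma casoratian_step:
  "casoratian u v n - casoratian u v (n - 1) =
     (jacobi V u n - z * u n) * v n - u n * (jacobi V v n - z * v n)"
  by (simp add: casoratian_def jacobi_def algebra_simps)

lemma casoratian_const:
  assumes "\<And>n. jacobi V u n = z * u n" "\<And>n. jacobi V v n = z * v n"
  shows "casoratian u v n = casoratian u v m"
proof -
  have step: "casoratian u v k = casoratian u v (k - 1)" for k
    using casoratian_step[of u v k V z] assms by simp
  have "casoratian u v k = casoratian u v 0" for k
  proof (induction k rule: int_induct[of _ 0])
    case (step1 i)
    then show ?case using step[of "i + 1"] by simp
  next
    case (step2 i)
    then show ?case using step[of i] by simp
  qed simp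
  then show ?thesis by metis
qed

lemma jacobi_lin: "jacobi V (\<lambda>n. a * u n - b * v n) n = a * jacobi V u n - b * jacobi V v n"
  by (simp add: jacobi_def algebra_simps)

lemma casoratian_lin:
  "casoratian (\<lambda>n. a * u n - b * v n) w n = a * casoratian u w n - b * casoratian v w n"
  "casoratian w (\<lambda>n. a * u n - b * v n) n = a * casoratian w u n - b * casoratian w v n"
  by (simp_all add: casoratian_def algebra_simps)

text \<open>Green's identity: the Dirichlet restriction to a box is a symmetric matrix.\<close>

lemma box_energy:
  fixes g :: "int \<Rightarrow> complex" and N :: int
  assumes "0 \<le> N" "g (- N - 1) = 0" "g (N + 1) = 0"
  shows "Im (\<Sum>n\<in>{-N..N}. cnj (g n) * (jacobi V g n - z * g n)) = - Im z * (\<Sum>n\<in>{-N..N}. (cmod (g n))\<^sup>2)"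
proof -
  define S where "S = (\<Sum>n\<in>{-N-1..N}. cnj (g n) * g (n + 1))"
  have "(\<Sum>n\<in>{-N..N}. cnj (g n) * g (n + 1)) = S"
    unfolding S_def
  proof (rule sum.mono_neutral_left)
    show "\<forall>i\<in>{- N - 1..N} - {- N..N}. cnj (g i) * g (i + 1) = 0"
    proof
      fix i assume "i \<in> {- N - 1..N} - {- N..N}"
      then have "i = - N - 1" by auto
      then show "cnj (g i) * g (i + 1) = 0" using assms by simp
    qed
  qed auto
  moreover have "(\<Sum>n\<in>{-N..N}. cnj (g n) * g (n - 1)) = (\<Sum>n\<in>{-N-1..N-1}. cnj (g (n + 1)) * g n)"
    by (rule sum.reindex_bij_witness[of _ "\<lambda>n. n + 1" "\<lambda>n. n - 1"]) auto
  moreover have "\<dots> = (\<Sum>n\<in>{-N-1..N}. cnj (g (n + 1)) * g n)"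
  proof (rule sum.mono_neutral_left)
    show "\<forall>i\<in>{- N - 1..N} - {- N - 1..N - 1}. cnj (g (i + 1)) * g i = 0"
    proof
      fix i assume "i \<in> {- N - 1..N} - {- N - 1..N - 1}"
      then have "i = N" by auto
      then show "cnj (g (i + 1)) * g i = 0" using assms by simp
    qed
  qed auto
  moreover have "\<dots> = cnj S"
    by (simp add: S_def mult.commute)
  \<comment> \<open>The hopping terms add up to the real number \<open>cnj S + S\<close>, and the
    potential is real, so that only \<open>z\<close> contributes to the imaginary part.\<close>
  ultimately have off: "(\<Sum>n\<in>{-N..N}. cnj (g n) * g (n - 1)) + (\<Sum>n\<in>{-N..N}. cnj (g n) * g (n + 1)) = cnj S + S"
    by simp
  have "cnj (g n) * (jacobi V g n - z * g n) = cnj (g n) * g (n - 1) + cnj (g n) * g (n + 1)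
      + (complex_of_real (V n) - z) * complex_of_real ((cmod (g n))\<^sup>2)" for n
    unfolding complex_norm_square by (simp add: jacobi_def algebra_simps)
  then have "(\<Sum>n\<in>{-N..N}. cnj (g n) * (jacobi V g n - z * g n)) =
      (cnj S + S) + (\<Sum>n\<in>{-N..N}. (complex_of_real (V n) - z) * complex_of_real ((cmod (g n))\<^sup>2))"
    by (simp add: sum.distrib off)
  then show ?thesis
    by (simp add: sum_negf sum_distrib_left)
qed

text \<open>The solution with zero boundary value at \<open>- N - 1\<close>, written as a
  determinant of boundary data so that it is holomorphic in \<open>z\<close>. In the same way
  \<open>box_right\<close> vanishes at \<open>N + 1\<close>.\<close>

definition box_left :: "(int \<Rightarrow> real) \<Rightarrow> int \<Rightarrow> complex \<Rightarrow> int \<Rightarrow> complex" where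
  "box_left V N z n = sol V z 1 0 (- N - 1) * sol V z 0 1 n - sol V z 0 1 (- N - 1) * sol V z 1 0 n"

definition box_right :: "(int \<Rightarrow> real) \<Rightarrow> int \<Rightarrow> complex \<Rightarrow> int \<Rightarrow> complex" where
  "box_right V N z n = sol V z 1 0 (N + 1) * sol V z 0 1 n - sol V z 0 1 (N + 1) * sol V z 1 0 n"

text \<open>It vanishes when \<open>box_left\<close> meets the right boundary condition as well,
  that is, at the Dirichlet eigenvalues of the box.\<close>

definition box_det :: "(int \<Rightarrow> real) \<Rightarrow> int \<Rightarrow> complex \<Rightarrow> complex" where
  "box_det V N z = box_left V N z (N + 1)"

definition box_green :: "(int \<Rightarrow> real) \<Rightarrow> int \<Rightarrow> complex \<Rightarrow> int \<Rightarrow> int \<Rightarrow> complex" where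
  "box_green V N z m n = box_left V N z (min m n) * box_right V N z (max m n) / box_det V N z"

lemma box_green_commute: "box_green V N z m n = box_green V N z n m"
  by (simp add: box_green_def min.commute max.commute)

lemma jacobi_box_left: "jacobi V (box_left V N z) n = z * box_left V N z n"
  unfolding box_left_def jacobi_lin by (simp add: jacobi_sol algebra_simps)

lemma jacobi_box_right: "jacobi V (box_right V N z) n = z * box_right V N z n"
  unfolding box_right_def jacobi_lin by (simp add: jacobi_sol algebra_simps)

lemma casoratian_fundamental: "casoratian (sol V z 0 1) (sol V z 1 0) n = 1"
proof -
  have "casoratian (sol V z 0 1) (sol V z 1 0) n = casoratian (sol V z 0 1) (sol V z 1 0) 0"
    by (rule casoratian_const[of V _ z]) (simp_all add: jacobi_sol)
  then show ?thesis
    by (simp add: casoratian_def)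
qed

lemma casoratian_box: "casoratian (box_left V N z) (box_right V N z) n = - box_det V N z"
proof -
  have 0: "casoratian u u n = 0" for u
    by (simp add: casoratian_def)
  have 1: "casoratian (sol V z 1 0) (sol V z 0 1) n = - 1"
    using casoratian_fundamental[of V z n] by (simp add: casoratian_def algebra_simps)
  show ?thesis
    unfolding box_left_def[abs_def] box_right_def[abs_def] box_det_def casoratian_lin
    by (simp add: 0 1 casoratian_fundamental box_left_def algebra_simps)
qed

text \<open>At a zero, \<open>box_left\<close> would be a Dirichlet eigenfunction of a symmetric
  matrix for a nonreal eigenvalue. By \<open>box_energy\<close> it vanishes on the box, so both of
  its coefficients vanish, against the Casoratian 1 of the fundamental solutions.\<close>

lemma box_det_nonzero:
  assumes "Im z > 0" "0 \<le> N"
  shows "box_det V N z \<noteq> 0"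
proof
  assume d: "box_det V N z = 0"
  let ?g = "box_left V N z"
  have b: "?g (- N - 1) = 0" "?g (N + 1) = 0"
    using d by (simp_all add: box_left_def box_det_def)
  have "Im z * (\<Sum>n\<in>{-N..N}. (cmod (?g n))\<^sup>2) = 0"
    using box_energy[of N ?g V z] assms b by (simp add: jacobi_box_left)
  then have "\<forall>n\<in>{-N..N}. (cmod (?g n))\<^sup>2 = 0"
    using assms by (subst (asm) mult_eq_0_iff) (auto simp: sum_nonneg_eq_0_iff)
  \<comment> \<open>For \<open>N = 0\<close> the site 1 is the boundary site \<open>N + 1\<close>
    rather than a site of the box.\<close>
  then have "?g 0 = 0" "?g 1 = 0"
    using assms b by (auto simp: le_less)
  then have "sol V z 0 1 (- N - 1) = 0" "sol V z 1 0 (- N - 1) = 0"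
    by (simp_all add: box_left_def)
  then show False
    using casoratian_fundamental[of V z "- N - 1"] by (simp add: casoratian_def)
qed

text \<open>Away from the source the three sites of the equation lie on one branch of the product,
  which solves the homogeneous equation. At the source the mismatch of the branches is the
  Casoratian, and the denominator normalizes it to 1.\<close>

lemma jacobi_box_green:
  assumes "box_det V N z \<noteq> 0"
  shows "jacobi V (\<lambda>n. box_green V N z n j) n - z * box_green V N z n j = (if n = j then 1 else 0)"
proof -
  let ?l = "box_left V N z" and ?r = "box_right V N z" and ?d = "box_det V N z"
  note jl = jacobi_box_left[of V N z n, unfolded jacobi_def]
  note jr = jacobi_box_right[of V N z n, unfolded jacobi_def]
  have jl': "?l (n - 1) = z * ?l n - complex_of_real (V n) * ?l n - ?l (n + 1)"
    using jl by (simp add: algebra_simps)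
  have jr': "?r (n - 1) = z * ?r n - complex_of_real (V n) * ?r n - ?r (n + 1)"
    using jr by (simp add: algebra_simps)
  consider "n < j" | "n = j" | "n > j" by linarith
  then show ?thesis
  proof cases
    case 1
    then show ?thesis
      by (simp add: jacobi_def box_green_def min_def max_def jl' divide_simps assms algebra_simps)
  next
    case 2
    have "?l n * ?r (n + 1) - ?l (n + 1) * ?r n = ?d"
      using casoratian_box[of V N z n] by (simp add: casoratian_def algebra_simps)
    moreover have "min (n - 1) n = n - 1" "max (n - 1) n = n" "min (n + 1) n = n" "max (n + 1) n = n + 1"
      by auto
    ultimately show ?thesis
      unfolding 2[symmetric] by (simp add: jacobi_def box_green_def jl' divide_simps assms algebra_simps)
  next
    case 3
    then have "min (n - 1) j = j" "max (n - 1) j = n - 1" "min n j = j" "max n j = n"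
        "min (n + 1) j = j" "max (n + 1) j = n + 1" "n \<noteq> j"
      by auto
    then show ?thesis
      by (simp add: jacobi_def box_green_def jr' divide_simps assms algebra_simps)
  qed
qed

lemma box_green_boundary:
  assumes "- N - 1 \<le> j" "j \<le> N + 1"
  shows "box_green V N z (- N - 1) j = 0" "box_green V N z (N + 1) j = 0"
  using assms by (simp_all add: box_green_def box_left_def box_right_def min_def max_def)

text \<open>The quadratic form of the box resolvent at the sum of the unit vectors at
  \<open>m\<close> and \<open>j\<close>. For \<open>m = j\<close> it is four times the diagonal
  entry.\<close>

definition herglotz :: "(int \<Rightarrow> real) \<Rightarrow> int \<Rightarrow> complex \<Rightarrow> int \<Rightarrow> int \<Rightarrow> complex" where
  "herglotz V N z m j = box_green V N z m m + box_green V N z j j + 2 * box_green V N z m j"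

text \<open>Let \<open>g\<close> be the resolvent applied to the two unit vectors and
  \<open>S\<close> its squared norm. Pairing the equation with \<open>g\<close> gives
  \<open>Im F = Im z * S\<close>, and \<open>S\<close> cannot vanish because the equation for
  \<open>g\<close> has a source.\<close>

lemma herglotz_bounds:
  assumes z: "Im z > 0" and N: "0 \<le> N" and m: "m \<in> {-N..N}" and j: "j \<in> {-N..N}"
  shows "Im (herglotz V N z m j) > 0" "cmod (herglotz V N z m j) \<le> 4 / Im z"
proof -
  let ?G = "box_green V N z" and ?F = "herglotz V N z m j"
  define g where "g = (\<lambda>n. ?G n m + ?G n j)"
  define S where "S = (\<Sum>n\<in>{-N..N}. (cmod (g n))\<^sup>2)"
  note d = box_det_nonzero[OF z N, of V]
  have src: "jacobi V g n - z * g n = (if n = m then 1 else 0) + (if n = j then 1 else 0)" for n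
  proof -
    have "jacobi V g n - z * g n = (jacobi V (\<lambda>n. ?G n m) n - z * ?G n m) + (jacobi V (\<lambda>n. ?G n j) n - z * ?G n j)"
      by (simp add: g_def jacobi_def algebra_simps)
    then show ?thesis
      by (simp only: jacobi_box_green[OF d])
  qed
  have bd: "g (- N - 1) = 0" "g (N + 1) = 0"
    using box_green_boundary[of N m V z] box_green_boundary[of N j V z] m j by (simp_all add: g_def)
  have F: "?F = g m + g j"
    by (simp add: herglotz_def g_def box_green_commute[of V N z j m])
  have "(\<Sum>n\<in>{-N..N}. cnj (g n) * (jacobi V g n - z * g n)) =
      (\<Sum>n\<in>{-N..N}. (if n = m then cnj (g n) else 0) + (if n = j then cnj (g n) else 0))"
    by (rule sum.cong) (auto simp: src)
  also have "\<dots> = cnj ?F"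
    using m j by (simp add: sum.distrib F)
  finally have Im: "Im ?F = Im z * S"
    using box_energy[OF N bd, of V z] by (simp add: S_def)
  have le: "(cmod (g n))\<^sup>2 \<le> S" if "n \<in> {-N..N}" for n
    unfolding S_def using that by (intro member_le_sum) auto
  have "S \<noteq> 0"
  proof
    assume "S = 0"
    then have "g n = 0" if "n \<in> {-N-1..N+1}" for n
    proof (cases "n \<in> {-N..N}")
      case True
      then show ?thesis using le[OF True] \<open>S = 0\<close> by simp
    next
      case False
      then have "n = - N - 1 \<or> n = N + 1" using that by auto
      then show ?thesis using bd by auto
    qed
    then have "jacobi V g m - z * g m = 0"
      using m by (simp add: jacobi_def)
    then show False
      using src[of m] by (simp split: if_splits)
  qed
  then have "S > 0"
    using le[OF m] by (smt (verit) zero_le_power2)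
  then show "Im ?F > 0"
    using Im z by simp
  have "(cmod ?F)\<^sup>2 \<le> (cmod (g m) + cmod (g j))\<^sup>2"
    unfolding F by (intro power_mono norm_triangle_ineq) auto
  also have "\<dots> \<le> 2 * (cmod (g m))\<^sup>2 + 2 * (cmod (g j))\<^sup>2"
    using sum_squares_bound[of "cmod (g m)" "cmod (g j)"] by (simp add: power2_sum)
  also have "\<dots> \<le> 4 * S"
    using le[OF m] le[OF j] by simp
  \<comment> \<open>The bound \<open>4 * S\<close> for the square of the modulus becomes a bound in
    terms of \<open>F\<close> alone, since \<open>Im z * S = Im F\<close> is at most the modulus of
    \<open>F\<close>.\<close>
  finally have "(cmod ?F)\<^sup>2 * Im z \<le> 4 * cmod ?F"
    using Im z abs_Im_le_cmod[of ?F] by (auto simp: algebra_simps intro: order_trans[OF mult_left_mono[of _ _ "Im z"]])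
  moreover have "cmod ?F > 0"
    using \<open>Im ?F > 0\<close> by auto
  ultimately show "cmod ?F \<le> 4 / Im z"
    using z by (simp add: power2_eq_square field_simps)
qed

lemma box_green_holomorphic:
  assumes "0 \<le> N"
  shows "(\<lambda>z. box_green V N z m j) holomorphic_on {z. Im z > 0}"
  unfolding box_green_def box_left_def box_right_def
  by (intro holomorphic_on_divide holomorphic_on_mult holomorphic_on_diff sol_holomorphic)
    (use box_det_nonzero[OF _ assms] in \<open>auto simp: box_det_def box_left_def intro!: holomorphic_on_mult holomorphic_on_diff sol_holomorphic\<close>)

lemma herglotz_holomorphic:
  assumes "0 \<le> N"
  shows "(\<lambda>z. herglotz V N z m j) holomorphic_on {z. Im z > 0}"
  unfolding herglotz_def
  by (intro holomorphic_on_add holomorphic_on_mult holomorphic_on_const box_green_holomorphic assms)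

section \<open>Circle means and the Cayley transform\<close>

definition disc_path :: "real \<Rightarrow> real \<Rightarrow> complex" where
  "disc_path \<rho> t = complex_of_real \<rho> * exp (2 * of_real pi * \<i> * of_real t)"

lemma norm_disc_path [simp]: "norm (disc_path \<rho> t) = \<bar>\<rho>\<bar>"
  by (simp add: disc_path_def norm_mult)

text \<open>Mean value property for the square root, which dominates the modulus up to a factor because
  its values lie in a sector.\<close>

lemma sqrt_mean_disc:
  assumes f: "f holomorphic_on ball 0 1" and pos: "\<And>w. w \<in> ball 0 1 \<Longrightarrow> Re (f w) > 0"
    and \<rho>: "0 < \<rho>" "\<rho> < 1"
  shows "(\<integral>\<^sup>+t. ennreal (sqrt (cmod (f (disc_path \<rho> t)))) * indicator {0..1} t \<partial>lborel)
    \<le> ennreal (2 * sqrt (cmod (f 0)))"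
proof -
  define s where "s = (\<lambda>w. csqrt (f w))"
  have "f w \<notin> \<real>\<^sub>\<le>\<^sub>0" if "w \<in> ball 0 1" for w
    using pos[OF that] by (auto simp: complex_nonpos_Reals_iff)
  then have hol: "s holomorphic_on ball 0 1"
    unfolding s_def by (intro holomorphic_on_csqrt' f)
  have cs: "cball 0 \<rho> \<subseteq> ball (0::complex) 1"
    using \<rho> by auto
  have "((\<lambda>u. s u / (u - 0)) has_contour_integral (2 * of_real pi * \<i> * s 0)) (circlepath 0 \<rho>)"
    by (rule Cauchy_integral_circlepath_simple) (use \<rho> holomorphic_on_subset[OF hol cs] in auto)
  then have "((\<lambda>t. s (circlepath 0 \<rho> t) / circlepath 0 \<rho> t *
      vector_derivative (circlepath 0 \<rho>) (at t within {0..1})) has_integral 2 * of_real pi * \<i> * s 0) {0..1}"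
    by (simp add: has_contour_integral_def)
  then have "((\<lambda>t. (2 * of_real pi * \<i>) * s (disc_path \<rho> t)) has_integral (2 * of_real pi * \<i>) * s 0) {0..1}"
  proof (rule has_integral_eq[rotated])
    fix t :: real assume t: "t \<in> {0..1}"
    have c: "circlepath 0 \<rho> t = disc_path \<rho> t"
      by (simp add: circlepath disc_path_def)
    have "vector_derivative (circlepath 0 \<rho>) (at t within {0..1}) = 2 * of_real pi * \<i> * disc_path \<rho> t"
      using t by (subst vector_derivative_circlepath01) (auto simp: disc_path_def)
    moreover have "disc_path \<rho> t \<noteq> 0"
      using \<rho> by (simp add: disc_path_def)
    ultimately show "s (circlepath 0 \<rho> t) / circlepath 0 \<rho> t * vector_derivative (circlepath 0 \<rho>) (at t within {0..1})
        = (2 * of_real pi * \<i>) * s (disc_path \<rho> t)"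
      unfolding c by simp
  qed
  from has_integral_mult_right[OF this, of "inverse (2 * of_real pi * \<i>)"]
  have "((\<lambda>t. s (disc_path \<rho> t)) has_integral s 0) {0..1}"
    by (simp add: field_simps)
  from has_integral_linear[OF this bounded_linear_Re]
  have int: "((\<lambda>t. Re (s (disc_path \<rho> t))) has_integral Re (s 0)) {0..1}"
    by (simp add: o_def)
  have le: "sqrt (cmod (f w)) \<le> 2 * Re (s w)" if "w \<in> ball 0 1" for w
  proof -
    have sq: "(s w)\<^sup>2 = f w" by (simp add: s_def)
    then have "(Re (s w))\<^sup>2 - (Im (s w))\<^sup>2 > 0"
      using pos[OF that] by (metis Re_power2)
    then have "\<bar>Im (s w)\<bar> \<le> \<bar>Re (s w)\<bar>"
      by (simp add: abs_le_square_iff)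
    moreover have "Re (s w) \<ge> 0"
      unfolding s_def using csqrt_principal[of "f w"] by auto
    moreover have "sqrt (cmod (f w)) = cmod (s w)"
      unfolding sq[symmetric] by (simp add: norm_power)
    ultimately show ?thesis
      using cmod_le[of "s w"] by linarith
  qed
  have inb: "disc_path \<rho> t \<in> ball 0 1" for t
    using \<rho> by simp
  have nn: "0 \<le> Re (s (disc_path \<rho> t))" for t
    using le[OF inb[of t]] real_sqrt_ge_zero[OF norm_ge_zero, of "f (disc_path \<rho> t)"] by linarith
  have "(\<integral>\<^sup>+t. ennreal (sqrt (cmod (f (disc_path \<rho> t)))) * indicator {0..1} t \<partial>lborel)
      \<le> (\<integral>\<^sup>+t. ennreal (2 * Re (s (disc_path \<rho> t))) * indicator {0..1} t \<partial>lborel)"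
    by (intro nn_integral_mono mult_right_mono ennreal_leI le inb) auto
  also have "\<dots> = ennreal (2 * Re (s 0))"
    by (rule nn_integral_has_integral_lebesgue'[OF _ has_integral_mult_right[OF int]]) (use nn in auto)
  also have "\<dots> \<le> ennreal (2 * sqrt (cmod (f 0)))"
    using complex_Re_le_cmod[of "s 0"] by (intro ennreal_leI) (simp add: s_def cmod_def norm_csqrt)
  finally show ?thesis .
qed

text \<open>The conformal map of the unit disc to the upper half-plane that sends 0 to
  \<open>\<i>\<close> and the boundary point 1 to infinity.\<close>

definition cayley :: "complex \<Rightarrow> complex" where
  "cayley w = \<i> * (1 + w) / (1 - w)"

lemma Im_cayley_pos:
  assumes "w \<in> ball 0 1"
  shows "Im (cayley w) > 0"
proof -
  have w: "cmod w < 1" using assms by simp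
  then have "w \<noteq> 1" by auto
  have "cayley w = \<i> * (1 + w) * cnj (1 - w) / complex_of_real ((cmod (1 - w))\<^sup>2)"
    unfolding cayley_def by (rule complex_div_cnj)
  also have "Im \<dots> = Im (\<i> * (1 + w) * cnj (1 - w)) / (cmod (1 - w))\<^sup>2"
    by (rule Im_divide_of_real)
  also have "Im (\<i> * (1 + w) * cnj (1 - w)) = 1 - (cmod w)\<^sup>2"
    unfolding cmod_power2 by (simp add: power2_eq_square algebra_simps)
  finally have "Im (cayley w) = (1 - (cmod w)\<^sup>2) / (cmod (1 - w))\<^sup>2" .
  moreover have "(cmod w)\<^sup>2 < 1"
    using w by (simp add: power_less_one_iff)
  ultimately show ?thesis
    using \<open>w \<noteq> 1\<close> by simp
qed

lemma cayley_holomorphic: "cayley holomorphic_on ball 0 1"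
  unfolding cayley_def by (intro holomorphic_intros) auto

lemma continuous_disc_path: "continuous_on UNIV (\<lambda>t. disc_path \<rho> t)"
  unfolding disc_path_def by (intro continuous_intros)

text \<open>The factor \<open>- \<i>\<close> turns positive imaginary part into positive real part.
  The centre of the disc is the energy \<open>\<i>\<close>, where the resolvent bound is 4 for every
  box, and \<open>2 * sqrt 4 = 4\<close>.\<close>

lemma herglotz_mean:
  assumes N: "0 \<le> N" and "m \<in> {-N..N}" "j \<in> {-N..N}" and \<rho>: "0 < \<rho>" "\<rho> < 1"
  shows "(\<integral>\<^sup>+t. ennreal (sqrt (cmod (herglotz V N (cayley (disc_path \<rho> t)) m j))) * indicator {0..1} t \<partial>lborel) \<le> 4"
proof -
  let ?f = "\<lambda>w. - \<i> * herglotz V N (cayley w) m j"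
  have "(\<lambda>w. herglotz V N (cayley w) m j) holomorphic_on ball 0 1"
    by (rule holomorphic_on_compose_gen[OF cayley_holomorphic herglotz_holomorphic[OF N, of V m j], unfolded o_def])
      (use Im_cayley_pos in auto)
  then have hol: "?f holomorphic_on ball 0 1"
    by (intro holomorphic_intros)
  have pos: "Re (?f w) > 0" if "w \<in> ball 0 1" for w
    using herglotz_bounds(1)[OF Im_cayley_pos[OF that] assms(1-3), of V] by simp
  have "cmod (?f 0) \<le> 4"
    using herglotz_bounds(2)[of \<i>, OF _ assms(1-3), of V] by (simp add: cayley_def norm_mult)
  then have "sqrt (cmod (?f 0)) \<le> sqrt 4"
    by (rule real_sqrt_le_mono)
  then have "ennreal (2 * sqrt (cmod (?f 0))) \<le> ennreal 4"
    by (intro ennreal_leI) simp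
  with sqrt_mean_disc[OF hol pos \<rho>] show ?thesis
    by (simp add: norm_mult)
qed

lemma box_green_continuous:
  assumes "0 \<le> N" "0 < \<rho>" "\<rho> < 1"
  shows "continuous_on UNIV (\<lambda>t. box_green V N (cayley (disc_path \<rho> t)) m j)"
proof (rule continuous_on_compose2[OF holomorphic_on_imp_continuous_on[OF box_green_holomorphic[OF assms(1)]]])
  show "continuous_on UNIV (\<lambda>t. cayley (disc_path \<rho> t))"
    by (rule continuous_on_compose2[OF holomorphic_on_imp_continuous_on[OF cayley_holomorphic] continuous_disc_path])
      (use assms in auto)
  show "(\<lambda>t. cayley (disc_path \<rho> t)) ` UNIV \<subseteq> {z. 0 < Im z}"
    using assms by (auto intro!: Im_cayley_pos)
qed

text \<open>Polarization reads \<open>2 * G m j = F m j - F m m / 4 - F j j / 4\<close>. The square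
  root is subadditive, and each of the three means is at most 4.\<close>

lemma box_green_mean:
  assumes N: "0 \<le> N" and m: "m \<in> {-N..N}" and j: "j \<in> {-N..N}" and \<rho>: "0 < \<rho>" "\<rho> < 1"
  shows "(\<integral>\<^sup>+t. ennreal (sqrt (cmod (box_green V N (cayley (disc_path \<rho> t)) m j))) * indicator {0..1} t \<partial>lborel) \<le> 12"
proof -
  let ?F = "\<lambda>m j t. sqrt (cmod (herglotz V N (cayley (disc_path \<rho> t)) m j))"
  have herg: "continuous_on UNIV (\<lambda>t. herglotz V N (cayley (disc_path \<rho> t)) m j)" for m j
    unfolding herglotz_def by (intro continuous_intros box_green_continuous assms)
  have meas: "(\<lambda>t. ennreal (?F m j t) * indicator {0..1} t) \<in> borel_measurable lborel" for m j
  proof -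
    have "continuous_on UNIV (?F m j)"
      by (intro continuous_on_real_sqrt continuous_on_norm herg)
    then have [measurable]: "?F m j \<in> borel_measurable borel"
      by (rule borel_measurable_continuous_onI)
    show ?thesis by measurable
  qed
  have "sqrt (cmod (box_green V N z m j)) \<le> sqrt (cmod (herglotz V N z m j))
      + sqrt (cmod (herglotz V N z m m)) + sqrt (cmod (herglotz V N z j j))" for z
  proof -
    have "cmod (2 * box_green V N z m j) \<le> cmod (herglotz V N z m j) + cmod (herglotz V N z m m / 4) + cmod (herglotz V N z j j / 4)"
      unfolding herglotz_def[of V N z m m] herglotz_def[of V N z j j]
      using norm_triangle_ineq4[of "herglotz V N z m j" "box_green V N z m m + box_green V N z j j"]
        norm_triangle_ineq[of "box_green V N z m m" "box_green V N z j j"]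
      by (simp add: herglotz_def norm_mult)
    then have "2 * cmod (box_green V N z m j) \<le> cmod (herglotz V N z m j) + cmod (herglotz V N z m m) / 4 + cmod (herglotz V N z j j) / 4"
      by (simp add: norm_mult norm_divide)
    then have "cmod (box_green V N z m j) \<le> cmod (herglotz V N z m j) + cmod (herglotz V N z m m) + cmod (herglotz V N z j j)"
      using norm_ge_zero[of "herglotz V N z m j"] norm_ge_zero[of "herglotz V N z m m"]
        norm_ge_zero[of "herglotz V N z j j"] norm_ge_zero[of "box_green V N z m j"]
      by linarith
    then have "sqrt (cmod (box_green V N z m j)) \<le> sqrt (cmod (herglotz V N z m j) + cmod (herglotz V N z m m) + cmod (herglotz V N z j j))"
      by (rule real_sqrt_le_mono)
    also have "\<dots> \<le> sqrt (cmod (herglotz V N z m j) + cmod (herglotz V N z m m)) + sqrt (cmod (herglotz V N z j j))"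
      by (rule sqrt_add_le_add_sqrt) auto
    also have "\<dots> \<le> sqrt (cmod (herglotz V N z m j)) + sqrt (cmod (herglotz V N z m m)) + sqrt (cmod (herglotz V N z j j))"
      by (intro add_right_mono sqrt_add_le_add_sqrt) auto
    finally show ?thesis .
  qed
  then have "(\<integral>\<^sup>+t. ennreal (sqrt (cmod (box_green V N (cayley (disc_path \<rho> t)) m j))) * indicator {0..1} t \<partial>lborel)
     \<le> (\<integral>\<^sup>+t. ennreal (?F m j t + ?F m m t + ?F j j t) * indicator {0..1} t \<partial>lborel)"
    by (intro nn_integral_mono mult_right_mono ennreal_leI) auto
  also have "\<dots> = (\<integral>\<^sup>+t. (ennreal (?F m j t) * indicator {0..1} t + ennreal (?F m m t) * indicator {0..1} t)
      + ennreal (?F j j t) * indicator {0..1} t \<partial>lborel)"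
    by (intro nn_integral_cong) (simp add: ennreal_plus distrib_right)
  also have "\<dots> = (\<integral>\<^sup>+t. ennreal (?F m j t) * indicator {0..1} t \<partial>lborel)
      + (\<integral>\<^sup>+t. ennreal (?F m m t) * indicator {0..1} t \<partial>lborel) + (\<integral>\<^sup>+t. ennreal (?F j j t) * indicator {0..1} t \<partial>lborel)"
    by (subst nn_integral_add, intro borel_measurable_add meas, rule meas, subst nn_integral_add, rule meas, rule meas, rule refl)
  also have "\<dots> \<le> 4 + 4 + 4"
    by (intro add_mono herglotz_mean assms)
  finally show ?thesis by simp
qed

text \<open>The subtracted term telescopes and lets the induction close; at \<open>k = 0\<close>
  both sides are 1.\<close>

lemma sum_inverse_squares_le: "(\<Sum>n\<in>{-int k..int k}. 1 / (1 + (real_of_int n)\<^sup>2)) \<le> 5 - 4 / (real k + 1)"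
proof (induction k)
  case (Suc k)
  have "{-int (Suc k)..int (Suc k)} = insert (- int (Suc k)) (insert (int (Suc k)) {-int k..int k})"
    by auto
  then have "(\<Sum>n\<in>{-int (Suc k)..int (Suc k)}. 1 / (1 + (real_of_int n)\<^sup>2)) =
      2 / (1 + (real k + 1)\<^sup>2) + (\<Sum>n\<in>{-int k..int k}. 1 / (1 + (real_of_int n)\<^sup>2))"
    by (simp add: power2_eq_square algebra_simps)
  also have "2 / (1 + (real k + 1)\<^sup>2) \<le> 4 / (real k + 1) - 4 / (real k + 2)"
  proof -
    define x where "x = real k + 1"
    have x: "x > 0" by (simp add: x_def)
    have "1 + x\<^sup>2 > 0"
      by (simp add: add_pos_nonneg)
    then have "2 / (1 + x\<^sup>2) = 4 / (2 * (1 + x\<^sup>2))"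
      by (simp add: field_simps)
    also have "\<dots> \<le> 4 / (x * (x + 1))"
    proof (rule divide_left_mono)
      have "x \<le> 1 + x\<^sup>2"
        using sum_squares_bound[of x 1] x by simp
      then show "x * (x + 1) \<le> 2 * (1 + x\<^sup>2)"
        by (simp add: power2_eq_square distrib_left)
    qed (use x in \<open>auto intro!: mult_pos_pos add_pos_nonneg\<close>)
    also have "\<dots> = 4 / x - 4 / (x + 1)"
      using x by (simp add: diff_frac_eq)
    finally show ?thesis
      by (simp add: x_def add.assoc)
  qed
  finally show ?case using Suc by (simp add: add.commute)
qed simp

section \<open>Limits at real energies\<close>

text \<open>The equation at a site involves three sites only and hence passes to coordinatewise
  limits; compactness of a product of discs supplies such a limit.\<close>

lemma green_limit:
  fixes G :: "nat \<Rightarrow> int \<Rightarrow> complex"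
  assumes eq: "\<And>k n. jacobi V (G k) n - z k * G k n = (if n = j then 1 else 0)"
    and B: "\<And>k n. \<bar>n\<bar> \<le> int k \<Longrightarrow> cmod (G k n) \<le> B n" and z: "z \<longlonglongrightarrow> E"
  obtains g where "\<And>n. jacobi V g n - E * g n = (if n = j then 1 else 0)" "\<And>n. cmod (g n) \<le> B n"
proof -
  \<comment> \<open>The cut-off puts the whole sequence into the compact product, although
    \<open>B\<close> bounds \<open>G k\<close> only on a growing window. At each fixed site it is
    eventually inactive.\<close>
  define a where "a = (\<lambda>k n. if \<bar>n\<bar> \<le> int k then G k n else 0)"
  have B0: "0 \<le> B n" for n
    using order_trans[OF norm_ge_zero B[of n "nat \<bar>n\<bar>"]] by simp
  define S where "S = PiE UNIV (\<lambda>n. cball (0::complex) (B n))"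
  have "compactin (product_topology (\<lambda>i. euclidean) UNIV) S"
    unfolding S_def compactin_PiE by simp
  then have "compact S"
    by (simp only: euclidean_product_topology compactin_euclidean_iff)
  then have sc: "seq_compact S"
    by (rule compact_imp_seq_compact)
  have "a k \<in> S" for k
    unfolding S_def using B B0 by (auto simp: a_def)
  then obtain g r where g: "g \<in> S" and r: "strict_mono r" and lim: "(a \<circ> r) \<longlonglongrightarrow> g"
    using seq_compactE[OF sc, of a] by blast
  have co: "(\<lambda>i. a (r i) n) \<longlonglongrightarrow> g n" for n
    using continuous_on_tendsto_compose[OF continuous_on_product_coordinates[of n] lim] by (simp add: o_def)
  have G: "(\<lambda>i. G (r i) n) \<longlonglongrightarrow> g n" for n
  proof (rule Lim_transform_eventually[OF co])
    show "\<forall>\<^sub>F i in sequentially. a (r i) n = G (r i) n"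
      using eventually_ge_at_top[of "nat \<bar>n\<bar>"]
    proof eventually_elim
      case (elim i)
      then show ?case
        using seq_suble[OF r, of i] by (simp add: a_def)
    qed
  qed
  have zr: "(\<lambda>i. z (r i)) \<longlonglongrightarrow> E"
    using LIMSEQ_subseq_LIMSEQ[OF z r] by (simp add: o_def)
  have "jacobi V g n - E * g n = (if n = j then 1 else 0)" for n
  proof (rule LIMSEQ_unique)
    show "(\<lambda>i. jacobi V (G (r i)) n - z (r i) * G (r i) n) \<longlonglongrightarrow> jacobi V g n - E * g n"
      unfolding jacobi_def by (intro tendsto_intros G zr)
    show "(\<lambda>i. jacobi V (G (r i)) n - z (r i) * G (r i) n) \<longlonglongrightarrow> (if n = j then 1 else 0)"
      unfolding eq by simp
  qed
  moreover have "cmod (g n) \<le> B n" for n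
    using PiE_mem[OF g[unfolded S_def], of n] by simp
  ultimately show ?thesis
    using that by blast
qed

text \<open>The exponent is what the weighted sums below yield: they bound the square root of the
  modulus by a multiple of \<open>1 + n\<^sup>2\<close>. For the exponents any fixed power would
  serve.\<close>

definition poly_bounded :: "(int \<Rightarrow> complex) \<Rightarrow> bool" where
  "poly_bounded u \<longleftrightarrow> (\<exists>C. \<forall>n. cmod (u n) \<le> C * (1 + (real_of_int n)\<^sup>2)\<^sup>2)"

text \<open>This is \<open>- cot (pi * t)\<close>, the boundary value of \<open>cayley\<close> on
  the unit circle.\<close>

definition circle_energy :: "real \<Rightarrow> real" where
  "circle_energy t = - sin (2 * pi * t) / (1 - cos (2 * pi * t))"

lemma cos_less_one:
  assumes "0 < t" "t < 1"
  shows "cos (2 * pi * t) < 1"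
proof -
  have "cos (2 * pi * t) = 1 - 2 * (sin (pi * t))\<^sup>2"
    using cos_double_sin[of "pi * t"] by (simp add: mult.assoc)
  moreover have "sin (pi * t) > 0"
    using assms by (intro sin_gt_zero) auto
  ultimately show ?thesis by simp
qed

lemma cayley_circle:
  assumes "0 < t" "t < 1"
  shows "cayley (disc_path 1 t) = complex_of_real (circle_energy t)"
proof -
  define c s where "c = cos (2 * pi * t)" and "s = sin (2 * pi * t)"
  have cs: "c * c + s * s = 1"
    using sin_cos_squared_add3[of "2 * pi * t"] by (simp add: c_def s_def)
  have c1: "c < 1"
    unfolding c_def by (rule cos_less_one[OF assms])
  have w: "disc_path 1 t = Complex c s"
    unfolding disc_path_def c_def s_def
    by (simp add: complex_eq_iff Re_exp Im_exp mult.commute)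
  have "(1 - Complex c s) \<noteq> 0"
    using c1 by (auto simp: complex_eq_iff)
  moreover have "\<i> * (1 + Complex c s) * complex_of_real (1 - c) = complex_of_real (- s) * (1 - Complex c s)"
    using cs by (simp add: complex_eq_iff algebra_simps)
  moreover have "complex_of_real (1 - c) \<noteq> 0"
    using c1 by (simp del: of_real_diff)
  ultimately have "cayley (disc_path 1 t) = complex_of_real (- s) / complex_of_real (1 - c)"
    unfolding cayley_def w by (simp add: frac_eq_eq del: of_real_diff of_real_minus)
  then show ?thesis
    by (simp add: circle_energy_def c_def s_def)
qed

lemma cayley_radial_limit:
  assumes "0 < t" "t < 1"
  shows "(\<lambda>k. cayley (disc_path (1 - 1 / (real k + 2)) t)) \<longlonglongrightarrow> complex_of_real (circle_energy t)"
proof -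
  have "(\<lambda>k. 1 - 1 / (real k + 2)) \<longlonglongrightarrow> 1"
    by real_asymp
  then have w: "(\<lambda>k. disc_path (1 - 1 / (real k + 2)) t) \<longlonglongrightarrow> disc_path 1 t"
    unfolding disc_path_def by (intro tendsto_intros) 
  have "disc_path 1 t \<noteq> 1"
  proof
    assume "disc_path 1 t = 1"
    then have "Re (disc_path 1 t) = 1" by simp
    then show False
      using cos_less_one[OF assms] by (simp add: disc_path_def Re_exp mult.commute)
  qed
  then have "(\<lambda>k. cayley (disc_path (1 - 1 / (real k + 2)) t)) \<longlonglongrightarrow> cayley (disc_path 1 t)"
    unfolding cayley_def by (intro tendsto_intros w) auto
  then show ?thesis
    by (simp add: cayley_circle[OF assms])
qed

text \<open>Box size and radius tend to their limits together. The weighted sums over the box have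
  means at most \<open>5 * 12\<close>, so Fatou makes their lower limit finite at almost every
  \<open>t\<close>; along a subsequence depending on \<open>t\<close> every site is then controlled
  by one constant.\<close>

lemma green_ae_circle:
  "AE t in lborel. 0 < t \<and> t < 1 \<longrightarrow>
     (\<exists>g. poly_bounded g \<and> (\<forall>n. jacobi V g n - complex_of_real (circle_energy t) * g n = (if n = j then 1 else 0)))"
proof -
  \<comment> \<open>The offset puts the source into every box.\<close>
  define N where "N = (\<lambda>k::nat. int k + \<bar>j\<bar>)"
  define \<rho> where "\<rho> = (\<lambda>k::nat. 1 - 1 / (real k + 2))"
  define z where "z = (\<lambda>k t. cayley (disc_path (\<rho> k) t))"
  define G where "G = (\<lambda>k t n. box_green V (N k) (z k t) n j)"
  define \<Phi> where "\<Phi> = (\<lambda>k t. \<Sum>n\<in>{-N k..N k}. (1 / (1 + (real_of_int n)\<^sup>2)) * sqrt (cmod (G k t n)))"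
  define u where "u = (\<lambda>k t. ennreal (\<Phi> k t) * indicator {0..1} t)"
  have \<rho>: "0 < \<rho> k" "\<rho> k < 1" for k
    by (simp_all add: \<rho>_def)
  have N: "0 \<le> N k" "j \<in> {-N k..N k}" for k
    by (auto simp: N_def)
  have G_cont: "continuous_on UNIV (\<lambda>t. sqrt (cmod (G k t n)))" for k n
    unfolding G_def z_def by (intro continuous_on_real_sqrt continuous_on_norm box_green_continuous N \<rho>)
  have [measurable]: "(\<lambda>t. sqrt (cmod (G k t n))) \<in> borel_measurable borel" for k n
    by (rule borel_measurable_continuous_onI[OF G_cont])
  have [measurable]: "\<Phi> k \<in> borel_measurable borel" for k
    unfolding \<Phi>_def by measurable
  have meas: "u k \<in> borel_measurable lborel" for k
    unfolding u_def by measurable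
  have int: "integral\<^sup>N lborel (u k) \<le> 60" for k
  proof -
    have ueq: "u k t = (\<Sum>n\<in>{-N k..N k}. ennreal (1 / (1 + (real_of_int n)\<^sup>2)) * (ennreal (sqrt (cmod (G k t n))) * indicator {0..1} t))" for t
    proof -
      have "ennreal (\<Phi> k t) = (\<Sum>n\<in>{-N k..N k}. ennreal ((1 / (1 + (real_of_int n)\<^sup>2)) * sqrt (cmod (G k t n))))"
        unfolding \<Phi>_def by (rule sum_ennreal[symmetric]) simp
      also have "\<dots> = (\<Sum>n\<in>{-N k..N k}. ennreal (1 / (1 + (real_of_int n)\<^sup>2)) * ennreal (sqrt (cmod (G k t n))))"
        by (intro sum.cong refl ennreal_mult) auto
      finally show ?thesis
        unfolding u_def by (simp only: sum_distrib_right mult.assoc)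
    qed
    have "integral\<^sup>N lborel (u k) =
        (\<integral>\<^sup>+t. (\<Sum>n\<in>{-N k..N k}. ennreal (1 / (1 + (real_of_int n)\<^sup>2)) * (ennreal (sqrt (cmod (G k t n))) * indicator {0..1} t)) \<partial>lborel)"
      by (rule nn_integral_cong) (rule ueq)
    also have "\<dots> = (\<Sum>n\<in>{-N k..N k}. (\<integral>\<^sup>+t. ennreal (1 / (1 + (real_of_int n)\<^sup>2)) * (ennreal (sqrt (cmod (G k t n))) * indicator {0..1} t) \<partial>lborel))"
      by (rule nn_integral_sum) measurable
    also have "\<dots> = (\<Sum>n\<in>{-N k..N k}. ennreal (1 / (1 + (real_of_int n)\<^sup>2)) * (\<integral>\<^sup>+t. ennreal (sqrt (cmod (G k t n))) * indicator {0..1} t \<partial>lborel))"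
      by (intro sum.cong refl nn_integral_cmult) measurable
    also have "\<dots> \<le> (\<Sum>n\<in>{-N k..N k}. ennreal (1 / (1 + (real_of_int n)\<^sup>2)) * 12)"
      unfolding G_def z_def by (intro sum_mono mult_left_mono box_green_mean N \<rho>) auto
    also have "\<dots> = ennreal (\<Sum>n\<in>{-N k..N k}. 1 / (1 + (real_of_int n)\<^sup>2)) * 12"
    proof -
      have "(\<Sum>n\<in>{-N k..N k}. ennreal (1 / (1 + (real_of_int n)\<^sup>2))) = ennreal (\<Sum>n\<in>{-N k..N k}. 1 / (1 + (real_of_int n)\<^sup>2))"
        by (rule sum_ennreal) simp
      then show ?thesis
        by (simp only: sum_distrib_right[symmetric])
    qed
    also have "\<dots> \<le> ennreal 5 * 12"
    proof (intro mult_right_mono ennreal_leI)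
      show "(\<Sum>n\<in>{-N k..N k}. 1 / (1 + (real_of_int n)\<^sup>2)) \<le> 5"
      proof -
        have "(\<Sum>n\<in>{-N k..N k}. 1 / (1 + (real_of_int n)\<^sup>2)) \<le> 5 - 4 / (real (nat (N k)) + 1)"
          using sum_inverse_squares_le[of "nat (N k)"] N(1)[of k] by simp
        also have "\<dots> \<le> 5" by simp
        finally show ?thesis .
      qed
    qed auto
    also have "\<dots> = 60"
      by simp
    finally show ?thesis .
  qed
  have "(\<integral>\<^sup>+t. liminf (\<lambda>k. u k t) \<partial>lborel) \<le> liminf (\<lambda>k. integral\<^sup>N lborel (u k))"
    by (rule nn_integral_liminf[OF meas])
  also have "\<dots> \<le> limsup (\<lambda>k. integral\<^sup>N lborel (u k))"
    by (rule Liminf_le_Limsup) simp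
  also have "\<dots> \<le> 60"
    by (rule Limsup_bounded) (simp add: int)
  finally have "(\<integral>\<^sup>+t. liminf (\<lambda>k. u k t) \<partial>lborel) \<noteq> \<infinity>"
    by (auto simp: top_unique)
  then have "AE t in lborel. liminf (\<lambda>k. u k t) \<noteq> \<infinity>"
    by (rule nn_integral_PInf_AE[rotated]) (intro borel_measurable_liminf meas)
  then show ?thesis
  proof (rule AE_mp, intro AE_I2 impI)
    fix t assume fin: "liminf (\<lambda>k. u k t) \<noteq> \<infinity>" and t: "0 < t \<and> t < 1"
    then obtain c where c: "0 \<le> c" "liminf (\<lambda>k. u k t) = ennreal c"
      by (cases "liminf (\<lambda>k. u k t)") auto
    have "\<not> (\<forall>\<^sub>F k in sequentially. ennreal (c + 1) \<le> u k t)"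
    proof
      assume "\<forall>\<^sub>F k in sequentially. ennreal (c + 1) \<le> u k t"
      then have "ennreal (c + 1) \<le> liminf (\<lambda>k. u k t)"
        by (rule Liminf_bounded)
      then show False
        using c by (simp add: ennreal_le_iff)
    qed
    then have "infinite {k. u k t < ennreal (c + 1)}"
      unfolding not_eventually not_le frequently_cofinite[symmetric] cofinite_eq_sequentially .
    then obtain r :: "nat \<Rightarrow> nat" where r0: "strict_mono r" "\<forall>k. r k \<in> {k. u k t < ennreal (c + 1)}"
      using infinite_enumerate by blast
    then have r: "strict_mono r" "\<And>k. u (r k) t < ennreal (c + 1)"
      by auto
    have \<Phi>: "\<Phi> (r k) t \<le> c + 1" for k
    proof (rule ccontr)
      assume "\<not> \<Phi> (r k) t \<le> c + 1"
      then have "ennreal (c + 1) \<le> ennreal (\<Phi> (r k) t)"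
        by (intro ennreal_leI) simp
      then show False
        using r(2)[of k] t by (simp add: u_def)
    qed
    have B: "cmod (G (r k) t n) \<le> (c + 1)\<^sup>2 * (1 + (real_of_int n)\<^sup>2)\<^sup>2" if n: "\<bar>n\<bar> \<le> int k" for k n
    proof -
      have "n \<in> {-N (r k)..N (r k)}"
        using n seq_suble[OF r(1), of k] by (auto simp: N_def)
      then have "(1 / (1 + (real_of_int n)\<^sup>2)) * sqrt (cmod (G (r k) t n)) \<le> \<Phi> (r k) t"
        unfolding \<Phi>_def by (intro member_le_sum) auto
      with \<Phi>[of k] have "(1 / (1 + (real_of_int n)\<^sup>2)) * sqrt (cmod (G (r k) t n)) \<le> c + 1"
        by linarith
      moreover have "0 < 1 + (real_of_int n)\<^sup>2"
        by (simp add: add_pos_nonneg)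
      ultimately have "sqrt (cmod (G (r k) t n)) \<le> (c + 1) * (1 + (real_of_int n)\<^sup>2)"
        by (simp add: field_simps)
      then have "(sqrt (cmod (G (r k) t n)))\<^sup>2 \<le> ((c + 1) * (1 + (real_of_int n)\<^sup>2))\<^sup>2"
        by (rule power_mono) simp
      then show ?thesis
        by (simp add: power_mult_distrib)
    qed
    have zlim: "(\<lambda>k. z (r k) t) \<longlonglongrightarrow> complex_of_real (circle_energy t)"
      using LIMSEQ_subseq_LIMSEQ[OF cayley_radial_limit r(1)] t by (simp add: z_def \<rho>_def o_def)
    have eq: "jacobi V (G (r k) t) n - z (r k) t * G (r k) t n = (if n = j then 1 else 0)" for k n
    proof -
      have "Im (z (r k) t) > 0"
        unfolding z_def using \<rho>[of "r k"] by (intro Im_cayley_pos) simp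
      then show ?thesis
        unfolding G_def by (intro jacobi_box_green box_det_nonzero N)
    qed
    obtain g where "\<And>n. jacobi V g n - complex_of_real (circle_energy t) * g n = (if n = j then 1 else 0)"
        "\<And>n. cmod (g n) \<le> (c + 1)\<^sup>2 * (1 + (real_of_int n)\<^sup>2)\<^sup>2"
      using green_limit[of V "\<lambda>k. G (r k) t", OF eq B zlim] by blast
    then show "\<exists>g. poly_bounded g \<and> (\<forall>n. jacobi V g n - complex_of_real (circle_energy t) * g n = (if n = j then 1 else 0))"
      unfolding poly_bounded_def by blast
  qed
qed

text \<open>Solving \<open>- cot (pi * t) = E\<close> gives the parameter
  \<open>1 / 2 + arctan E / pi\<close>.\<close>

lemma circle_energy_surj: "\<exists>t. 0 < t \<and> t < 1 \<and> circle_energy t = E"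
proof -
  define a where "a = arctan E"
  define t where "t = 1 / 2 + a / pi"
  have a: "- (pi / 2) < a" "a < pi / 2"
    using arctan_lbound arctan_ubound by (auto simp: a_def)
  have "- pi < 2 * a" "2 * a < pi" using a by auto
  then have "0 < t" "t < 1"
    by (auto simp: t_def field_simps)
  moreover have "circle_energy t = E"
  proof -
    have "2 * pi * t = 2 * a + pi"
      by (simp add: t_def field_simps)
    then have "circle_energy t = sin (2 * a) / (1 + cos (2 * a))"
      by (simp add: circle_energy_def)
    also have "\<dots> = tan a"
      using cos_gt_zero_pi[OF a(1) a(2)]
      by (simp add: sin_double cos_double_cos tan_def power2_eq_square)
    finally show ?thesis
      by (simp add: a_def tan_arctan)
  qed
  ultimately show ?thesis by blast
qed

text \<open>Almost every parameter becomes almost every energy, because a differentiable map of the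
  line carries null sets to null sets.\<close>

lemma green_ae:
  "AE E in lborel. \<exists>g. poly_bounded g \<and> (\<forall>n. jacobi V g n - complex_of_real E * g n = (if n = j then 1 else 0))"
    (is "AE E in lborel. ?P E")
proof -
  define S where "S = {t. 0 < t \<and> t < 1 \<and> \<not> ?P (circle_energy t)}"
  \<comment> \<open>\<open>S\<close> is not known to be Borel, hence the passage to the completed
    measure.\<close>
  have "AE t in lebesgue. \<not> t \<in> S"
    using AE_completion[OF green_ae_circle[of V j]] by eventually_elim (auto simp: S_def)
  then obtain S' where "S' \<in> null_sets lebesgue" "S \<subseteq> S'"
    unfolding eventually_ae_filter by auto
  then have "negligible S"
    using negligible_subset negligible_iff_null_sets by blast
  moreover have "circle_energy differentiable_on S"
  proof -
    have "circle_energy differentiable (at t)" if "0 < t" "t < 1" for t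
    proof -
      have "(circle_energy has_real_derivative
          - ((cos (2 * pi * t) * (2 * pi) * (1 - cos (2 * pi * t)) - sin (2 * pi * t) * (sin (2 * pi * t) * (2 * pi)))
            / ((1 - cos (2 * pi * t)) * (1 - cos (2 * pi * t))))) (at t)"
        unfolding circle_energy_def using cos_less_one[OF that]
        by (auto intro!: derivative_eq_intros)
      then show ?thesis
        by (auto simp: real_differentiable_def)
    qed
    then show ?thesis
      unfolding differentiable_on_def S_def by (auto intro: differentiable_at_withinI)
  qed
  ultimately have "negligible (circle_energy ` S)"
    by (intro negligible_differentiable_image_negligible) auto
  then have "AE E in lebesgue. E \<notin> circle_energy ` S"
    by (intro AE_not_in) (simp add: negligible_iff_null_sets)
  then have "AE E in lebesgue. ?P E"
  proof eventually_elim
    case (elim E)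
    obtain t where t: "0 < t" "t < 1" "circle_energy t = E"
      using circle_energy_surj by blast
    with elim have "t \<notin> S" by blast
    then show ?case
      using t by (auto simp: S_def)
  qed
  then show ?thesis
    by (simp only: AE_completion_iff)
qed

section \<open>Transfer matrices\<close>

text \<open>A Pluecker relation for three vectors in the plane. Where
  \<open>casoratian g \<phi>\<close> is a nonzero constant, it writes a solution \<open>u\<close> as
  a combination of \<open>g\<close> and \<open>\<phi>\<close> with constant coefficients.\<close>

lemma casoratian_plucker:
  "u n * casoratian g \<phi> n = g n * casoratian u \<phi> n + \<phi> n * casoratian g u n"
  by (simp add: casoratian_def algebra_simps)

lemma casoratian_const_right:
  assumes "\<And>n. n > m \<Longrightarrow> jacobi V u n = z * u n" "\<And>n. n > m \<Longrightarrow> jacobi V v n = z * v n" "m \<le> n"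
  shows "casoratian u v n = casoratian u v m"
  using assms(3)
proof (induction n rule: int_ge_induct)
  case (step i)
  then show ?case
    using casoratian_step[of u v "i + 1" V z] assms(1,2)[of "i + 1"] by simp
qed simp

text \<open>The Casoratian at \<open>n\<close> involves the sites \<open>n\<close> and
  \<open>n + 1\<close>, and going from \<open>i\<close> to \<open>i - 1\<close> uses the equation at
  \<open>i\<close>. With a source at \<open>m\<close>, the last value on the left is therefore the
  one at \<open>m - 1\<close>.\<close>

lemma casoratian_const_left:
  assumes "\<And>n. n < m \<Longrightarrow> jacobi V u n = z * u n" "\<And>n. n < m \<Longrightarrow> jacobi V v n = z * v n" "n < m"
  shows "casoratian u v n = casoratian u v (m - 1)"
proof -
  have "n \<le> m - 1" using assms(3) by simp
  then show ?thesis
  proof (induction n rule: int_le_induct)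
    case (step i)
    then show ?case
      using casoratian_step[of u v i V z] assms(1,2)[of i] by simp
  qed simp
qed

text \<open>The Casoratians of \<open>\<phi>\<close> with both fundamental solutions vanish at 0 and
  hence everywhere; the Pluecker relation then expresses \<open>\<phi>\<close> by zeros.\<close>

lemma eigen_solution_zero:
  assumes "\<And>n. jacobi V \<phi> n = z * \<phi> n" "\<phi> 0 = 0" "\<phi> 1 = 0"
  shows "\<phi> n = 0"
proof -
  have 0: "casoratian \<phi> u k = 0" "casoratian u \<phi> k = 0" if "\<And>n. jacobi V u n = z * u n" for u k
  proof -
    have "casoratian \<phi> u k = casoratian \<phi> u 0"
      by (rule casoratian_const[of V _ z]) (use assms that in auto)
    then show "casoratian \<phi> u k = 0" using assms by (simp add: casoratian_def)
    have "casoratian u \<phi> k = casoratian u \<phi> 0"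
      by (rule casoratian_const[of V _ z]) (use assms that in auto)
    then show "casoratian u \<phi> k = 0" using assms by (simp add: casoratian_def)
  qed
  show ?thesis
    using casoratian_plucker[of \<phi> n "sol V z 0 1" "sol V z 1 0"]
    by (simp add: casoratian_fundamental 0 jacobi_sol)
qed

lemma combination_poly_bounded:
  assumes "poly_bounded g" "poly_bounded \<phi>" "w \<noteq> 0" "\<And>n. n \<in> S \<Longrightarrow> u n * w = g n * a + \<phi> n * b"
  shows "\<exists>C. \<forall>n\<in>S. cmod (u n) \<le> C * (1 + (real_of_int n)\<^sup>2)\<^sup>2"
proof -
  obtain C1 C2 where C: "\<And>n. cmod (g n) \<le> C1 * (1 + (real_of_int n)\<^sup>2)\<^sup>2"
    "\<And>n. cmod (\<phi> n) \<le> C2 * (1 + (real_of_int n)\<^sup>2)\<^sup>2"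
    using assms(1,2) unfolding poly_bounded_def by blast
  have "cmod (u n) \<le> (C1 * cmod a + C2 * cmod b) / cmod w * (1 + (real_of_int n)\<^sup>2)\<^sup>2" if "n \<in> S" for n
  proof -
    have "cmod (u n) * cmod w \<le> cmod (g n) * cmod a + cmod (\<phi> n) * cmod b"
      using assms(4)[OF that] norm_triangle_ineq[of "g n * a" "\<phi> n * b"] by (simp add: norm_mult flip: norm_mult[of "u n"])
    also have "\<dots> \<le> C1 * (1 + (real_of_int n)\<^sup>2)\<^sup>2 * cmod a + C2 * (1 + (real_of_int n)\<^sup>2)\<^sup>2 * cmod b"
      by (intro add_mono mult_right_mono C) auto
    finally show ?thesis
      using assms(3) by (simp add: field_simps)
  qed
  then show ?thesis by blast
qed

text \<open>The Casoratian of \<open>\<phi>\<close> with a Green's function jumps by \<open>\<phi> j\<close> at the source \<open>j\<close>,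
  so that it cannot vanish on both half-lines for both sources.\<close>

lemma solutions_poly_bounded:
  assumes g0: "poly_bounded g0" "\<And>n. jacobi V g0 n - z * g0 n = (if n = 0 then 1 else 0)"
    and g1: "poly_bounded g1" "\<And>n. jacobi V g1 n - z * g1 n = (if n = 1 then 1 else 0)"
    and \<phi>: "poly_bounded \<phi>" "\<And>n. jacobi V \<phi> n = z * \<phi> n" "\<phi> k \<noteq> 0"
  shows "(\<forall>u. (\<forall>n. jacobi V u n = z * u n) \<longrightarrow> (\<exists>C. \<forall>n\<in>{1..}. cmod (u n) \<le> C * (1 + (real_of_int n)\<^sup>2)\<^sup>2)) \<or>
    (\<forall>u. (\<forall>n. jacobi V u n = z * u n) \<longrightarrow> (\<exists>C. \<forall>n\<in>{..-1}. cmod (u n) \<le> C * (1 + (real_of_int n)\<^sup>2)\<^sup>2))"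
proof (rule ccontr)
  assume neg: "\<not> ?thesis"
  \<comment> \<open>No source lies outside the sites 0 and 1, so one argument covers both Green's
    functions: a nonzero Casoratian with \<open>\<phi>\<close> on a half-line makes every solution
    there a combination of \<open>g\<close> and \<open>\<phi>\<close>, against
    \<open>neg\<close>.\<close>
  have zero: "casoratian g \<phi> 1 = 0 \<and> casoratian g \<phi> (-1) = 0"
    if g: "poly_bounded g" "\<And>n. n \<noteq> 0 \<Longrightarrow> n \<noteq> 1 \<Longrightarrow> jacobi V g n = z * g n" for g
  proof (rule ccontr)
    assume "\<not> ?thesis"
    then consider "casoratian g \<phi> 1 \<noteq> 0" | "casoratian g \<phi> (-1) \<noteq> 0" by blast
    then show False
    proof cases
      case 1
      have "\<exists>C. \<forall>n\<in>{1..}. cmod (u n) \<le> C * (1 + (real_of_int n)\<^sup>2)\<^sup>2" if u: "\<forall>n. jacobi V u n = z * u n" for u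
      proof (rule combination_poly_bounded[OF g(1) \<phi>(1) 1])
        fix n :: int assume n: "n \<in> {1..}"
        have "casoratian g \<phi> n = casoratian g \<phi> 1" "casoratian u \<phi> n = casoratian u \<phi> 1" "casoratian g u n = casoratian g u 1"
          by (rule casoratian_const_right[of 1 V _ z]; use g(2) \<phi>(2) u n in auto)+
        then show "u n * casoratian g \<phi> 1 = g n * casoratian u \<phi> 1 + \<phi> n * casoratian g u 1"
          using casoratian_plucker[of u n g \<phi>] by simp
      qed
      with neg show False by blast
    next
      case 2
      have "\<exists>C. \<forall>n\<in>{..-1}. cmod (u n) \<le> C * (1 + (real_of_int n)\<^sup>2)\<^sup>2" if u: "\<forall>n. jacobi V u n = z * u n" for u
      proof (rule combination_poly_bounded[OF g(1) \<phi>(1) 2])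
        fix n :: int assume n: "n \<in> {..-1}"
        have "casoratian g \<phi> n = casoratian g \<phi> (0 - 1)" "casoratian u \<phi> n = casoratian u \<phi> (0 - 1)" "casoratian g u n = casoratian g u (0 - 1)"
          by (rule casoratian_const_left[of 0 V _ z]; use g(2) \<phi>(2) u n in auto)+
        then show "u n * casoratian g \<phi> (-1) = g n * casoratian u \<phi> (-1) + \<phi> n * casoratian g u (-1)"
          using casoratian_plucker[of u n g \<phi>] by simp
      qed
      with neg show False by blast
    qed
  qed
  have z0: "casoratian g0 \<phi> 1 = 0" "casoratian g0 \<phi> (-1) = 0"
    using zero[OF g0(1)] g0(2) by (simp_all add: diff_eq_eq)
  have z1: "casoratian g1 \<phi> 1 = 0" "casoratian g1 \<phi> (-1) = 0"
    using zero[OF g1(1)] g1(2) by (simp_all add: diff_eq_eq)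
  \<comment> \<open>Between -1 and 1 the Casoratian with \<open>g0\<close> changes by
    \<open>\<phi> 0\<close> in total and the one with \<open>g1\<close> by \<open>\<phi> 1\<close>,
    while all end values are zero.\<close>
  have "\<phi> 0 = 0" "\<phi> 1 = 0"
    using casoratian_step[of g0 \<phi> 0 V z] casoratian_step[of g0 \<phi> 1 V z]
      casoratian_step[of g1 \<phi> 0 V z] casoratian_step[of g1 \<phi> 1 V z] z0 z1 g0(2) g1(2) \<phi>(2) by auto
  then show False
    using eigen_solution_zero[of V \<phi> z k] \<phi>(2,3) by blast
qed

section \<open>Norms and growth of transfer matrices\<close>

lemma matrix_inv_eqI:
  fixes A B :: "real^'n^'n"
  assumes "A ** B = mat 1" "B ** A = mat 1"
  shows "matrix_inv A = B"
proof -
  have "A ** matrix_inv A = mat 1 \<and> matrix_inv A ** A = mat 1"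
    unfolding matrix_inv_def by (rule someI[of _ B]) (use assms in auto)
  then have "matrix_inv A ** (A ** B) = B"
    by (simp add: matrix_mul_assoc)
  then show ?thesis
    by (simp add: assms)
qed

lemma matrix2_eqI:
  fixes A B :: "'a^2^2"
  assumes "A$1$1 = B$1$1" "A$1$2 = B$1$2" "A$2$1 = B$2$1" "A$2$2 = B$2$2"
  shows "A = B"
  using assms by (simp add: vec_eq_iff forall_2)

lemma matrix2_mult:
  fixes A B :: "real^2^2"
  shows "(A ** B) $ i $ j = A$i$1 * B$1$j + A$i$2 * B$2$j"
  by (simp add: matrix_matrix_mult_def sum_2)

lemma matrix_inv_one_step:
  "matrix_inv (one_step_matrix f E \<omega>) = vector [vector [0, 1], vector [-1, E - f \<omega>]]"
  by (rule matrix_inv_eqI; rule matrix2_eqI) (simp_all add: matrix2_mult one_step_matrix_def mat_def)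

lemma det_one_step: "det (one_step_matrix f E \<omega>) = 1" "det (matrix_inv (one_step_matrix f E \<omega>)) = 1"
  unfolding matrix_inv_one_step by (simp_all add: det_2 one_step_matrix_def)

lemma det_transfer_matrix: "det (transfer_matrix M T f E n \<omega>) = 1"
proof -
  have "det (forward_transfer M T f E k \<omega>) = 1" "det (backward_transfer M T f E k \<omega>) = 1" for k
    by (induction k) (simp_all add: det_mul det_one_step)
  then show ?thesis
    by (simp add: transfer_matrix_def)
qed

text \<open>The determinant is the area spanned by the two columns, and each column is bounded by
  the operator norm. This makes growth rates nonnegative, so that a nonzero exponent is
  positive.\<close>

lemma onorm_ge_1:
  fixes A :: "real^2^2"
  assumes "det A = 1"
  shows "1 \<le> onorm ((*v) A)"
proof -
  let ?a = "A *v axis 1 1" and ?b = "A *v axis 2 1"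
  have le: "norm (A *v axis i 1) \<le> onorm ((*v) A)" for i
    using onorm[OF matrix_vector_mul_bounded_linear[of A], of "axis i 1"] by simp
  have c: "?a $ i = A $ i $ 1" "?b $ i = A $ i $ 2" for i
    by (simp_all add: matrix_vector_mult_def sum_2 axis_def)
  have "1 = (?a $ 1 * ?b $ 2 - ?a $ 2 * ?b $ 1)"
    using assms by (simp add: det_2 c mult.commute)
  \<comment> \<open>Turning \<open>?b\<close> by a right angle makes the determinant an inner
    product and keeps the norm.\<close>
  also have "\<dots> = inner ?a (vector [?b $ 2, - ?b $ 1])"
    by (simp add: inner_vec_def sum_2)
  also have "\<dots> \<le> norm ?a * norm (vector [?b $ 2, - ?b $ 1] :: real^2)"
    by (rule norm_cauchy_schwarz)
  also have "norm (vector [?b $ 2, - ?b $ 1] :: real^2) = norm ?b"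
    by (simp add: norm_vec_def L2_set_def sum_2 add.commute)
  also have "norm ?a * norm ?b \<le> onorm ((*v) A) * onorm ((*v) A)"
    by (intro mult_mono le order_trans[OF norm_ge_zero le]) auto
  finally have "1\<^sup>2 \<le> (onorm ((*v) A))\<^sup>2"
    by (simp add: power2_eq_square)
  then show ?thesis
    by (rule power2_le_imp_le) (rule order_trans[OF norm_ge_zero le])
qed

text \<open>A one-step matrix at site \<open>k\<close> moves the pair of values at \<open>k\<close>
  and \<open>k - 1\<close> one site to the right. The columns follow the two solutions whose data at
  0 and -1 are the unit vectors.\<close>

lemma forward_transfer_entries:
  fixes M :: "'a measure" and T :: "'a \<Rightarrow> 'a" and f :: "'a \<Rightarrow> real" and \<omega> :: 'a
  defines "V \<equiv> \<lambda>n. f (int_iterate M T n \<omega>)"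
  assumes u: "\<And>n. jacobi V u n = complex_of_real E * u n" and v: "\<And>n. jacobi V v n = complex_of_real E * v n"
    and init: "u 0 = 1" "u (-1) = 0" "v 0 = 0" "v (-1) = 1"
  defines "A \<equiv> \<lambda>k. forward_transfer M T f E k \<omega>"
  shows "complex_of_real (A k $ 1 $ 1) = u (int k) \<and> complex_of_real (A k $ 2 $ 1) = u (int k - 1) \<and>
    complex_of_real (A k $ 1 $ 2) = v (int k) \<and> complex_of_real (A k $ 2 $ 2) = v (int k - 1)"
proof (induction k)
  case 0
  then show ?case by (simp add: A_def init mat_def)
next
  case (Suc k)
  have "u (int k + 1) = (complex_of_real E - complex_of_real (V (int k))) * u (int k) - u (int k - 1)"
    "v (int k + 1) = (complex_of_real E - complex_of_real (V (int k))) * v (int k) - v (int k - 1)"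
    using u[of "int k"] v[of "int k"] by (simp_all add: jacobi_def algebra_simps)
  with Suc show ?case
    by (simp add: A_def matrix2_mult one_step_matrix_def V_def add.commute)
qed

text \<open>The inverse matrix at site \<open>- k - 1\<close> moves the pair of values at
  \<open>- k\<close> and \<open>- k - 1\<close> one site to the left.\<close>

lemma backward_transfer_entries:
  fixes M :: "'a measure" and T :: "'a \<Rightarrow> 'a" and f :: "'a \<Rightarrow> real" and \<omega> :: 'a
  defines "V \<equiv> \<lambda>n. f (int_iterate M T n \<omega>)"
  assumes u: "\<And>n. jacobi V u n = complex_of_real E * u n" and v: "\<And>n. jacobi V v n = complex_of_real E * v n"
    and init: "u 0 = 1" "u (-1) = 0" "v 0 = 0" "v (-1) = 1"
  defines "A \<equiv> \<lambda>k. backward_transfer M T f E k \<omega>"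
  shows "complex_of_real (A k $ 1 $ 1) = u (- int k) \<and> complex_of_real (A k $ 2 $ 1) = u (- int k - 1) \<and>
    complex_of_real (A k $ 1 $ 2) = v (- int k) \<and> complex_of_real (A k $ 2 $ 2) = v (- int k - 1)"
proof (induction k)
  case 0
  then show ?case by (simp add: A_def init mat_def)
next
  case (Suc k)
  let ?m = "- int k - 1"
  have m: "- int (Suc k) = ?m" by simp
  have "u (?m - 1) = (complex_of_real E - complex_of_real (V ?m)) * u ?m - u (- int k)"
    "v (?m - 1) = (complex_of_real E - complex_of_real (V ?m)) * v ?m - v (- int k)"
    using u[of ?m] v[of ?m] by (simp_all add: jacobi_def algebra_simps)
  with Suc show ?case
    unfolding m by (simp add: A_def matrix2_mult matrix_inv_one_step V_def m del: of_nat_Suc)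
qed

text \<open>\<open>sol\<close> takes data at 0 and 1, whereas transfer matrices start from 0 and -1;
  the values at 1 are chosen so that the equation at 0 gives the prescribed ones at -1.\<close>

lemma real_solutions:
  obtains u v where "\<And>n. jacobi V u n = z * u n" "\<And>n. jacobi V v n = z * v n"
    "u 0 = 1" "u (-1) = 0" "v 0 = 0" "v (-1) = 1"
proof -
  define u where "u = sol V z 1 (z - complex_of_real (V 0))"
  define v where "v = sol V z 0 (-1)"
  have "jacobi V u n = z * u n" "jacobi V v n = z * v n" for n
    by (simp_all add: u_def v_def jacobi_sol)
  note * = this
  have "u (-1) = 0" "v (-1) = 1"
    using *[of 0] by (simp_all add: jacobi_def) (simp_all add: u_def v_def algebra_simps)
  with * show ?thesis
    by (intro that[of u v]) (simp_all add: u_def v_def)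
qed

lemma growth_rate_nonneg: "0 \<le> growth_rate M T f E \<omega> n"
  unfolding growth_rate_def using ln_ge_zero[OF onorm_ge_1[OF det_transfer_matrix]] by (intro mult_nonneg_nonneg) auto

lemma poly_growth_limsup:
  fixes F :: "int filter"
  assumes lim: "filterlim (\<lambda>n. real_of_int \<bar>n\<bar>) at_top F"
    and bd: "\<forall>\<^sub>F n in F. onorm ((*v) (transfer_matrix M T f E n \<omega>)) \<le> C * (1 + (real_of_int \<bar>n\<bar> + 1)\<^sup>2)\<^sup>2"
  shows "Limsup F (\<lambda>n. ereal (growth_rate M T f E \<omega> n)) \<le> 0"
proof (cases "F = bot")
  case True
  then show ?thesis by (simp add: Limsup_bot)
next
  case False
  \<comment> \<open>A positive constant keeps the logarithm of the bound meaningful.\<close>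
  define K where "K = max C 1"
  have K: "K > 0" by (simp add: K_def)
  let ?h = "\<lambda>x::real. 1 / x * ln (K * (1 + (x + 1)\<^sup>2)\<^sup>2)"
  have h: "(?h \<longlongrightarrow> 0) at_top"
    using K by real_asymp
  have hF: "((\<lambda>n. ?h (real_of_int \<bar>n\<bar>)) \<longlongrightarrow> 0) F"
    by (rule filterlim_compose[OF h lim])
  have "\<forall>\<^sub>F n in F. ereal (growth_rate M T f E \<omega> n) \<le> ereal (?h (real_of_int \<bar>n\<bar>))"
    using bd
  proof eventually_elim
    case (elim n)
    have "C * (1 + (real_of_int \<bar>n\<bar> + 1)\<^sup>2)\<^sup>2 \<le> K * (1 + (real_of_int \<bar>n\<bar> + 1)\<^sup>2)\<^sup>2"
      by (intro mult_right_mono) (auto simp: K_def)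
    with elim have "onorm ((*v) (transfer_matrix M T f E n \<omega>)) \<le> K * (1 + (real_of_int \<bar>n\<bar> + 1)\<^sup>2)\<^sup>2"
      by linarith
    moreover have "1 \<le> onorm ((*v) (transfer_matrix M T f E n \<omega>))"
      by (rule onorm_ge_1[OF det_transfer_matrix])
    ultimately have "ln (onorm ((*v) (transfer_matrix M T f E n \<omega>))) \<le> ln (K * (1 + (real_of_int \<bar>n\<bar> + 1)\<^sup>2)\<^sup>2)"
      by (intro ln_mono) auto
    then show ?case
      unfolding growth_rate_def by (simp only: ereal_less_eq) (intro mult_left_mono, auto)
  qed
  then have "Limsup F (\<lambda>n. ereal (growth_rate M T f E \<omega> n)) \<le> Limsup F (\<lambda>n. ereal (?h (real_of_int \<bar>n\<bar>)))"
    by (rule Limsup_mono)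
  also have "\<dots> = ereal 0"
    using hF by (intro lim_imp_Limsup False) simp
  finally show ?thesis by (simp add: zero_ereal_def)
qed

lemma filterlim_abs_int_at_top: "filterlim (\<lambda>n::int. real_of_int \<bar>n\<bar>) at_top at_top"
  unfolding filterlim_at_top eventually_at_top_linorder
proof
  fix Z :: real
  show "\<exists>N::int. \<forall>n\<ge>N. Z \<le> real_of_int \<bar>n\<bar>"
    by (intro exI[of _ "\<lceil>Z\<rceil>"] allI impI) linarith
qed

lemma filterlim_abs_int_at_bot: "filterlim (\<lambda>n::int. real_of_int \<bar>n\<bar>) at_top at_bot"
  unfolding filterlim_at_top eventually_at_bot_linorder
proof
  fix Z :: real
  show "\<exists>N::int. \<forall>n\<le>N. Z \<le> real_of_int \<bar>n\<bar>"
    by (intro exI[of _ "- \<lceil>Z\<rceil>"] allI impI) linarith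
qed

text \<open>Gives the entries at the neighbouring sites \<open>n\<close> and \<open>n - 1\<close>
  one common weight.\<close>

lemma weight_mono:
  assumes "cmod a \<le> C * (1 + (real_of_int n)\<^sup>2)\<^sup>2" "\<bar>n\<bar> \<le> m"
  shows "cmod a \<le> \<bar>C\<bar> * (1 + (real_of_int m)\<^sup>2)\<^sup>2"
proof -
  have "(real_of_int n)\<^sup>2 \<le> (real_of_int m)\<^sup>2"
    using assms(2) by (intro power2_le_iff_abs_le[THEN iffD2]) auto
  then have "\<bar>C\<bar> * (1 + (real_of_int n)\<^sup>2)\<^sup>2 \<le> \<bar>C\<bar> * (1 + (real_of_int m)\<^sup>2)\<^sup>2"
    by (intro mult_left_mono power_mono) auto
  moreover have "C * (1 + (real_of_int n)\<^sup>2)\<^sup>2 \<le> \<bar>C\<bar> * (1 + (real_of_int n)\<^sup>2)\<^sup>2"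
    by (intro mult_right_mono) auto
  ultimately show ?thesis using assms(1) by linarith
qed

lemma onorm_le_entries:
  fixes A :: "real^2^2"
  assumes "\<bar>A$1$1\<bar> \<le> a" "\<bar>A$2$1\<bar> \<le> a" "\<bar>A$1$2\<bar> \<le> b" "\<bar>A$2$2\<bar> \<le> b"
  shows "onorm ((*v) A) \<le> 2 * a + 2 * b"
  using onorm_le_matrix_component_sum[of A] assms by (simp add: sum_2)

lemma transfer_growth_right:
  fixes M :: "'a measure" and T :: "'a \<Rightarrow> 'a" and f :: "'a \<Rightarrow> real" and \<omega> :: 'a
  defines "V \<equiv> \<lambda>n. f (int_iterate M T n \<omega>)"
  assumes "\<forall>u. (\<forall>n. jacobi V u n = complex_of_real E * u n) \<longrightarrow>
    (\<exists>C. \<forall>n\<in>{1..}. cmod (u n) \<le> C * (1 + (real_of_int n)\<^sup>2)\<^sup>2)"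
  shows "Limsup at_top (\<lambda>n. ereal (growth_rate M T f E \<omega> n)) \<le> 0"
proof -
  obtain u v where u: "\<And>n. jacobi V u n = complex_of_real E * u n" and v: "\<And>n. jacobi V v n = complex_of_real E * v n"
    and init: "u 0 = 1" "u (-1) = 0" "v 0 = 0" "v (-1) = 1"
    using real_solutions[of V "complex_of_real E"] by blast
  obtain C1 where C1: "\<forall>n\<in>{1..}. cmod (u n) \<le> C1 * (1 + (real_of_int n)\<^sup>2)\<^sup>2"
    using assms(2) u by blast
  obtain C2 where C2: "\<forall>n\<in>{1..}. cmod (v n) \<le> C2 * (1 + (real_of_int n)\<^sup>2)\<^sup>2"
    using assms(2) v by blast
  \<comment> \<open>The restriction \<open>n \<ge> 2\<close> keeps the site \<open>n - 1\<close> of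
    the second row in the half-line \<open>{1..}\<close>.\<close>
  have bd: "onorm ((*v) (transfer_matrix M T f E n \<omega>)) \<le> (2 * \<bar>C1\<bar> + 2 * \<bar>C2\<bar>) * (1 + (real_of_int \<bar>n\<bar> + 1)\<^sup>2)\<^sup>2"
    if n: "n \<ge> 2" for n
  proof -
    let ?w = "(1 + (real_of_int (n + 1))\<^sup>2)\<^sup>2"
    note e = forward_transfer_entries[where k = "nat n", OF u[unfolded V_def] v[unfolded V_def] init]
    have t: "transfer_matrix M T f E n \<omega> = forward_transfer M T f E (nat n) \<omega>"
      using n by (simp add: transfer_matrix_def)
    have le: "cmod (u m) \<le> \<bar>C1\<bar> * ?w" "cmod (v m) \<le> \<bar>C2\<bar> * ?w" if "m \<in> {n-1, n}" for m
    proof -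
      have "m \<in> {1..}" "\<bar>m\<bar> \<le> n + 1" using that n by auto
      then show "cmod (u m) \<le> \<bar>C1\<bar> * ?w" "cmod (v m) \<le> \<bar>C2\<bar> * ?w"
        using weight_mono[of "u m" C1 m "n + 1"] weight_mono[of "v m" C2 m "n + 1"] C1 C2 by blast+
    qed
    have "onorm ((*v) (transfer_matrix M T f E n \<omega>)) \<le> 2 * (\<bar>C1\<bar> * ?w) + 2 * (\<bar>C2\<bar> * ?w)"
    proof (rule onorm_le_entries)
      note d = e[THEN conjunct1] e[THEN conjunct2, THEN conjunct1]
        e[THEN conjunct2, THEN conjunct2, THEN conjunct1] e[THEN conjunct2, THEN conjunct2, THEN conjunct2]
      have abs_le: "\<bar>x\<bar> \<le> c" if "complex_of_real x = y" "cmod y \<le> c" for x y c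
        using that(2) unfolding that(1)[symmetric] norm_of_real .
      have i: "int (nat n) = n" "int (nat n) - 1 = n - 1" using n by auto
      show "\<bar>transfer_matrix M T f E n \<omega> $ 1 $ 1\<bar> \<le> \<bar>C1\<bar> * ?w"
        "\<bar>transfer_matrix M T f E n \<omega> $ 2 $ 1\<bar> \<le> \<bar>C1\<bar> * ?w"
        "\<bar>transfer_matrix M T f E n \<omega> $ 1 $ 2\<bar> \<le> \<bar>C2\<bar> * ?w"
        "\<bar>transfer_matrix M T f E n \<omega> $ 2 $ 2\<bar> \<le> \<bar>C2\<bar> * ?w"
        unfolding t using abs_le[OF d(1)] abs_le[OF d(2)] abs_le[OF d(3)] abs_le[OF d(4)] le[of n] le[of "n - 1"]
        unfolding i by blast+
    qed
    then show ?thesis using n by (simp add: algebra_simps)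
  qed
  have "\<forall>\<^sub>F n in at_top. onorm ((*v) (transfer_matrix M T f E n \<omega>)) \<le> (2 * \<bar>C1\<bar> + 2 * \<bar>C2\<bar>) * (1 + (real_of_int \<bar>n\<bar> + 1)\<^sup>2)\<^sup>2"
    using eventually_ge_at_top[of 2] by eventually_elim (rule bd)
  then show ?thesis
    by (rule poly_growth_limsup[OF filterlim_abs_int_at_top])
qed

lemma transfer_growth_left:
  fixes M :: "'a measure" and T :: "'a \<Rightarrow> 'a" and f :: "'a \<Rightarrow> real" and \<omega> :: 'a
  defines "V \<equiv> \<lambda>n. f (int_iterate M T n \<omega>)"
  assumes "\<forall>u. (\<forall>n. jacobi V u n = complex_of_real E * u n) \<longrightarrow>
    (\<exists>C. \<forall>n\<in>{..-1}. cmod (u n) \<le> C * (1 + (real_of_int n)\<^sup>2)\<^sup>2)"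
  shows "Limsup at_bot (\<lambda>n. ereal (growth_rate M T f E \<omega> n)) \<le> 0"
proof -
  obtain u v where u: "\<And>n. jacobi V u n = complex_of_real E * u n" and v: "\<And>n. jacobi V v n = complex_of_real E * v n"
    and init: "u 0 = 1" "u (-1) = 0" "v 0 = 0" "v (-1) = 1"
    using real_solutions[of V "complex_of_real E"] by blast
  obtain C1 where C1: "\<forall>n\<in>{..-1}. cmod (u n) \<le> C1 * (1 + (real_of_int n)\<^sup>2)\<^sup>2"
    using assms(2) u by blast
  obtain C2 where C2: "\<forall>n\<in>{..-1}. cmod (v n) \<le> C2 * (1 + (real_of_int n)\<^sup>2)\<^sup>2"
    using assms(2) v by blast
  \<comment> \<open>Now \<open>n - 1\<close> stays in the half-line automatically, but its modulus
    is \<open>- n + 1\<close>, which is the site in the weight.\<close>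
  have bd: "onorm ((*v) (transfer_matrix M T f E n \<omega>)) \<le> (2 * \<bar>C1\<bar> + 2 * \<bar>C2\<bar>) * (1 + (real_of_int \<bar>n\<bar> + 1)\<^sup>2)\<^sup>2"
    if n: "n \<le> -1" for n
  proof -
    let ?w = "(1 + (real_of_int (- n + 1))\<^sup>2)\<^sup>2"
    note e = backward_transfer_entries[where k = "nat (- n)", OF u[unfolded V_def] v[unfolded V_def] init]
    have t: "transfer_matrix M T f E n \<omega> = backward_transfer M T f E (nat (- n)) \<omega>"
      using n by (simp add: transfer_matrix_def)
    have le: "cmod (u m) \<le> \<bar>C1\<bar> * ?w" "cmod (v m) \<le> \<bar>C2\<bar> * ?w" if "m \<in> {n-1, n}" for m
    proof -
      have "m \<in> {..-1}" "\<bar>m\<bar> \<le> - n + 1" using that n by auto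
      then show "cmod (u m) \<le> \<bar>C1\<bar> * ?w" "cmod (v m) \<le> \<bar>C2\<bar> * ?w"
        using weight_mono[of "u m" C1 m "- n + 1"] weight_mono[of "v m" C2 m "- n + 1"] C1 C2 by blast+
    qed
    have "onorm ((*v) (transfer_matrix M T f E n \<omega>)) \<le> 2 * (\<bar>C1\<bar> * ?w) + 2 * (\<bar>C2\<bar> * ?w)"
    proof (rule onorm_le_entries)
      note d = e[THEN conjunct1] e[THEN conjunct2, THEN conjunct1]
        e[THEN conjunct2, THEN conjunct2, THEN conjunct1] e[THEN conjunct2, THEN conjunct2, THEN conjunct2]
      have abs_le: "\<bar>x\<bar> \<le> c" if "complex_of_real x = y" "cmod y \<le> c" for x y c
        using that(2) unfolding that(1)[symmetric] norm_of_real .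
      have i: "- int (nat (- n)) = n" "- int (nat (- n)) - 1 = n - 1" using n by auto
      show "\<bar>transfer_matrix M T f E n \<omega> $ 1 $ 1\<bar> \<le> \<bar>C1\<bar> * ?w"
        "\<bar>transfer_matrix M T f E n \<omega> $ 2 $ 1\<bar> \<le> \<bar>C1\<bar> * ?w"
        "\<bar>transfer_matrix M T f E n \<omega> $ 1 $ 2\<bar> \<le> \<bar>C2\<bar> * ?w"
        "\<bar>transfer_matrix M T f E n \<omega> $ 2 $ 2\<bar> \<le> \<bar>C2\<bar> * ?w"
        unfolding t using abs_le[OF d(1)] abs_le[OF d(2)] abs_le[OF d(3)] abs_le[OF d(4)] le[of n] le[of "n - 1"]
        unfolding i by blast+
    qed
    then show ?thesis using n by (simp add: algebra_simps)
  qed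
  have "\<forall>\<^sub>F n in at_bot. onorm ((*v) (transfer_matrix M T f E n \<omega>)) \<le> (2 * \<bar>C1\<bar> + 2 * \<bar>C2\<bar>) * (1 + (real_of_int \<bar>n\<bar> + 1)\<^sup>2)\<^sup>2"
    using eventually_le_at_bot[of "-1"] by eventually_elim (rule bd)
  then show ?thesis
    by (rule poly_growth_limsup[OF filterlim_abs_int_at_bot])
qed

section \<open>Measures on a bounded interval\<close>

text \<open>Meant for spectral measures, with \<open>R\<close> a bound for the spectrum. Bounded
  support makes continuous functions integrable and lets polynomials approximate them uniformly
  almost everywhere.\<close>

locale compact_measure = finite_measure \<nu> for \<nu> :: "real measure" +
  fixes R :: real
  assumes sets_nu [simp, measurable_cong]: "sets \<nu> = sets borel"
    and supp: "AE x in \<nu>. \<bar>x\<bar> \<le> R"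
begin

lemma borel_measurable_nu: "borel_measurable \<nu> = borel_measurable borel"
  by (rule measurable_cong_sets) simp_all

lemma continuous_bound:
  fixes g :: "real \<Rightarrow> real"
  assumes "continuous_on UNIV g"
  obtains B where "0 \<le> B" "\<And>x. \<bar>x\<bar> \<le> R \<Longrightarrow> \<bar>g x\<bar> \<le> B"
proof -
  have "compact (g ` {-R..R})"
    by (intro compact_continuous_image continuous_on_subset[OF assms]) auto
  then obtain B where "\<forall>y\<in>g ` {-R..R}. \<bar>y\<bar> \<le> B"
    using compact_imp_bounded bounded_real by blast
  then have "\<bar>g x\<bar> \<le> B" if "\<bar>x\<bar> \<le> R" for x
    using that by (auto simp: abs_le_iff)
  then have "\<bar>g x\<bar> \<le> \<bar>B\<bar>" if "\<bar>x\<bar> \<le> R" for x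
    using that abs_ge_self[of B] by (blast intro: order_trans)
  then show ?thesis
    using that[of "\<bar>B\<bar>"] by simp
qed

lemma continuous_measurable: "continuous_on UNIV g \<Longrightarrow> (g :: real \<Rightarrow> real) \<in> borel_measurable \<nu>"
  unfolding borel_measurable_nu by (rule borel_measurable_continuous_onI)

lemma integrable_mult_continuous:
  fixes g k :: "real \<Rightarrow> real"
  assumes g: "continuous_on UNIV g" and k: "integrable \<nu> k"
  shows "integrable \<nu> (\<lambda>x. g x * k x)"
proof -
  obtain B where B: "0 \<le> B" "\<And>x. \<bar>x\<bar> \<le> R \<Longrightarrow> \<bar>g x\<bar> \<le> B"
    using continuous_bound[OF g] by blast
  have "integrable \<nu> (\<lambda>x. B * k x)"
    using k by simp
  then show ?thesis
  proof (rule Bochner_Integration.integrable_bound)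
    show "(\<lambda>x. g x * k x) \<in> borel_measurable \<nu>"
      by (intro borel_measurable_times continuous_measurable g borel_measurable_integrable k)
    show "AE x in \<nu>. norm (g x * k x) \<le> norm (B * k x)"
      using supp by eventually_elim (use B in \<open>auto simp: abs_mult intro!: mult_right_mono\<close>)
  qed
qed

lemma integrable_continuous: "continuous_on UNIV g \<Longrightarrow> integrable \<nu> (g :: real \<Rightarrow> real)"
  using integrable_mult_continuous[of g "\<lambda>_. 1"] by simp

lemma continuous_poly: "continuous_on UNIV (poly p :: real \<Rightarrow> real)"
  by (intro continuous_intros)

lemma integrable_poly [simp]: "integrable \<nu> (poly p)"
  by (rule integrable_continuous[OF continuous_poly])

lemma weierstrass:
  fixes g :: "real \<Rightarrow> real"
  assumes "continuous_on UNIV g" "0 < e"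
  obtains p :: "real poly" where "\<And>x. \<bar>x\<bar> \<le> R \<Longrightarrow> \<bar>g x - poly p x\<bar> < e"
proof -
  obtain h where h: "real_polynomial_function h" "\<And>x. x \<in> {-R..R} \<Longrightarrow> \<bar>g x - h x\<bar> < e"
    using Stone_Weierstrass_real_polynomial_function[OF compact_Icc continuous_on_subset[OF assms(1) subset_UNIV] assms(2)]
    by blast
  obtain a n where an: "h = (\<lambda>x. \<Sum>i\<le>n. a i * x ^ i)"
    using h(1) unfolding real_polynomial_function_iff_sum by blast
  have "poly (\<Sum>i\<le>n. monom (a i) i) x = h x" for x
    by (simp add: an poly_sum poly_monom)
  then show ?thesis
    using h(2) by (intro that[of "\<Sum>i\<le>n. monom (a i) i"]) (auto simp: abs_le_iff)
qed

lemma weierstrass_seq: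
  fixes g :: "real \<Rightarrow> real"
  assumes "continuous_on UNIV g"
  obtains p :: "nat \<Rightarrow> real poly" where "\<And>k x. \<bar>x\<bar> \<le> R \<Longrightarrow> \<bar>g x - poly (p k) x\<bar> < 1 / (real k + 1)"
proof -
  have "\<forall>k. \<exists>p. \<forall>x. \<bar>x\<bar> \<le> R \<longrightarrow> \<bar>g x - poly p x\<bar> < 1 / (real k + 1)"
  proof
    fix k :: nat
    obtain p where "\<And>x. \<bar>x\<bar> \<le> R \<Longrightarrow> \<bar>g x - poly p x\<bar> < 1 / (real k + 1)"
      by (rule weierstrass[OF assms, of "1 / (real k + 1)"]) auto
    then show "\<exists>p. \<forall>x. \<bar>x\<bar> \<le> R \<longrightarrow> \<bar>g x - poly p x\<bar> < 1 / (real k + 1)" by blast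
  qed
  from choice[OF this] show ?thesis
    using that by blast
qed

text \<open>On the support the approximants are bounded by \<open>B + 1\<close>, which gives the
  majorants. The squares are needed for norms of vectors.\<close>

lemma integral_limit:
  fixes g :: "real \<Rightarrow> real"
  assumes g: "continuous_on UNIV g" and p: "\<And>k x. \<bar>x\<bar> \<le> R \<Longrightarrow> \<bar>g x - poly (p k) x\<bar> < 1 / (real k + 1)"
    and k: "integrable \<nu> k"
  shows "(\<lambda>i. \<integral>x. poly (p i) x * k x \<partial>\<nu>) \<longlonglongrightarrow> (\<integral>x. g x * k x \<partial>\<nu>)"
    "(\<lambda>i. \<integral>x. (poly (p i) x)\<^sup>2 * k x \<partial>\<nu>) \<longlonglongrightarrow> (\<integral>x. (g x)\<^sup>2 * k x \<partial>\<nu>)"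
proof -
  obtain B where B: "0 \<le> B" "\<And>x. \<bar>x\<bar> \<le> R \<Longrightarrow> \<bar>g x\<bar> \<le> B"
    using continuous_bound[OF g] by blast
  have bd: "\<bar>poly (p i) x\<bar> \<le> B + 1" if "\<bar>x\<bar> \<le> R" for i x
  proof -
    have "1 / (real i + 1) \<le> 1" by simp
    then show ?thesis using B(2)[OF that] p[OF that, of i] by linarith
  qed
  have lim: "(\<lambda>i. poly (p i) x) \<longlonglongrightarrow> g x" if "\<bar>x\<bar> \<le> R" for x
  proof -
    have "(\<lambda>i. 1 / (real i + 1)) \<longlonglongrightarrow> 0"
      by real_asymp
    then have "(\<lambda>i. poly (p i) x - g x) \<longlonglongrightarrow> 0"
      by (rule Lim_null_comparison[rotated]) (use p[OF that] in \<open>auto simp: abs_minus_commute intro!: always_eventually less_imp_le\<close>)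
    then show ?thesis by (rule LIM_zero_cancel)
  qed
  have [measurable]: "g \<in> borel_measurable \<nu>" "k \<in> borel_measurable \<nu>" "poly (p i) \<in> borel_measurable \<nu>" for i
    using g k by (auto intro: continuous_measurable continuous_poly)
  show "(\<lambda>i. \<integral>x. poly (p i) x * k x \<partial>\<nu>) \<longlonglongrightarrow> (\<integral>x. g x * k x \<partial>\<nu>)"
  proof (rule integral_dominated_convergence[where w = "\<lambda>x. (B + 1) * \<bar>k x\<bar>"])
    show "AE x in \<nu>. (\<lambda>i. poly (p i) x * k x) \<longlonglongrightarrow> g x * k x"
      using supp by eventually_elim (intro tendsto_intros lim)
    show "AE x in \<nu>. norm (poly (p i) x * k x) \<le> (B + 1) * \<bar>k x\<bar>" for i
      using supp by eventually_elim (use bd in \<open>auto simp: abs_mult intro!: mult_right_mono\<close>)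
  qed (use k in auto)
  show "(\<lambda>i. \<integral>x. (poly (p i) x)\<^sup>2 * k x \<partial>\<nu>) \<longlonglongrightarrow> (\<integral>x. (g x)\<^sup>2 * k x \<partial>\<nu>)"
  proof (rule integral_dominated_convergence[where w = "\<lambda>x. (B + 1)\<^sup>2 * \<bar>k x\<bar>"])
    show "AE x in \<nu>. (\<lambda>i. (poly (p i) x)\<^sup>2 * k x) \<longlonglongrightarrow> (g x)\<^sup>2 * k x"
      using supp by eventually_elim (intro tendsto_intros lim)
    show "AE x in \<nu>. norm ((poly (p i) x)\<^sup>2 * k x) \<le> (B + 1)\<^sup>2 * \<bar>k x\<bar>" for i
      using supp
    proof eventually_elim
      case (elim x)
      have "(poly (p i) x)\<^sup>2 \<le> (B + 1)\<^sup>2"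
        using bd[OF elim, of i] B(1) by (simp add: abs_le_square_iff[symmetric])
      then show ?case by (simp add: abs_mult mult_right_mono)
    qed
  qed (use k in auto)
qed

lemma integral_continuous_zero:
  assumes k: "integrable \<nu> k" and zero: "\<And>p. (\<integral>x. poly p x * k x \<partial>\<nu>) = 0" and g: "continuous_on UNIV g"
  shows "(\<integral>x. g x * k x \<partial>\<nu>) = 0"
proof -
  obtain p where p: "\<And>i x. \<bar>x\<bar> \<le> R \<Longrightarrow> \<bar>g x - poly (p i) x\<bar> < 1 / (real i + 1)"
    using weierstrass_seq[OF g] by blast
  show ?thesis
    using LIMSEQ_unique[OF integral_limit(1)[OF g p k]] zero by simp
qed

text \<open>Weierstrass extends the hypothesis to continuous functions, and dominated convergence to
  indicators of half-lines. The measures whose densities are the positive and negative parts of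
  \<open>k\<close> then agree on a generator stable under intersection.\<close>

lemma moments_determine:
  assumes k: "integrable \<nu> k" and zero: "\<And>p. (\<integral>x. poly p x * k x \<partial>\<nu>) = 0"
  shows "AE x in \<nu>. k x = 0"
proof -
  have [measurable]: "k \<in> borel_measurable \<nu>"
    using k by simp
  have half: "(\<integral>x. indicator {..a} x * k x \<partial>\<nu>) = 0" for a
  proof (rule LIMSEQ_unique)
    \<comment> \<open>Piecewise linear functions decreasing to the indicator of
      \<open>{..a}\<close>.\<close>
    define g where "g = (\<lambda>i x. max 0 (min 1 (1 - real i * (x - a))))"
    have c: "continuous_on UNIV (g i)" for i
      unfolding g_def by (intro continuous_intros)
    have [measurable]: "g i \<in> borel_measurable \<nu>" for i
      by (rule continuous_measurable[OF c])
    show "(\<lambda>i. \<integral>x. g i x * k x \<partial>\<nu>) \<longlonglongrightarrow> 0"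
      using integral_continuous_zero[OF k zero c] by simp
    show "(\<lambda>i. \<integral>x. g i x * k x \<partial>\<nu>) \<longlonglongrightarrow> (\<integral>x. indicator {..a} x * k x \<partial>\<nu>)"
    proof (rule integral_dominated_convergence[where w = "\<lambda>x. \<bar>k x\<bar>"])
      have "(\<lambda>i. g i x) \<longlonglongrightarrow> indicator {..a} x" for x
      proof (cases "x \<le> a")
        case True
        then have "g i x = 1" for i
          by (simp add: g_def mult_nonneg_nonpos)
        then show ?thesis using True by simp
      next
        case False
        then obtain N :: nat where N: "1 / (x - a) < real N"
          using reals_Archimedean2 by blast
        have "g i x = 0" if "i \<ge> N" for i
        proof -
          have "1 < real N * (x - a)"
            using N False by (simp add: field_simps)
          also have "\<dots> \<le> real i * (x - a)"
            using that False by (intro mult_right_mono) auto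
          finally show ?thesis by (simp add: g_def)
        qed
        then have "\<forall>\<^sub>F i in sequentially. g i x = indicator {..a} x"
          using False by (auto simp: eventually_sequentially)
        then show ?thesis by (rule tendsto_eventually)
      qed
      then show "AE x in \<nu>. (\<lambda>i. g i x * k x) \<longlonglongrightarrow> indicator {..a} x * k x"
        by (intro AE_I2 tendsto_intros)
      show "AE x in \<nu>. norm (g i x * k x) \<le> \<bar>k x\<bar>" for i
      proof (rule AE_I2)
        fix x
        have "\<bar>g i x\<bar> \<le> 1" by (simp add: g_def)
        then show "norm (g i x * k x) \<le> \<bar>k x\<bar>"
          unfolding real_norm_def abs_mult by (rule mult_left_le_one_le[rotated 2]) auto
      qed
    qed (use k in auto)
  qed
  let ?P = "\<lambda>x. ennreal (k x)" and ?N = "\<lambda>x. ennreal (- k x)"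
  have eq: "emeasure (density \<nu> ?P) {..a} = emeasure (density \<nu> ?N) {..a}"
    and fin: "emeasure (density \<nu> ?P) {..a} \<noteq> \<infinity>" for a
  proof -
    have ik: "integrable \<nu> (\<lambda>x. indicator {..a} x * k x)"
      by (rule Bochner_Integration.integrable_bound[OF k]) (auto split: split_indicator)
    have A: "(\<integral>\<^sup>+x. ?P x * indicator {..a} x \<partial>\<nu>) = (\<integral>\<^sup>+x. ennreal (indicator {..a} x * k x) \<partial>\<nu>)"
      "(\<integral>\<^sup>+x. ?N x * indicator {..a} x \<partial>\<nu>) = (\<integral>\<^sup>+x. ennreal (- (indicator {..a} x * k x)) \<partial>\<nu>)"
      by (intro nn_integral_cong; simp split: split_indicator)+
    have B: "(\<integral>\<^sup>+x. ennreal (indicator {..a} x * k x) \<partial>\<nu>) \<noteq> \<infinity>"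
      "(\<integral>\<^sup>+x. ennreal (- (indicator {..a} x * k x)) \<partial>\<nu>) \<noteq> \<infinity>"
      using ik unfolding real_integrable_def by auto
    have "enn2real (\<integral>\<^sup>+x. ennreal (indicator {..a} x * k x) \<partial>\<nu>) = enn2real (\<integral>\<^sup>+x. ennreal (- (indicator {..a} x * k x)) \<partial>\<nu>)"
      using half[of a] unfolding real_lebesgue_integral_def[OF ik] by simp
    then have "(\<integral>\<^sup>+x. ennreal (indicator {..a} x * k x) \<partial>\<nu>) = (\<integral>\<^sup>+x. ennreal (- (indicator {..a} x * k x)) \<partial>\<nu>)"
      using ennreal_enn2real[of "\<integral>\<^sup>+x. ennreal (indicator {..a} x * k x) \<partial>\<nu>"]
        ennreal_enn2real[of "\<integral>\<^sup>+x. ennreal (- (indicator {..a} x * k x)) \<partial>\<nu>"] B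
      by (simp add: less_top)
    then show "emeasure (density \<nu> ?P) {..a} = emeasure (density \<nu> ?N) {..a}"
      "emeasure (density \<nu> ?P) {..a} \<noteq> \<infinity>"
      using A B by (simp_all add: emeasure_density)
  qed
  have "density \<nu> ?P = density \<nu> ?N"
  proof (rule measure_eqI_generator_eq[where E = "range (\<lambda>a::real. {..a})" and \<Omega> = UNIV and A = "\<lambda>i. {..real i}"])
    show "Int_stable (range (\<lambda>a::real. {..a}))"
      by (auto simp: Int_stable_def)
    show "sets (density \<nu> ?P) = sigma_sets UNIV (range (\<lambda>a::real. {..a}))"
      "sets (density \<nu> ?N) = sigma_sets UNIV (range (\<lambda>a::real. {..a}))"
      by (simp_all add: borel_eq_atMost)
    show "(\<Union>i. {..real i}) = UNIV"
      using real_arch_simple by auto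
    show "range (\<lambda>i. {..real i}) \<subseteq> range (\<lambda>a. {..a})"
      by auto
  qed (use eq fin in auto)
  then have "AE x in \<nu>. ?P x = ?N x"
    by (intro density_unique) measurable
  then show ?thesis
  proof eventually_elim
    case (elim x)
    then show ?case
      by (cases "0 \<le> k x") (auto simp: ennreal_neg dest: sym)
  qed
qed

text \<open>The representing function is the limit of a minimizing sequence of polynomials for the
  functional \<open>\<integral>p\<^sup>2 d\<nu> - 2 L p\<close>. The bound \<open>9\<close> is not sharp; only its independence of \<open>L\<close> matters.\<close>

lemma riesz_poly:
  fixes L :: "real poly \<Rightarrow> real"
  assumes add: "\<And>p q. L (p + q) = L p + L q" and smult: "\<And>c p. L (smult c p) = c * L p"
    and bound: "\<And>p. (L p)\<^sup>2 \<le> (\<integral>x. (poly p x)\<^sup>2 \<partial>\<nu>)"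
  obtains h where "h \<in> borel_measurable borel" "integrable \<nu> (\<lambda>x. (h x)\<^sup>2)" "(\<integral>\<^sup>+x. ennreal ((h x)\<^sup>2) \<partial>\<nu>) \<le> 9"
    "\<And>p. L p = (\<integral>x. poly p x * h x \<partial>\<nu>)"
proof -
  define Q where "Q = (\<lambda>p. \<integral>x. (poly p x)\<^sup>2 \<partial>\<nu>)"
  define J where "J = (\<lambda>p. Q p - 2 * L p)"
  have iq [simp]: "integrable \<nu> (\<lambda>x. (poly p x)\<^sup>2)" for p
    by (rule integrable_continuous) (intro continuous_intros)
  have ipq [simp]: "integrable \<nu> (\<lambda>x. poly p x * poly q x)" for p q
    by (rule integrable_continuous) (intro continuous_intros)
  have Q0: "0 \<le> Q p" for p
    unfolding Q_def by simp
  have Lle: "\<bar>L p\<bar> \<le> sqrt (Q p)" for p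
    using bound[of p] by (simp add: Q_def real_le_rsqrt)
  \<comment> \<open>The bound on \<open>L\<close> gives \<open>J p \<ge> s\<^sup>2 - 2 * s\<close>
    with \<open>s = sqrt (Q p)\<close>, and the minimum of the right-hand side is -1.\<close>
  have Jlow: "- 1 \<le> J p" for p
  proof -
    have "0 \<le> (sqrt (Q p) - 1)\<^sup>2" by simp
    then have "0 \<le> Q p - 2 * sqrt (Q p) + 1"
      using Q0[of p] by (simp add: power2_diff)
    then show ?thesis
      using Lle[of p] by (simp add: J_def)
  qed
  define m where "m = Inf (range J)"
  have bdd: "bdd_below (range J)"
    using Jlow by (auto intro!: bdd_belowI[of _ "-1"])
  have m: "m \<le> J p" for p
    unfolding m_def by (rule cInf_lower) (use bdd in auto)
  \<comment> \<open>The accuracy is a square because distances between near-minimizers are of the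
    order of the square roots of their defects.\<close>
  have "\<exists>p. J p < m + ((1 / 2) ^ k)\<^sup>2" for k
    using cInf_less_iff[of "range J" "m + ((1 / 2) ^ k)\<^sup>2"] bdd by (auto simp: m_def)
  then have "\<forall>k. \<exists>p. J p < m + ((1 / 2) ^ k)\<^sup>2"
    by blast
  from choice[OF this] obtain P where P: "\<And>k. J (P k) < m + ((1 / 2) ^ k)\<^sup>2"
    by blast
  define \<epsilon> where "\<epsilon> = (\<lambda>k::nat. ((1 / 2 :: real) ^ k))"
  have \<epsilon>: "0 < \<epsilon> k" "\<epsilon> k \<le> 1" for k
    by (simp_all add: \<epsilon>_def power_le_one)
  have \<epsilon>_mono: "\<epsilon> j \<le> \<epsilon> k" if "k \<le> j" for j k
    using that by (simp add: \<epsilon>_def power_decreasing)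
  have \<epsilon>_sq: "(\<epsilon> j)\<^sup>2 \<le> (\<epsilon> k)\<^sup>2" if "k \<le> j" for j k
    by (rule power_mono[OF \<epsilon>_mono[OF that]]) (use \<epsilon>(1)[of j] in simp)
  have \<epsilon>_lim: "\<epsilon> \<longlonglongrightarrow> 0"
    unfolding \<epsilon>_def by (rule LIMSEQ_power_zero) simp
  have P': "J (P k) \<le> m + (\<epsilon> k)\<^sup>2" for k
    using P[of k] by (simp add: \<epsilon>_def)
  have Q_lin: "Q (p + smult t q) = Q p + 2 * t * (\<integral>x. poly p x * poly q x \<partial>\<nu>) + t\<^sup>2 * Q q" for p q t
  proof -
    have "(poly (p + smult t q) x)\<^sup>2 = (poly p x)\<^sup>2 + 2 * t * (poly p x * poly q x) + t\<^sup>2 * (poly q x)\<^sup>2" for x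
      by (simp add: power2_eq_square algebra_simps)
    then show ?thesis
      unfolding Q_def by simp
  qed
  \<comment> \<open>Parallelogram law: with \<open>h\<close> the midpoint of \<open>p\<close> and
    \<open>q\<close>, \<open>Q (p - q) = 2 * J p + 2 * J q - 4 * J h\<close>, since the linear parts
    cancel.\<close>
  have par: "Q (P j - P k) \<le> 2 * (\<epsilon> j)\<^sup>2 + 2 * (\<epsilon> k)\<^sup>2" for j k
  proof -
    let ?p = "P j" and ?q = "P k" and ?h = "smult (1/2) (P j + P k)"
    have "Q (?p - ?q) = Q ?p - 2 * (\<integral>x. poly ?p x * poly ?q x \<partial>\<nu>) + Q ?q"
      using Q_lin[of ?p "-1" ?q] by simp
    moreover have "Q ?h = (Q ?p + 2 * (\<integral>x. poly ?p x * poly ?q x \<partial>\<nu>) + Q ?q) / 4"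
    proof -
      have "Q ?h = Q (0 + smult (1/2) (?p + ?q))" by simp
      also have "\<dots> = Q (?p + smult 1 ?q) / 4"
        unfolding Q_lin[of 0] by (simp add: Q_def power2_eq_square)
      finally show ?thesis unfolding Q_lin by simp
    qed
    moreover have "L ?h = (L ?p + L ?q) / 2"
      by (simp only: smult add)
    moreover have "m \<le> J ?h" by (rule m)
    ultimately show ?thesis
      using P'[of j] P'[of k] unfolding J_def by (simp add: field_simps)
  qed
  \<comment> \<open>An almost everywhere convergent subsequence will be extracted from convergence
    in the mean. As the measure is finite,
    \<open>\<bar>a\<bar> \<le> \<delta> + a\<^sup>2 / \<delta>\<close> leads there from the
    squares.\<close>
  have l1: "(\<integral>x. \<bar>poly (P j) x - poly (P k) x\<bar> \<partial>\<nu>) \<le> \<delta> * measure \<nu> (space \<nu>) + Q (P j - P k) / \<delta>" if "\<delta> > 0" for \<delta> j k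
  proof -
    have "(\<integral>x. \<bar>poly (P j) x - poly (P k) x\<bar> \<partial>\<nu>) \<le> (\<integral>x. \<delta> + (poly (P j - P k) x)\<^sup>2 / \<delta> \<partial>\<nu>)"
    proof (rule integral_mono)
      show "integrable \<nu> (\<lambda>x. \<bar>poly (P j) x - poly (P k) x\<bar>)"
        by (intro integrable_abs Bochner_Integration.integrable_diff integrable_poly)
      show "integrable \<nu> (\<lambda>x. \<delta> + (poly (P j - P k) x)\<^sup>2 / \<delta>)"
        using iq[of "P j - P k"] by (intro Bochner_Integration.integrable_add integrable_divide) auto
      fix x
      have "0 \<le> (\<bar>poly (P j) x - poly (P k) x\<bar> - \<delta>)\<^sup>2" by simp
      then have "2 * (\<bar>poly (P j) x - poly (P k) x\<bar> * \<delta>) \<le> (poly (P j) x - poly (P k) x)\<^sup>2 + \<delta>\<^sup>2"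
        by (simp add: power2_diff power2_eq_square algebra_simps)
      moreover have "0 \<le> \<bar>poly (P j) x - poly (P k) x\<bar> * \<delta>"
        using that by simp
      ultimately have "\<bar>poly (P j) x - poly (P k) x\<bar> * \<delta> \<le> (poly (P j) x - poly (P k) x)\<^sup>2 + \<delta>\<^sup>2"
        by linarith
      then show "\<bar>poly (P j) x - poly (P k) x\<bar> \<le> \<delta> + (poly (P j - P k) x)\<^sup>2 / \<delta>"
        using that by (simp add: field_simps power2_eq_square)
    qed
    also have "\<dots> = \<delta> * measure \<nu> (space \<nu>) + Q (P j - P k) / \<delta>"
      unfolding Q_def using iq[of "P j - P k"] by (subst Bochner_Integration.integral_add) auto
    finally show ?thesis .
  qed
  obtain r where r: "strict_mono r" "AE x in \<nu>. Cauchy (\<lambda>i. poly (P (r i)) x)"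
  proof (rule cauchy_L1_AE_cauchy_subseq[of \<nu> "\<lambda>i. poly (P i)"])
    show "integrable \<nu> (poly (P n))" for n by simp
    fix e :: real assume e: "e > 0"
    define M where "M = measure \<nu> (space \<nu>) + 1"
    have M: "M > 0" by (simp add: M_def add_nonneg_pos)
    define \<delta> where "\<delta> = e / (2 * M)"
    have \<delta>: "\<delta> > 0" using e M by (simp add: \<delta>_def)
    have "(\<lambda>n. 4 * (\<epsilon> n)\<^sup>2 / \<delta>) \<longlonglongrightarrow> 4 * 0\<^sup>2 / \<delta>"
      by (intro tendsto_intros \<epsilon>_lim) (use \<delta> in auto)
    then have "\<forall>\<^sub>F n in sequentially. 4 * (\<epsilon> n)\<^sup>2 / \<delta> < e / 2"
      by (rule order_tendstoD) (use e in auto)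
    then obtain N where N: "4 * (\<epsilon> N)\<^sup>2 / \<delta> < e / 2"
      by (auto simp: eventually_sequentially)
    have "(\<integral>x. \<bar>poly (P i) x - poly (P j) x\<bar> \<partial>\<nu>) < e" if "i \<ge> N" "j \<ge> N" for i j
    proof -
      have "(\<epsilon> i)\<^sup>2 \<le> (\<epsilon> N)\<^sup>2" "(\<epsilon> j)\<^sup>2 \<le> (\<epsilon> N)\<^sup>2"
        by (intro \<epsilon>_sq that)+
      then have "Q (P i - P j) \<le> 4 * (\<epsilon> N)\<^sup>2"
        using par[of i j] by linarith
      then have "Q (P i - P j) / \<delta> \<le> 4 * (\<epsilon> N)\<^sup>2 / \<delta>"
        using \<delta> by (intro divide_right_mono) auto
      moreover have "\<delta> * measure \<nu> (space \<nu>) \<le> \<delta> * M"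
        using \<delta> by (intro mult_left_mono) (auto simp: M_def)
      moreover have "\<delta> * M = e / 2"
        using M by (simp add: \<delta>_def)
      ultimately show ?thesis
        using l1[OF \<delta>, of i j] N by linarith
    qed
    then show "\<exists>N. \<forall>i\<ge>N. \<forall>j\<ge>N. (\<integral>x. norm (poly (P i) x - poly (P j) x) \<partial>\<nu>) < e"
      by (auto intro!: exI[of _ N])
  qed auto
  define h where "h = (\<lambda>x. lim (\<lambda>i. poly (P (r i)) x))"
  have [measurable]: "poly p \<in> borel_measurable borel" for p :: "real poly"
    by (rule borel_measurable_continuous_onI[OF continuous_poly])
  have hm [measurable]: "h \<in> borel_measurable borel"
    unfolding h_def by measurable
  have lim: "AE x in \<nu>. (\<lambda>i. poly (P (r i)) x) \<longlonglongrightarrow> h x"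
    using r(2) by eventually_elim (simp add: h_def Cauchy_convergent_iff convergent_LIMSEQ_iff)
  \<comment> \<open>Hands estimates for the \<open>P j\<close> over to \<open>h\<close>: with
    \<open>p = 0\<close> for the norm of \<open>h\<close>, with \<open>p = P k\<close> for its
    distance from the sequence.\<close>
  have fatou: "(\<integral>\<^sup>+x. ennreal ((h x - poly p x)\<^sup>2) \<partial>\<nu>) \<le> ennreal c"
    if "\<And>j. j \<ge> k \<Longrightarrow> Q (P j - p) \<le> c" for p c k
  proof -
    have "(\<integral>\<^sup>+x. ennreal ((h x - poly p x)\<^sup>2) \<partial>\<nu>) = (\<integral>\<^sup>+x. liminf (\<lambda>i. ennreal ((poly (P (r i)) x - poly p x)\<^sup>2)) \<partial>\<nu>)"
    proof (rule nn_integral_cong_AE)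
      show "AE x in \<nu>. ennreal ((h x - poly p x)\<^sup>2) = liminf (\<lambda>i. ennreal ((poly (P (r i)) x - poly p x)\<^sup>2))"
        using lim
      proof eventually_elim
        case (elim x)
        have "(\<lambda>i. ennreal ((poly (P (r i)) x - poly p x)\<^sup>2)) \<longlonglongrightarrow> ennreal ((h x - poly p x)\<^sup>2)"
          by (intro tendsto_ennrealI tendsto_intros elim)
        then show ?case
          by (rule lim_imp_Liminf[OF sequentially_bot, symmetric])
      qed
    qed
    also have "\<dots> \<le> liminf (\<lambda>i. \<integral>\<^sup>+x. ennreal ((poly (P (r i)) x - poly p x)\<^sup>2) \<partial>\<nu>)"
      by (rule nn_integral_liminf) measurable
    also have "\<dots> \<le> limsup (\<lambda>i. \<integral>\<^sup>+x. ennreal ((poly (P (r i)) x - poly p x)\<^sup>2) \<partial>\<nu>)"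
      by (rule Liminf_le_Limsup) simp
    also have "\<dots> \<le> ennreal c"
    proof (rule Limsup_bounded)
      show "\<forall>\<^sub>F i in sequentially. (\<integral>\<^sup>+x. ennreal ((poly (P (r i)) x - poly p x)\<^sup>2) \<partial>\<nu>) \<le> ennreal c"
        using eventually_ge_at_top[of k]
      proof eventually_elim
        case (elim i)
        then have "r i \<ge> k" using seq_suble[OF r(1), of i] by linarith
        have "(\<integral>\<^sup>+x. ennreal ((poly (P (r i)) x - poly p x)\<^sup>2) \<partial>\<nu>) = ennreal (Q (P (r i) - p))"
          unfolding Q_def poly_diff by (rule nn_integral_eq_integral) (use iq[of "P (r i) - p"] in auto)
        then show ?case
          using that[OF \<open>r i \<ge> k\<close>] by (simp add: ennreal_leI)
      qed
    qed
    finally show ?thesis .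
  qed
  \<comment> \<open>From \<open>m \<le> J 0 = 0\<close> one gets \<open>J (P j) \<le> 1\<close>, so
    \<open>s = sqrt (Q (P j))\<close> satisfies \<open>s\<^sup>2 \<le> 2 * s + 1\<close>, which
    excludes \<open>s > 3\<close>.\<close>
  have Q_le: "Q (P j) \<le> 9" for j
  proof -
    have "m \<le> 0"
      using m[of 0] smult[of 0 0] by (simp add: J_def Q_def)
    then have "Q (P j) - 2 * L (P j) \<le> 1"
      using P'[of j] \<epsilon>[of j] power_le_one[of "\<epsilon> j" 2] by (simp add: J_def)
    then have *: "Q (P j) \<le> 2 * sqrt (Q (P j)) + 1"
      using Lle[of "P j"] by linarith
    have "sqrt (Q (P j)) \<le> 3"
    proof (rule ccontr)
      assume "\<not> sqrt (Q (P j)) \<le> 3"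
      then have "3 * sqrt (Q (P j)) < sqrt (Q (P j)) * sqrt (Q (P j))"
        by (intro mult_strict_right_mono) linarith+
      also have "\<dots> = Q (P j)"
        using Q0 by simp
      finally show False
        using * \<open>\<not> sqrt (Q (P j)) \<le> 3\<close> by linarith
    qed
    then have "(sqrt (Q (P j)))\<^sup>2 \<le> 3\<^sup>2"
      by (rule power_mono) (simp add: Q0)
    then show ?thesis using Q0 by simp
  qed
  have h9: "(\<integral>\<^sup>+x. ennreal ((h x)\<^sup>2) \<partial>\<nu>) \<le> 9"
    using fatou[of 0 0 9] Q_le by simp
  have ih2: "integrable \<nu> (\<lambda>x. (h x)\<^sup>2)"
  proof (rule integrableI_bounded)
    have "(9::ennreal) < \<infinity>"
      using ennreal_less_top[of 9] by simp
    from le_less_trans[OF h9 this] show "(\<integral>\<^sup>+x. ennreal (norm ((h x)\<^sup>2)) \<partial>\<nu>) < \<infinity>"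
      by simp
  qed measurable
  have ihd2: "integrable \<nu> (\<lambda>x. (h x - poly p x)\<^sup>2)" for p
  proof (rule Bochner_Integration.integrable_bound)
    show "integrable \<nu> (\<lambda>x. 2 * (h x)\<^sup>2 + 2 * (poly p x)\<^sup>2)"
      using ih2 by simp
    show "AE x in \<nu>. norm ((h x - poly p x)\<^sup>2) \<le> norm (2 * (h x)\<^sup>2 + 2 * (poly p x)\<^sup>2)"
    proof (rule AE_I2)
      fix x
      have "0 \<le> (h x + poly p x)\<^sup>2" by simp
      then have "(h x - poly p x)\<^sup>2 \<le> 2 * (h x)\<^sup>2 + 2 * (poly p x)\<^sup>2"
        by (simp add: power2_eq_square algebra_simps)
      then show "norm ((h x - poly p x)\<^sup>2) \<le> norm (2 * (h x)\<^sup>2 + 2 * (poly p x)\<^sup>2)"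
        by simp
    qed
  qed measurable
  have ih: "integrable \<nu> h"
  proof (rule Bochner_Integration.integrable_bound)
    show "integrable \<nu> (\<lambda>x. 1 + (h x)\<^sup>2)"
      using ih2 by simp
    show "AE x in \<nu>. norm (h x) \<le> norm (1 + (h x)\<^sup>2)"
    proof (rule AE_I2)
      fix x
      have "0 \<le> (\<bar>h x\<bar> - 1)\<^sup>2" by simp
      then have "2 * \<bar>h x\<bar> \<le> 1 + (h x)\<^sup>2"
        by (simp add: power2_diff)
      then show "norm (h x) \<le> norm (1 + (h x)\<^sup>2)" by simp
    qed
  qed measurable
  have "L p = (\<integral>x. poly p x * h x \<partial>\<nu>)" for p
  proof -
    have iph: "integrable \<nu> (\<lambda>x. poly p x * h x)"
      by (rule integrable_mult_continuous[OF continuous_poly ih])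
    define D where "D = (\<lambda>k. (\<integral>x. poly (P k) x * poly p x \<partial>\<nu>))"
    \<comment> \<open>First variation at \<open>P k\<close> with steps \<open>\<epsilon> k\<close>
      and \<open>- \<epsilon> k\<close> along \<open>p\<close>. The defect and the quadratic term
      are both of order \<open>(\<epsilon> k)\<^sup>2\<close>, so division by the step leaves an
      error of order \<open>\<epsilon> k\<close>.\<close>
    have var: "\<bar>D k - L p\<bar> \<le> \<epsilon> k * (1 + Q p)" for k
    proof -
      have t: "- (\<epsilon> k)\<^sup>2 \<le> 2 * t * (D k - L p) + t\<^sup>2 * Q p" for t
        using m[of "P k + smult t p"] P'[of k] unfolding J_def Q_lin add smult D_def
        by (simp add: algebra_simps)
      have "- ((\<epsilon> k) * \<epsilon> k) \<le> \<epsilon> k * (2 * s * (D k - L p) + \<epsilon> k * Q p)" if "s\<^sup>2 = 1" for s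
      proof -
        have e: "(\<epsilon> k * s)\<^sup>2 = \<epsilon> k * \<epsilon> k"
          using that by (simp add: power_mult_distrib power2_eq_square[of "\<epsilon> k"])
        show ?thesis
          using t[of "\<epsilon> k * s"] unfolding e by (simp add: power2_eq_square algebra_simps)
      qed
      then have *: "- \<epsilon> k \<le> 2 * s * (D k - L p) + \<epsilon> k * Q p" if "s\<^sup>2 = 1" for s
        using mult_le_cancel_left_pos[OF \<epsilon>(1)[of k], of "- \<epsilon> k" "2 * s * (D k - L p) + \<epsilon> k * Q p"] that
        by simp
      show ?thesis
        using *[of 1] *[of "-1"] Q0[of p] \<epsilon>(1)[of k] mult_nonneg_nonneg[of "\<epsilon> k" "Q p"]
        by (simp add: abs_le_iff algebra_simps)
    qed
    \<comment> \<open>A product is split as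
      \<open>\<epsilon> k * a\<^sup>2 + b\<^sup>2 / \<epsilon> k\<close>; the weight balances the
      two terms, as the squared distance of \<open>h\<close> from \<open>P k\<close> is at most
      \<open>4 * (\<epsilon> k)\<^sup>2\<close>.\<close>
    have diff: "\<bar>D k - (\<integral>x. poly p x * h x \<partial>\<nu>)\<bar> \<le> \<epsilon> k * (Q p + 4)" for k
    proof -
      have "D k - (\<integral>x. poly p x * h x \<partial>\<nu>) = (\<integral>x. poly p x * (poly (P k) x - h x) \<partial>\<nu>)"
        unfolding D_def using iph
        by (subst Bochner_Integration.integral_diff[symmetric]) (auto simp: algebra_simps)
      also have "\<bar>\<dots>\<bar> \<le> (\<integral>x. \<bar>poly p x * (poly (P k) x - h x)\<bar> \<partial>\<nu>)"
        by (rule integral_abs_bound)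
      also have "\<dots> \<le> (\<integral>x. \<epsilon> k * (poly p x)\<^sup>2 + (h x - poly (P k) x)\<^sup>2 / \<epsilon> k \<partial>\<nu>)"
      proof (rule integral_mono)
        have "integrable \<nu> (\<lambda>x. poly p x * poly (P k) x - poly p x * h x)"
          using iph by simp
        then show "integrable \<nu> (\<lambda>x. \<bar>poly p x * (poly (P k) x - h x)\<bar>)"
          by (simp add: algebra_simps)
        show "integrable \<nu> (\<lambda>x. \<epsilon> k * (poly p x)\<^sup>2 + (h x - poly (P k) x)\<^sup>2 / \<epsilon> k)"
          using ihd2[of "P k"] by simp
        fix x
        let ?a = "\<bar>poly p x\<bar>" and ?b = "\<bar>poly (P k) x - h x\<bar>"
        have "0 \<le> (\<epsilon> k * ?a - ?b)\<^sup>2" by simp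
        then have "2 * (\<epsilon> k * (?a * ?b)) \<le> (\<epsilon> k * ?a)\<^sup>2 + ?b\<^sup>2"
          by (simp add: power2_diff algebra_simps)
        moreover have "0 \<le> \<epsilon> k * (?a * ?b)"
          using \<epsilon>(1)[of k] by simp
        ultimately have "\<epsilon> k * (?a * ?b) \<le> (\<epsilon> k * ?a)\<^sup>2 + ?b\<^sup>2"
          by linarith
        moreover have "?b\<^sup>2 = (h x - poly (P k) x)\<^sup>2"
          by (simp add: power2_commute)
        ultimately have "?a * ?b \<le> ((\<epsilon> k)\<^sup>2 * (poly p x)\<^sup>2 + (h x - poly (P k) x)\<^sup>2) / \<epsilon> k"
          using \<epsilon>(1)[of k] by (simp add: pos_le_divide_eq power_mult_distrib mult.commute)
        also have "\<dots> = \<epsilon> k * (poly p x)\<^sup>2 + (h x - poly (P k) x)\<^sup>2 / \<epsilon> k"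
          using \<epsilon>(1)[of k] by (simp add: add_divide_distrib power2_eq_square)
        finally show "\<bar>poly p x * (poly (P k) x - h x)\<bar> \<le> \<epsilon> k * (poly p x)\<^sup>2 + (h x - poly (P k) x)\<^sup>2 / \<epsilon> k"
          by (simp add: abs_mult)
      qed
      also have "\<dots> = \<epsilon> k * Q p + (\<integral>x. (h x - poly (P k) x)\<^sup>2 \<partial>\<nu>) / \<epsilon> k"
        using ihd2[of "P k"] by (simp add: Q_def)
      also have "(\<integral>x. (h x - poly (P k) x)\<^sup>2 \<partial>\<nu>) \<le> 4 * (\<epsilon> k)\<^sup>2"
      proof -
        have "Q (P j - P k) \<le> 4 * (\<epsilon> k)\<^sup>2" if "j \<ge> k" for j
        proof -
          have "(\<epsilon> j)\<^sup>2 \<le> (\<epsilon> k)\<^sup>2"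
            by (rule \<epsilon>_sq[OF that])
          then show ?thesis using par[of j k] by linarith
        qed
        from fatou[OF this] have "ennreal (\<integral>x. (h x - poly (P k) x)\<^sup>2 \<partial>\<nu>) \<le> ennreal (4 * (\<epsilon> k)\<^sup>2)"
          using nn_integral_eq_integral[OF ihd2[of "P k"]] by simp
        then show ?thesis by (simp add: ennreal_le_iff)
      qed
      finally show ?thesis
        using \<epsilon>(1)[of k] by (simp add: divide_right_mono power2_eq_square algebra_simps)
    qed
    have "\<bar>L p - (\<integral>x. poly p x * h x \<partial>\<nu>)\<bar> \<le> \<epsilon> k * (2 * Q p + 5)" for k
      using var[of k] diff[of k] by (simp add: algebra_simps abs_le_iff)
    moreover have "(\<lambda>k. \<epsilon> k * (2 * Q p + 5)) \<longlonglongrightarrow> 0 * (2 * Q p + 5)"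
      by (intro tendsto_intros \<epsilon>_lim)
    ultimately have "\<bar>L p - (\<integral>x. poly p x * h x \<partial>\<nu>)\<bar> \<le> 0 * (2 * Q p + 5)"
      by (intro tendsto_lowerbound[of "\<lambda>k. \<epsilon> k * (2 * Q p + 5)" _ sequentially]) auto
    then show ?thesis by simp
  qed
  with hm ih2 h9 show ?thesis
    by (rule that)
qed

end

section \<open>Spectral measures and generalized eigenfunctions\<close>

definition poly_op :: "(l2 \<Rightarrow> l2) \<Rightarrow> real poly \<Rightarrow> l2 \<Rightarrow> l2" where
  "poly_op H p w = (\<Sum>i\<le>degree p. coeff p i *\<^sub>R (H ^^ i) w)"

lemma poly_op_eq:
  assumes "degree p \<le> N"
  shows "poly_op H p w = (\<Sum>i\<le>N. coeff p i *\<^sub>R (H ^^ i) w)"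
  unfolding poly_op_def
  by (rule sum.mono_neutral_left) (use assms in \<open>auto simp: coeff_eq_0\<close>)

lemma poly_op_add: "poly_op H (p + q) w = poly_op H p w + poly_op H q w"
proof -
  let ?N = "max (degree p) (degree q)"
  show ?thesis
    unfolding poly_op_eq[of "p + q" ?N, OF degree_add_le_max] poly_op_eq[of p ?N, OF max.cobounded1]
      poly_op_eq[of q ?N, OF max.cobounded2]
    by (simp add: sum.distrib scaleR_add_left)
qed

lemma poly_op_smult: "poly_op H (smult c p) w = c *\<^sub>R poly_op H p w"
  unfolding poly_op_eq[of "smult c p" "degree p", OF degree_smult_le] poly_op_def[of H p]
  by (simp add: scaleR_sum_right)

lemma poly_op_diff: "poly_op H (p - q) w = poly_op H p w - poly_op H q w"
  using poly_op_add[of H p "smult (-1) q" w] unfolding poly_op_smult by simp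

lemma poly_op_1: "poly_op H 1 w = w"
  by (simp add: poly_op_def)

lemma poly_op_pCons:
  assumes "linear H"
  shows "poly_op H (pCons 0 p) w = H (poly_op H p w)"
proof -
  have "poly_op H (pCons 0 p) w = (\<Sum>i\<le>Suc (degree p). coeff (pCons 0 p) i *\<^sub>R (H ^^ i) w)"
    by (rule poly_op_eq) (simp add: degree_pCons_le)
  also have "\<dots> = (\<Sum>i\<le>degree p. coeff p i *\<^sub>R H ((H ^^ i) w))"
    by (subst sum.atMost_Suc_shift) simp
  also have "\<dots> = H (poly_op H p w)"
    by (simp add: poly_op_def linear_sum[OF assms] linear_scale[OF assms])
  finally show ?thesis .
qed

lemma poly_op_monom_mult:
  assumes "linear H"
  shows "poly_op H (monom 1 k * p) w = (H ^^ k) (poly_op H p w)"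
proof (induction k)
  case 0
  then show ?case by (simp add: monom_0)
next
  case (Suc k)
  then show ?case
    by (simp add: monom_Suc poly_op_pCons[OF assms])
qed

lemma bounded_linear_funpow:
  fixes H :: "l2 \<Rightarrow> l2"
  assumes "bounded_linear H"
  shows "bounded_linear (H ^^ k)"
proof (induction k)
  case 0
  then show ?case by (simp add: bounded_linear_ident[unfolded id_def] id_def)
next
  case (Suc k)
  then show ?case
    using bounded_linear_compose[OF assms Suc] by (simp add: o_def)
qed

text \<open>The name refers to the subspace generated by \<open>u\<close> under the operator. The
  moment identity turns \<open>p \<mapsto> poly_op H p u\<close> into an isometry for the norm of
  square integrable functions of \<open>\<nu>\<close>.\<close>

locale cyclic_vector = compact_measure \<nu> R for \<nu> :: "real measure" and R :: real +
  fixes V :: "int \<Rightarrow> real" and K :: real and u :: l2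
  assumes V: "\<forall>n. \<bar>V n\<bar> \<le> K"
    and moments: "\<And>k. u \<bullet> (jacobi_l2 V ^^ k) u = (\<integral>x. x ^ k \<partial>\<nu>)"
begin

abbreviation "H \<equiv> jacobi_l2 V"

lemma H_bounded_linear: "bounded_linear H"
  by (rule bounded_linear_jacobi_l2[OF V])

lemma H_linear: "linear H"
  by (rule bounded_linear.linear[OF H_bounded_linear])

lemma H_pow_inner: "(H ^^ i) a \<bullet> b = a \<bullet> (H ^^ i) b"
proof (induction i arbitrary: a b)
  case (Suc i)
  have "(H ^^ Suc i) a \<bullet> b = (H ^^ i) a \<bullet> H b"
    by (simp add: inner_jacobi_l2[OF V])
  then show ?case
    by (simp add: Suc funpow_swap1)
qed simp

lemma integrable_power [simp]: "integrable \<nu> (\<lambda>x. x ^ n)"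
  by (rule integrable_continuous) (intro continuous_intros)

text \<open>Symmetry moves all powers of \<open>H\<close> to one side, so that only moments of
  \<open>\<nu>\<close> occur.\<close>

lemma poly_op_inner: "poly_op H p u \<bullet> poly_op H q u = (\<integral>x. poly p x * poly q x \<partial>\<nu>)"
proof -
  have m: "(H ^^ i) u \<bullet> (H ^^ j) u = (\<integral>x. x ^ (i + j) \<partial>\<nu>)" for i j
    unfolding H_pow_inner moments[symmetric] by (simp add: funpow_add)
  have "poly_op H p u \<bullet> poly_op H q u =
      (\<Sum>i\<le>degree p. \<Sum>j\<le>degree q. coeff p i * coeff q j * (\<integral>x. x ^ (i + j) \<partial>\<nu>))"
    unfolding poly_op_def inner_sum_left inner_sum_right by (subst sum.swap) (simp add: m algebra_simps)
  also have "\<dots> = (\<integral>x. (\<Sum>i\<le>degree p. \<Sum>j\<le>degree q. coeff p i * coeff q j * x ^ (i + j)) \<partial>\<nu>)"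
    by (subst Bochner_Integration.integral_sum, simp, rule sum.cong, simp, subst Bochner_Integration.integral_sum) simp_all
  also have "\<dots> = (\<integral>x. poly p x * poly q x \<partial>\<nu>)"
    by (rule Bochner_Integration.integral_cong) (simp_all add: poly_altdef sum_product power_add algebra_simps)
  finally show ?thesis .
qed

lemma norm_poly_op: "(norm (poly_op H p u))\<^sup>2 = (\<integral>x. (poly p x)\<^sup>2 \<partial>\<nu>)"
  unfolding power2_norm_eq_inner poly_op_inner by (simp add: power2_eq_square)

text \<open>The vector \<open>v\<close> is \<open>g(H) u\<close>, a limit of polynomials in
  \<open>H\<close> applied to \<open>u\<close>. The three conclusions serve to identify its spectral
  measure, to invert \<open>H - E\<close>, and to compute its coordinates from the densities that
  represent those of polynomials.\<close>

lemma functional_calculus: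
  fixes g :: "real \<Rightarrow> real"
  assumes g: "continuous_on UNIV g"
  obtains v where "\<And>k. v \<bullet> (H ^^ k) v = (\<integral>x. x ^ k * (g x)\<^sup>2 \<partial>\<nu>)"
    "\<And>E. (norm (H v - E *\<^sub>R v - u))\<^sup>2 = (\<integral>x. ((x - E) * g x - 1)\<^sup>2 \<partial>\<nu>)"
    "\<And>l n h. bounded_linear l \<longrightarrow> integrable \<nu> h \<longrightarrow>
       (\<forall>p. l (seq_of (poly_op H p u) n) = (\<integral>x. poly p x * h x \<partial>\<nu>)) \<longrightarrow>
       l (seq_of v n) = (\<integral>x. g x * h x \<partial>\<nu>)"
proof -
  obtain p where p: "\<And>i x. \<bar>x\<bar> \<le> R \<Longrightarrow> \<bar>g x - poly (p i) x\<bar> < 1 / (real i + 1)"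
    using weierstrass_seq[OF g] by blast
  define w where "w = (\<lambda>i. poly_op H (p i) u)"
  have "Cauchy w"
  proof (rule metric_CauchyI)
    fix e :: real assume e: "e > 0"
    define M where "M = measure \<nu> (space \<nu>) + 1"
    have M: "M > 0" by (simp add: M_def add_nonneg_pos)
    \<comment> \<open>Two approximants of index at least \<open>n\<close> differ by at most
      \<open>2 / (n + 1)\<close> on the support; by the isometry this is squared and
      integrated.\<close>
    have "(\<lambda>n. (2 / (real n + 1))\<^sup>2) \<longlonglongrightarrow> 0"
      by real_asymp
    from tendsto_mult_left_zero[OF this] have "(\<lambda>n. (2 / (real n + 1))\<^sup>2 * M) \<longlonglongrightarrow> 0" .
    then have "\<forall>\<^sub>F n in sequentially. (2 / (real n + 1))\<^sup>2 * M < e\<^sup>2"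
      by (rule order_tendstoD) (use e in auto)
    then obtain N where N: "(2 / (real N + 1))\<^sup>2 * M < e\<^sup>2"
      by (auto simp: eventually_sequentially)
    have "dist (w i) (w j) < e" if ij: "i \<ge> N" "j \<ge> N" for i j
    proof -
      have "(norm (w i - w j))\<^sup>2 = (\<integral>x. (poly (p i - p j) x)\<^sup>2 \<partial>\<nu>)"
        unfolding w_def poly_op_diff[symmetric] by (rule norm_poly_op)
      also have "\<dots> \<le> (\<integral>x. (2 / (real N + 1))\<^sup>2 \<partial>\<nu>)"
      proof (rule integral_mono_AE)
        show "integrable \<nu> (\<lambda>x. (poly (p i - p j) x)\<^sup>2)"
          by (rule integrable_continuous) (intro continuous_intros)
        show "AE x in \<nu>. (poly (p i - p j) x)\<^sup>2 \<le> (2 / (real N + 1))\<^sup>2"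
          using supp
        proof eventually_elim
          case (elim x)
          have "1 / (real i + 1) \<le> 1 / (real N + 1)" "1 / (real j + 1) \<le> 1 / (real N + 1)"
            using ij by (auto intro!: divide_left_mono)
          then have "\<bar>poly (p i - p j) x\<bar> \<le> 1 / (real N + 1) + 1 / (real N + 1)"
            using p[OF elim, of i] p[OF elim, of j] unfolding poly_diff by linarith
          then have "\<bar>poly (p i - p j) x\<bar> \<le> 2 / (real N + 1)"
            by simp
          then show ?case
            by (rule power2_le_iff_abs_le[THEN iffD2, rotated]) simp
        qed
      qed simp
      also have "\<dots> \<le> (2 / (real N + 1))\<^sup>2 * M"
        by (simp add: M_def algebra_simps)
      also note N
      finally have "(norm (w i - w j))\<^sup>2 < e\<^sup>2" .
      then show ?thesis
        using e by (simp add: dist_norm power2_less_imp_less)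
    qed
    then show "\<exists>N. \<forall>i\<ge>N. \<forall>j\<ge>N. dist (w i) (w j) < e"
      by blast
  qed
  obtain v where v: "w \<longlonglongrightarrow> v"
    using Cauchy_convergent[OF \<open>Cauchy w\<close>] unfolding convergent_def by (rule exE)
  have one: "v \<bullet> (H ^^ k) v = (\<integral>x. x ^ k * (g x)\<^sup>2 \<partial>\<nu>)" for k
  proof (rule LIMSEQ_unique)
    show "(\<lambda>i. w i \<bullet> (H ^^ k) (w i)) \<longlonglongrightarrow> v \<bullet> (H ^^ k) v"
      by (intro tendsto_inner v bounded_linear.tendsto[OF bounded_linear_funpow[OF H_bounded_linear]])
    have "w i \<bullet> (H ^^ k) (w i) = (\<integral>x. (poly (p i) x)\<^sup>2 * x ^ k \<partial>\<nu>)" for i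
      unfolding w_def poly_op_monom_mult[OF H_linear, symmetric] poly_op_inner
      by (rule Bochner_Integration.integral_cong) (simp_all add: poly_monom power2_eq_square)
    then show "(\<lambda>i. w i \<bullet> (H ^^ k) (w i)) \<longlonglongrightarrow> (\<integral>x. x ^ k * (g x)\<^sup>2 \<partial>\<nu>)"
      using integral_limit(2)[OF g p integrable_power[of k]] by (simp add: mult.commute)
  qed
  have two: "(norm (H v - E *\<^sub>R v - u))\<^sup>2 = (\<integral>x. ((x - E) * g x - 1)\<^sup>2 \<partial>\<nu>)" for E
  proof (rule LIMSEQ_unique)
    show "(\<lambda>i. (norm (H (w i) - E *\<^sub>R w i - u))\<^sup>2) \<longlonglongrightarrow> (norm (H v - E *\<^sub>R v - u))\<^sup>2"
      by (intro tendsto_intros v bounded_linear.tendsto[OF H_bounded_linear])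
    \<comment> \<open>Expanding the square leaves the total mass and integrals covered by
      \<open>integral_limit\<close>.\<close>
    define A where "A = (\<integral>x. (1::real) \<partial>\<nu>)"
    have c: "integrable \<nu> (\<lambda>x. x - E)" "integrable \<nu> (\<lambda>x. (x - E)\<^sup>2)"
      by (rule integrable_continuous; intro continuous_intros)+
    have e: "(norm (H (w i) - E *\<^sub>R w i - u))\<^sup>2 =
        (\<integral>x. (poly (p i) x)\<^sup>2 * (x - E)\<^sup>2 \<partial>\<nu>) - 2 * (\<integral>x. poly (p i) x * (x - E) \<partial>\<nu>) + A" for i
    proof -
      have "H (w i) - E *\<^sub>R w i - u = poly_op H (pCons 0 (p i) - smult E (p i) - 1) u"
        by (simp add: poly_op_diff poly_op_smult poly_op_1 poly_op_pCons[OF H_linear] w_def)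
      then have "(norm (H (w i) - E *\<^sub>R w i - u))\<^sup>2 = (\<integral>x. (poly (pCons 0 (p i) - smult E (p i) - 1) x)\<^sup>2 \<partial>\<nu>)"
        by (simp only: norm_poly_op)
      also have "\<dots> = (\<integral>x. ((poly (p i) x)\<^sup>2 * (x - E)\<^sup>2 - 2 * (poly (p i) x * (x - E))) + 1 \<partial>\<nu>)"
        by (rule Bochner_Integration.integral_cong) (simp_all add: power2_eq_square algebra_simps)
      also have "\<dots> = (\<integral>x. (poly (p i) x)\<^sup>2 * (x - E)\<^sup>2 \<partial>\<nu>) - 2 * (\<integral>x. poly (p i) x * (x - E) \<partial>\<nu>) + A"
      proof -
        have i: "integrable \<nu> (\<lambda>x. (poly (p i) x)\<^sup>2 * (x - E)\<^sup>2)" "integrable \<nu> (\<lambda>x. 2 * (poly (p i) x * (x - E)))"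
          by (rule integrable_continuous; intro continuous_intros)+
        show ?thesis
          unfolding A_def
          by (subst Bochner_Integration.integral_add, intro Bochner_Integration.integrable_diff i, simp,
              subst Bochner_Integration.integral_diff[OF i]) simp
      qed
      finally show ?thesis .
    qed
    have "(\<lambda>i. (\<integral>x. (poly (p i) x)\<^sup>2 * (x - E)\<^sup>2 \<partial>\<nu>) - 2 * (\<integral>x. poly (p i) x * (x - E) \<partial>\<nu>) + A) \<longlonglongrightarrow>
        (\<integral>x. (g x)\<^sup>2 * (x - E)\<^sup>2 \<partial>\<nu>) - 2 * (\<integral>x. g x * (x - E) \<partial>\<nu>) + A"
      by (intro tendsto_intros integral_limit[OF g p] c)
    also have "(\<integral>x. (g x)\<^sup>2 * (x - E)\<^sup>2 \<partial>\<nu>) - 2 * (\<integral>x. g x * (x - E) \<partial>\<nu>) + A =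
        (\<integral>x. ((g x)\<^sup>2 * (x - E)\<^sup>2 - 2 * (g x * (x - E))) + 1 \<partial>\<nu>)"
    proof -
      have i: "integrable \<nu> (\<lambda>x. (g x)\<^sup>2 * (x - E)\<^sup>2)" "integrable \<nu> (\<lambda>x. 2 * (g x * (x - E)))"
        by (rule integrable_continuous; intro continuous_intros g)+
      show ?thesis
        unfolding A_def
        by (subst Bochner_Integration.integral_add, intro Bochner_Integration.integrable_diff i, simp,
            subst Bochner_Integration.integral_diff[OF i]) simp
    qed
    also have "\<dots> = (\<integral>x. ((x - E) * g x - 1)\<^sup>2 \<partial>\<nu>)"
      by (rule Bochner_Integration.integral_cong) (simp_all add: power2_eq_square algebra_simps)
    finally show "(\<lambda>i. (norm (H (w i) - E *\<^sub>R w i - u))\<^sup>2) \<longlonglongrightarrow> (\<integral>x. ((x - E) * g x - 1)\<^sup>2 \<partial>\<nu>)"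
      unfolding e .
  qed
  have three: "l (seq_of v n) = (\<integral>x. g x * h x \<partial>\<nu>)"
    if l: "bounded_linear l" and h: "integrable \<nu> h"
      and eq: "\<And>p. l (seq_of (poly_op H p u) n) = (\<integral>x. poly p x * h x \<partial>\<nu>)" for l n h
  proof (rule LIMSEQ_unique)
    show "(\<lambda>i. l (seq_of (w i) n)) \<longlonglongrightarrow> l (seq_of v n)"
      by (intro bounded_linear.tendsto[OF l] tendsto_seq_of v)
    show "(\<lambda>i. l (seq_of (w i) n)) \<longlonglongrightarrow> (\<integral>x. g x * h x \<partial>\<nu>)"
      unfolding w_def eq by (rule integral_limit(1)[OF g p h])
  qed
  show ?thesis
  proof (rule that[of v])
    show "v \<bullet> (H ^^ k) v = (\<integral>x. x ^ k * (g x)\<^sup>2 \<partial>\<nu>)" for k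
      by (rule one)
    show "(norm (H v - E *\<^sub>R v - u))\<^sup>2 = (\<integral>x. ((x - E) * g x - 1)\<^sup>2 \<partial>\<nu>)" for E
      by (rule two)
    show "bounded_linear l \<longrightarrow> integrable \<nu> h \<longrightarrow>
       (\<forall>p. l (seq_of (poly_op H p u) n) = (\<integral>x. poly p x * h x \<partial>\<nu>)) \<longrightarrow>
       l (seq_of v n) = (\<integral>x. g x * h x \<partial>\<nu>)" for l n h
      by (intro impI three) auto
  qed
qed

text \<open>A coordinate of a vector is at most its norm, so that the functional on polynomials has
  bound 1 at every site; hence a bound for \<open>h n\<close> that does not depend on
  \<open>n\<close>. Real and imaginary parts are the intended \<open>l\<close>.\<close>

lemma coordinate_densities:
  assumes l: "bounded_linear l" and le: "\<And>z. \<bar>l z\<bar> \<le> cmod z"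
  obtains h :: "int \<Rightarrow> real \<Rightarrow> real" where "\<And>n. h n \<in> borel_measurable borel" "\<And>n. integrable \<nu> (h n)"
    "\<And>n. (\<integral>\<^sup>+x. ennreal ((h n x)\<^sup>2) \<partial>\<nu>) \<le> 9"
    "\<And>n p. l (seq_of (poly_op H p u) n) = (\<integral>x. poly p x * h n x \<partial>\<nu>)"
proof -
  define P where "P = (\<lambda>n h. h \<in> borel_measurable borel \<and> integrable \<nu> h \<and> (\<integral>\<^sup>+x. ennreal ((h x)\<^sup>2) \<partial>\<nu>) \<le> 9 \<and>
    (\<forall>p. l (seq_of (poly_op H p u) n) = (\<integral>x. poly p x * h x \<partial>\<nu>)))"
  have "\<forall>n. \<exists>h. P n h"
  proof
    fix n
    obtain h where h: "h \<in> borel_measurable borel" "integrable \<nu> (\<lambda>x. (h x)\<^sup>2)"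
      "(\<integral>\<^sup>+x. ennreal ((h x)\<^sup>2) \<partial>\<nu>) \<le> 9" "\<And>p. l (seq_of (poly_op H p u) n) = (\<integral>x. poly p x * h x \<partial>\<nu>)"
    proof (rule riesz_poly[of "\<lambda>p. l (seq_of (poly_op H p u) n)"])
      fix p q :: "real poly" and c :: real
      show "l (seq_of (poly_op H (p + q) u) n) = l (seq_of (poly_op H p u) n) + l (seq_of (poly_op H q u) n)"
        unfolding poly_op_add seq_of_add by (rule linear_add[OF bounded_linear.linear[OF l]])
      show "l (seq_of (poly_op H (smult c p) u) n) = c * l (seq_of (poly_op H p u) n)"
        unfolding poly_op_smult seq_of_scaleR using linear_scale[OF bounded_linear.linear[OF l]] by simp
      have "\<bar>l (seq_of (poly_op H p u) n)\<bar> \<le> norm (poly_op H p u)"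
        using le[of "seq_of (poly_op H p u) n"] norm_seq_of_le[of "poly_op H p u" n] by linarith
      then show "(l (seq_of (poly_op H p u) n))\<^sup>2 \<le> (\<integral>x. (poly p x)\<^sup>2 \<partial>\<nu>)"
        unfolding norm_poly_op[symmetric] by (simp add: power2_le_iff_abs_le)
    qed (rule that)
    have [measurable]: "h \<in> borel_measurable \<nu>"
      using h(1) by (simp add: borel_measurable_nu)
    have "integrable \<nu> h"
    proof (rule Bochner_Integration.integrable_bound)
      show "integrable \<nu> (\<lambda>x. 1 + (h x)\<^sup>2)"
        using h(2) by simp
      show "AE x in \<nu>. norm (h x) \<le> norm (1 + (h x)\<^sup>2)"
      proof (rule AE_I2)
        fix x
        have "0 \<le> (\<bar>h x\<bar> - 1)\<^sup>2" by simp
        then have "2 * \<bar>h x\<bar> \<le> 1 + (h x)\<^sup>2"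
          by (simp add: power2_diff)
        then show "norm (h x) \<le> norm (1 + (h x)\<^sup>2)" by simp
      qed
    qed measurable
    with h(1,3,4) have "P n h"
      unfolding P_def by simp
    then show "\<exists>h. P n h"
      by (rule exI[of "P n"])
  qed
  from choice[OF this] obtain h where h: "\<forall>n. P n (h n)"
    by (rule exE)
  show ?thesis
    by (rule that[of h]) (use h in \<open>simp_all add: P_def\<close>)
qed

text \<open>Multiplying \<open>p\<close> by the variable amounts to applying \<open>H\<close>, so
  both sides of the recurrence have equal integrals against every polynomial; the moments then
  identify them almost everywhere.\<close>

lemma densities_eigen:
  assumes l: "bounded_linear l" and h: "\<And>n. integrable \<nu> (h n)"
    and eq: "\<And>n p. l (seq_of (poly_op H p u) n) = (\<integral>x. poly p x * h n x \<partial>\<nu>)"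
  shows "AE x in \<nu>. \<forall>n. h (n - 1) x + h (n + 1) x + V n * h n x = x * h n x"
proof -
  have "AE x in \<nu>. (h (n - 1) x + h (n + 1) x + V n * h n x) - x * h n x = 0" for n
  proof (rule moments_determine)
    have ix: "integrable \<nu> (\<lambda>x. x * h n x)"
      by (rule integrable_mult_continuous[OF continuous_on_id h])
    show i: "integrable \<nu> (\<lambda>x. (h (n - 1) x + h (n + 1) x + V n * h n x) - x * h n x)"
      by (intro Bochner_Integration.integrable_diff Bochner_Integration.integrable_add integrable_mult_right h ix)
    fix p :: "real poly"
    have ip: "integrable \<nu> (\<lambda>x. poly p x * h m x)" for m
      by (rule integrable_mult_continuous[OF continuous_poly h])
    have ipx: "integrable \<nu> (\<lambda>x. poly p x * (x * h n x))"
      by (rule integrable_mult_continuous[OF continuous_poly ix])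
    have "(\<integral>x. poly p x * (x * h n x) \<partial>\<nu>) = (\<integral>x. poly (pCons 0 p) x * h n x \<partial>\<nu>)"
      by (rule Bochner_Integration.integral_cong) (simp_all add: mult.assoc mult.left_commute)
    also have "\<dots> = l (seq_of (H (poly_op H p u)) n)"
      unfolding eq[symmetric] poly_op_pCons[OF H_linear] ..
    also have "\<dots> = l (seq_of (poly_op H p u) (n - 1)) + l (seq_of (poly_op H p u) (n + 1)) + V n * l (seq_of (poly_op H p u) n)"
      unfolding seq_of_jacobi_l2[OF V] jacobi_def scaleR_conv_of_real[symmetric]
      by (simp add: linear_add[OF bounded_linear.linear[OF l]] linear_scale[OF bounded_linear.linear[OF l]])
    also have "\<dots> = (\<integral>x. poly p x * h (n - 1) x \<partial>\<nu>) + (\<integral>x. poly p x * h (n + 1) x \<partial>\<nu>) + V n * (\<integral>x. poly p x * h n x \<partial>\<nu>)"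
      unfolding eq ..
    finally have *: "(\<integral>x. poly p x * (x * h n x) \<partial>\<nu>) = \<dots>" .
    have "(\<integral>x. poly p x * ((h (n - 1) x + h (n + 1) x + V n * h n x) - x * h n x) \<partial>\<nu>) =
        (\<integral>x. ((poly p x * h (n - 1) x + poly p x * h (n + 1) x) + V n * (poly p x * h n x)) - poly p x * (x * h n x) \<partial>\<nu>)"
      by (rule Bochner_Integration.integral_cong) (simp_all add: algebra_simps)
    also have "\<dots> = 0"
      using * ip[of "n - 1"] ip[of "n + 1"] ip[of n] ipx by simp
    finally show "(\<integral>x. poly p x * ((h (n - 1) x + h (n + 1) x + V n * h n x) - x * h n x) \<partial>\<nu>) = 0" .
  qed
  then have "AE x in \<nu>. \<forall>n. (h (n - 1) x + h (n + 1) x + V n * h n x) - x * h n x = 0"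
    by (simp add: AE_all_countable)
  then show ?thesis
    by eventually_elim simp
qed

text \<open>The weighted sums have integrals at most \<open>5 * 9\<close>, and Fatou works as it did
  for the Green's functions.\<close>

lemma densities_poly_bounded:
  assumes hm: "\<And>n. h n \<in> borel_measurable borel" and h9: "\<And>n. (\<integral>\<^sup>+x. ennreal ((h n x)\<^sup>2) \<partial>\<nu>) \<le> 9"
  shows "AE x in \<nu>. poly_bounded (\<lambda>n. complex_of_real (h n x))"
proof -
  note hm[measurable]
  define \<Phi> where "\<Phi> = (\<lambda>k::nat. \<lambda>x. \<Sum>n\<in>{-int k..int k}. (1 / (1 + (real_of_int n)\<^sup>2)) * (h n x)\<^sup>2)"
  have [measurable]: "\<Phi> k \<in> borel_measurable \<nu>" for k
    unfolding \<Phi>_def borel_measurable_nu by measurable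
  have int: "(\<integral>\<^sup>+x. ennreal (\<Phi> k x) \<partial>\<nu>) \<le> 45" for k
  proof -
    have ueq: "ennreal (\<Phi> k x) = (\<Sum>n\<in>{-int k..int k}. ennreal (1 / (1 + (real_of_int n)\<^sup>2)) * ennreal ((h n x)\<^sup>2))" for x
    proof -
      have "ennreal (\<Phi> k x) = (\<Sum>n\<in>{-int k..int k}. ennreal ((1 / (1 + (real_of_int n)\<^sup>2)) * (h n x)\<^sup>2))"
        unfolding \<Phi>_def by (rule sum_ennreal[symmetric]) simp
      also have "\<dots> = (\<Sum>n\<in>{-int k..int k}. ennreal (1 / (1 + (real_of_int n)\<^sup>2)) * ennreal ((h n x)\<^sup>2))"
        by (intro sum.cong refl ennreal_mult) auto
      finally show ?thesis .
    qed
    have "(\<integral>\<^sup>+x. ennreal (\<Phi> k x) \<partial>\<nu>) = (\<Sum>n\<in>{-int k..int k}. \<integral>\<^sup>+x. ennreal (1 / (1 + (real_of_int n)\<^sup>2)) * ennreal ((h n x)\<^sup>2) \<partial>\<nu>)"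
      unfolding ueq by (rule nn_integral_sum) measurable
    also have "\<dots> = (\<Sum>n\<in>{-int k..int k}. ennreal (1 / (1 + (real_of_int n)\<^sup>2)) * (\<integral>\<^sup>+x. ennreal ((h n x)\<^sup>2) \<partial>\<nu>))"
      by (intro sum.cong refl nn_integral_cmult) measurable
    also have "\<dots> \<le> (\<Sum>n\<in>{-int k..int k}. ennreal (1 / (1 + (real_of_int n)\<^sup>2)) * 9)"
      by (intro sum_mono mult_left_mono h9) auto
    also have "\<dots> = ennreal (\<Sum>n\<in>{-int k..int k}. 1 / (1 + (real_of_int n)\<^sup>2)) * 9"
    proof -
      have "(\<Sum>n\<in>{-int k..int k}. ennreal (1 / (1 + (real_of_int n)\<^sup>2))) = ennreal (\<Sum>n\<in>{-int k..int k}. 1 / (1 + (real_of_int n)\<^sup>2))"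
        by (rule sum_ennreal) simp
      then show ?thesis
        by (simp only: sum_distrib_right[symmetric])
    qed
    also have "\<dots> \<le> ennreal 5 * 9"
    proof (intro mult_right_mono ennreal_leI)
      have "0 \<le> 4 / (real k + 1)" by simp
      then show "(\<Sum>n\<in>{-int k..int k}. 1 / (1 + (real_of_int n)\<^sup>2)) \<le> 5"
        using sum_inverse_squares_le[of k] by linarith
    qed auto
    also have "\<dots> = 45" by simp
    finally show ?thesis .
  qed
  have "(\<integral>\<^sup>+x. liminf (\<lambda>k. ennreal (\<Phi> k x)) \<partial>\<nu>) \<le> liminf (\<lambda>k. \<integral>\<^sup>+x. ennreal (\<Phi> k x) \<partial>\<nu>)"
    by (rule nn_integral_liminf) measurable
  also have "\<dots> \<le> limsup (\<lambda>k. \<integral>\<^sup>+x. ennreal (\<Phi> k x) \<partial>\<nu>)"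
    by (rule Liminf_le_Limsup) simp
  also have "\<dots> \<le> 45"
    by (rule Limsup_bounded) (simp add: int)
  finally have "(\<integral>\<^sup>+x. liminf (\<lambda>k. ennreal (\<Phi> k x)) \<partial>\<nu>) \<noteq> \<infinity>"
    by (auto simp: top_unique)
  then have "AE x in \<nu>. liminf (\<lambda>k. ennreal (\<Phi> k x)) \<noteq> \<infinity>"
    by (rule nn_integral_PInf_AE[rotated]) measurable
  then show ?thesis
  proof eventually_elim
    case (elim x)
    then obtain c where c: "0 \<le> c" "liminf (\<lambda>k. ennreal (\<Phi> k x)) = ennreal c"
      by (cases "liminf (\<lambda>k. ennreal (\<Phi> k x))") auto
    have "\<not> (\<forall>\<^sub>F k in sequentially. ennreal (c + 1) \<le> ennreal (\<Phi> k x))"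
    proof
      assume "\<forall>\<^sub>F k in sequentially. ennreal (c + 1) \<le> ennreal (\<Phi> k x)"
      then have "ennreal (c + 1) \<le> liminf (\<lambda>k. ennreal (\<Phi> k x))"
        by (rule Liminf_bounded)
      then show False
        using c by (simp add: ennreal_le_iff)
    qed
    have freq: "\<exists>k\<ge>N. \<Phi> k x < c + 1" for N
    proof (rule ccontr)
      assume "\<not> (\<exists>k\<ge>N. \<Phi> k x < c + 1)"
      then have "\<forall>k\<ge>N. ennreal (c + 1) \<le> ennreal (\<Phi> k x)"
        by (auto simp: not_less intro!: ennreal_leI)
      with \<open>\<not> (\<forall>\<^sub>F k in sequentially. ennreal (c + 1) \<le> ennreal (\<Phi> k x))\<close> show False
        unfolding eventually_sequentially by blast
    qed
    \<comment> \<open>Here the square of \<open>h\<close> is controlled;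
      \<open>2 * \<bar>h\<bar> \<le> h\<^sup>2 + 1\<close> brings it down to \<open>h\<close>, and
      the extra 1 raises \<open>c + 1\<close> to \<open>c + 2\<close>.\<close>
    have "cmod (complex_of_real (h n x)) \<le> (c + 2) * (1 + (real_of_int n)\<^sup>2)\<^sup>2" for n
    proof -
      obtain k where k: "k \<ge> nat \<bar>n\<bar>" "\<Phi> k x < c + 1"
        using freq by blast
      have "n \<in> {-int k..int k}"
        using k(1) by auto
      then have "(1 / (1 + (real_of_int n)\<^sup>2)) * (h n x)\<^sup>2 \<le> \<Phi> k x"
        unfolding \<Phi>_def by (intro member_le_sum) auto
      moreover have pos: "0 < 1 + (real_of_int n)\<^sup>2"
        by (simp add: add_pos_nonneg)
      ultimately have "(h n x)\<^sup>2 \<le> \<Phi> k x * (1 + (real_of_int n)\<^sup>2)"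
        by (simp add: field_simps)
      also have "\<dots> \<le> (c + 1) * (1 + (real_of_int n)\<^sup>2)"
        using k(2) pos by (intro mult_right_mono) auto
      finally have hh: "(h n x)\<^sup>2 \<le> (c + 1) * (1 + (real_of_int n)\<^sup>2)" .
      have "2 * \<bar>h n x\<bar> \<le> (h n x)\<^sup>2 + 1"
        using sum_squares_bound[of "\<bar>h n x\<bar>" 1] by simp
      also have "\<dots> \<le> (c + 2) * (1 + (real_of_int n)\<^sup>2)"
      proof -
        have "(c + 2) * (1 + (real_of_int n)\<^sup>2) = (c + 1) * (1 + (real_of_int n)\<^sup>2) + (1 + (real_of_int n)\<^sup>2)"
          by (simp add: algebra_simps)
        then show ?thesis using hh zero_le_power2[of "real_of_int n"] by linarith
      qed
      also have "\<dots> \<le> (c + 2) * (1 + (real_of_int n)\<^sup>2)\<^sup>2"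
        using c(1) self_le_power[of "1 + (real_of_int n)\<^sup>2" 2] by (intro mult_left_mono) auto
      finally show ?thesis by simp
    qed
    then show ?case
      unfolding poly_bounded_def by blast
  qed
qed

text \<open>Let \<open>g\<close> be a tent that is positive exactly on the interval. The densities
  vanish where \<open>g\<close> does not, so every coordinate of \<open>g(H) u\<close> is zero; its
  squared norm, the integral of \<open>g\<^sup>2\<close>, is then zero as well.\<close>

lemma null_interval:
  assumes noeig: "AE x in \<nu>. \<bar>x - E0\<bar> < \<epsilon> \<longrightarrow>
    (\<forall>\<phi>. poly_bounded \<phi> \<longrightarrow> (\<forall>n. jacobi V \<phi> n = complex_of_real x * \<phi> n) \<longrightarrow> (\<forall>n. \<phi> n = 0))"
  shows "AE x in \<nu>. \<not> \<bar>x - E0\<bar> < \<epsilon>"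
proof -
  define g where "g = (\<lambda>x. max 0 (\<epsilon> - \<bar>x - E0\<bar>))"
  have g: "continuous_on UNIV g"
    unfolding g_def by (intro continuous_intros)
  obtain v where v: "\<And>k. v \<bullet> (H ^^ k) v = (\<integral>x. x ^ k * (g x)\<^sup>2 \<partial>\<nu>)"
    "\<And>E. (norm (H v - E *\<^sub>R v - u))\<^sup>2 = (\<integral>x. ((x - E) * g x - 1)\<^sup>2 \<partial>\<nu>)"
    "\<And>l n h. bounded_linear l \<longrightarrow> integrable \<nu> h \<longrightarrow>
       (\<forall>p. l (seq_of (poly_op H p u) n) = (\<integral>x. poly p x * h x \<partial>\<nu>)) \<longrightarrow>
       l (seq_of v n) = (\<integral>x. g x * h x \<partial>\<nu>)"
    by (rule functional_calculus[OF g]) (rule that; assumption)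
  have zero: "l (seq_of v n) = 0" if l: "bounded_linear l" "\<And>z. \<bar>l z\<bar> \<le> cmod z" for l n
  proof -
    obtain h where h: "\<And>n. h n \<in> borel_measurable borel" "\<And>n. integrable \<nu> (h n)"
      "\<And>n. (\<integral>\<^sup>+x. ennreal ((h n x)\<^sup>2) \<partial>\<nu>) \<le> 9"
      "\<And>n p. l (seq_of (poly_op H p u) n) = (\<integral>x. poly p x * h n x \<partial>\<nu>)"
      by (rule coordinate_densities[OF l]) (rule that; assumption)
    have "AE x in \<nu>. g x * h n x = 0"
      using noeig densities_eigen[of l h, OF l(1) h(2) h(4)] densities_poly_bounded[of h, OF h(1) h(3)]
    proof eventually_elim
      case (elim x)
      show ?case
      proof (cases "\<bar>x - E0\<bar> < \<epsilon>")
        case True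
        have "jacobi V (\<lambda>n. complex_of_real (h n x)) n = complex_of_real x * complex_of_real (h n x)" for n
        proof -
          have "complex_of_real (h (n - 1) x + h (n + 1) x + V n * h n x) = complex_of_real (x * h n x)"
            using elim(2) by simp
          then show ?thesis by (simp add: jacobi_def)
        qed
        with elim(1,3) True have "complex_of_real (h n x) = 0" by blast
        then show ?thesis by simp
      next
        case False
        then show ?thesis by (simp add: g_def)
      qed
    qed
    then have "(\<integral>x. g x * h n x \<partial>\<nu>) = 0"
      by (rule integral_eq_zero_AE)
    then show ?thesis
      using v(3)[of l "h n" n] l(1) h(2) h(4) by simp
  qed
  \<comment> \<open>The densities are real, so real and imaginary parts of the coordinates are
    represented separately.\<close>
  have "seq_of v n = 0" for n
    using zero[OF bounded_linear_Re abs_Re_le_cmod] zero[OF bounded_linear_Im abs_Im_le_cmod]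
    by (simp add: complex_eq_iff)
  then have "v = 0"
    unfolding seq_of_inject[symmetric] seq_of_zero by (simp add: fun_eq_iff)
  then have "(\<integral>x. (g x)\<^sup>2 \<partial>\<nu>) = 0"
    using v(1)[of 0] by simp
  moreover have "integrable \<nu> (\<lambda>x. (g x)\<^sup>2)"
    by (rule integrable_continuous) (intro continuous_intros g)
  ultimately have "AE x in \<nu>. (g x)\<^sup>2 = 0"
    using integral_nonneg_eq_0_iff_AE[of \<nu> "\<lambda>x. (g x)\<^sup>2"] by simp
  then show ?thesis
    by eventually_elim (auto simp: g_def max_def split: if_splits)
qed

end

section \<open>The absolutely continuous subspace\<close>

lemma seq_of_jacobi_minus:
  assumes "\<forall>n. \<bar>V n\<bar> \<le> K"
  shows "seq_of (jacobi_l2 V w - x *\<^sub>R w) = (\<lambda>n. jacobi V (seq_of w) n - complex_of_real x * seq_of w n)"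
  by (simp add: seq_of_diff seq_of_scaleR seq_of_jacobi_l2[OF assms] scaleR_conv_of_real)

lemma ell2_eq_range: "ell2 = range seq_of"
  by (rule type_definition.Rep_range[OF type_definition_l2, symmetric])

lemma not_in_spectrum_onI:
  assumes V: "\<forall>n. \<bar>V n\<bar> \<le> K"
    and bij: "bij_betw (\<lambda>w. jacobi_l2 V w - x *\<^sub>R w) S S"
    and bound: "\<And>w. w \<in> S \<Longrightarrow> norm w \<le> C * norm (jacobi_l2 V w - x *\<^sub>R w)"
  shows "complex_of_real x \<notin> spectrum_on (jacobi V) (seq_of ` S)"
proof -
  let ?B = "\<lambda>u n. jacobi V u n - complex_of_real x * u n"
  have eq: "?B (seq_of w) = seq_of (jacobi_l2 V w - x *\<^sub>R w)" for w
    by (rule seq_of_jacobi_minus[OF V, symmetric])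
  have "bij_betw ?B (seq_of ` S) (seq_of ` S)"
    unfolding bij_betw_def
  proof
    show "inj_on ?B (seq_of ` S)"
    proof (rule inj_onI)
      fix a b assume "a \<in> seq_of ` S" "b \<in> seq_of ` S" and ab: "?B a = ?B b"
      then obtain w z where wz: "w \<in> S" "z \<in> S" "a = seq_of w" "b = seq_of z" by blast
      then have "jacobi_l2 V w - x *\<^sub>R w = jacobi_l2 V z - x *\<^sub>R z"
        using ab by (simp only: eq seq_of_inject)
      then have "w = z"
        using bij wz(1,2) unfolding bij_betw_def inj_on_def by blast
      then show "a = b" using wz by simp
    qed
    have "?B ` seq_of ` S = seq_of ` (\<lambda>w. jacobi_l2 V w - x *\<^sub>R w) ` S"
      by (simp only: image_image eq)
    then show "?B ` seq_of ` S = seq_of ` S"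
      using bij by (simp only: bij_betw_def)
  qed
  moreover have "\<forall>u\<in>seq_of ` S. ell2_norm u \<le> C * ell2_norm (?B u)"
    using bound by (auto simp: eq norm_eq_ell2_norm)
  ultimately show ?thesis
    unfolding spectrum_on_def by blast
qed

text \<open>For such \<open>x\<close> the map \<open>w \<mapsto> (H w - v) / x\<close> is a
  contraction, and its fixed point solves \<open>H w - x w = v\<close>. Spectral measures, being
  carried by the spectrum, thereby get bounded support.\<close>

lemma jacobi_spectrum_bounded:
  assumes V: "\<forall>n. \<bar>V n\<bar> \<le> K" and x: "K + 2 < \<bar>x\<bar>"
  shows "complex_of_real x \<notin> spectrum_on (jacobi V) ell2"
  unfolding ell2_eq_range
proof (rule not_in_spectrum_onI[OF V])
  let ?H = "jacobi_l2 V"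
  have lin: "linear ?H"
    by (rule bounded_linear.linear[OF bounded_linear_jacobi_l2[OF V]])
  have K: "0 \<le> K" using V abs_ge_zero order_trans by blast
  then have x0: "0 < \<bar>x\<bar>" using x by linarith
  have ex: "\<exists>!w. ?H w - x *\<^sub>R w = v" for v
  proof -
    have "\<exists>!w. inverse x *\<^sub>R (?H w - v) = w"
    proof (rule banach_fix_type[of "(K + 2) / \<bar>x\<bar>"])
      show "0 \<le> (K + 2) / \<bar>x\<bar>" "(K + 2) / \<bar>x\<bar> < 1"
        using K x x0 by auto
      have "dist (inverse x *\<^sub>R (?H a - v)) (inverse x *\<^sub>R (?H b - v)) \<le> (K + 2) / \<bar>x\<bar> * dist a b" for a b
      proof -
        have "inverse x *\<^sub>R (?H a - v) - inverse x *\<^sub>R (?H b - v) = inverse x *\<^sub>R ?H (a - b)"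
          by (simp add: linear_diff[OF lin] scaleR_diff_right)
        then have "dist (inverse x *\<^sub>R (?H a - v)) (inverse x *\<^sub>R (?H b - v)) = norm (?H (a - b)) / \<bar>x\<bar>"
          by (simp add: dist_norm divide_inverse mult.commute)
        also have "\<dots> \<le> (K + 2) * norm (a - b) / \<bar>x\<bar>"
          using norm_jacobi_l2_le[OF V] x0 by (intro divide_right_mono) auto
        finally show ?thesis by (simp add: dist_norm)
      qed
      then show "\<forall>a b. dist (inverse x *\<^sub>R (?H a - v)) (inverse x *\<^sub>R (?H b - v)) \<le> (K + 2) / \<bar>x\<bar> * dist a b"
        by blast
    qed
    moreover have "inverse x *\<^sub>R (?H w - v) = w \<longleftrightarrow> ?H w - x *\<^sub>R w = v" for w
    proof -
      have "inverse x *\<^sub>R (?H w - v) = w \<longleftrightarrow> ?H w - v = x *\<^sub>R w"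
      proof
        assume "inverse x *\<^sub>R (?H w - v) = w"
        then have "x *\<^sub>R inverse x *\<^sub>R (?H w - v) = x *\<^sub>R w" by (rule arg_cong)
        then show "?H w - v = x *\<^sub>R w" using x0 by simp
      next
        assume "?H w - v = x *\<^sub>R w"
        then show "inverse x *\<^sub>R (?H w - v) = w" using x0 by simp
      qed
      also have "\<dots> \<longleftrightarrow> ?H w - x *\<^sub>R w = v"
        by (auto simp: algebra_simps)
      finally show ?thesis .
    qed
    ultimately show ?thesis by simp
  qed
  then show "bij_betw (\<lambda>w. ?H w - x *\<^sub>R w) UNIV UNIV"
    unfolding bij_iff by blast
  fix w
  have "\<bar>x\<bar> * norm w - (K + 2) * norm w \<le> norm (?H w - x *\<^sub>R w)"
    using norm_triangle_ineq2[of "x *\<^sub>R w" "?H w"] norm_jacobi_l2_le[OF V, of w]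
    by (simp add: norm_minus_commute)
  then have "norm w * (\<bar>x\<bar> - (K + 2)) \<le> norm (?H w - x *\<^sub>R w)"
    by (simp add: algebra_simps)
  then show "norm w \<le> 1 / (\<bar>x\<bar> - (K + 2)) * norm (?H w - x *\<^sub>R w)"
    using x by (simp add: pos_le_divide_eq)
qed

lemma seq_of_funpow_jacobi:
  assumes "\<forall>n. \<bar>V n\<bar> \<le> K"
  shows "seq_of ((jacobi_l2 V ^^ k) u) = (jacobi V ^^ k) (seq_of u)"
  by (induction k) (simp_all add: seq_of_jacobi_l2[OF assms])

lemma cyclic_vectorI:
  assumes V: "\<forall>n. \<bar>V n\<bar> \<le> K" and \<nu>: "spectral_measure (jacobi V) (seq_of u) \<nu>"
  shows "cyclic_vector \<nu> (K + 2) V K u"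
proof -
  have s: "sets \<nu> = sets borel" "finite_measure \<nu>"
    "AE x in \<nu>. complex_of_real x \<in> spectrum_on (jacobi V) ell2"
    "\<And>k. ell2_inner (seq_of u) ((jacobi V ^^ k) (seq_of u)) = complex_of_real (\<integral>x. x ^ k \<partial>\<nu>)"
    using \<nu> unfolding spectral_measure_def by auto
  interpret finite_measure \<nu> by (rule s(2))
  show ?thesis
  proof (unfold_locales)
    show "AE x in \<nu>. \<bar>x\<bar> \<le> K + 2"
      using s(3)
    proof eventually_elim
      case (elim x)
      then show ?case
        using jacobi_spectrum_bounded[OF V, of x] by (cases "\<bar>x\<bar> \<le> K + 2") auto
    qed
    show "u \<bullet> (jacobi_l2 V ^^ k) u = (\<integral>x. x ^ k \<partial>\<nu>)" for k
      unfolding inner_l2_eq seq_of_funpow_jacobi[OF V] s(4) by simp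
  qed (use V s(1) in auto)
qed

lemma ell2_inner_cnj: "cnj (ell2_inner u v) = ell2_inner v u"
  unfolding ell2_inner_def infsum_cnj[symmetric] by (simp add: mult.commute)

lemma ell2_inner_jacobi_pow:
  assumes V: "\<forall>n. \<bar>V n\<bar> \<le> K" and "u \<in> ell2" "v \<in> ell2"
  shows "ell2_inner ((jacobi V ^^ k) u) v = ell2_inner u ((jacobi V ^^ k) v)"
  using assms(2,3)
proof (induction k arbitrary: u v)
  case (Suc k)
  have "(jacobi V ^^ k) u \<in> ell2"
    using Suc.prems(1) by (induction k) (auto intro: jacobi_ell2[OF V])
  then have "ell2_inner ((jacobi V ^^ Suc k) u) v = ell2_inner ((jacobi V ^^ k) u) (jacobi V v)"
    using Suc.prems by (simp add: ell2_inner_jacobi[OF V])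
  also have "\<dots> = ell2_inner u ((jacobi V ^^ k) (jacobi V v))"
    by (rule Suc.IH[OF Suc.prems(1) jacobi_ell2[OF V Suc.prems(2)]])
  finally show ?case
    by (simp add: funpow_swap1)
qed simp

context cyclic_vector
begin

lemma spectral_measure_density:
  assumes g: "continuous_on UNIV g"
    and v: "\<And>k. v \<bullet> (H ^^ k) v = (\<integral>x. x ^ k * (g x)\<^sup>2 \<partial>\<nu>)"
    and supp': "AE x in \<nu>. complex_of_real x \<in> spectrum_on (jacobi V) ell2"
  shows "spectral_measure (jacobi V) (seq_of v) (density \<nu> (\<lambda>x. ennreal ((g x)\<^sup>2)))"
proof -
  have gm [measurable]: "g \<in> borel_measurable \<nu>"
    by (rule continuous_measurable[OF g])
  have ig: "integrable \<nu> (\<lambda>x. (g x)\<^sup>2)"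
    by (rule integrable_continuous) (intro continuous_intros g)
  have "finite_measure (density \<nu> (\<lambda>x. ennreal ((g x)\<^sup>2)))"
  proof
    show "emeasure (density \<nu> (\<lambda>x. ennreal ((g x)\<^sup>2))) (space (density \<nu> (\<lambda>x. ennreal ((g x)\<^sup>2)))) \<noteq> \<infinity>"
    proof -
      have "emeasure (density \<nu> (\<lambda>x. ennreal ((g x)\<^sup>2))) (space \<nu>) = (\<integral>\<^sup>+x. ennreal ((g x)\<^sup>2) * indicator (space \<nu>) x \<partial>\<nu>)"
        by (rule emeasure_density) measurable
      also have "\<dots> = (\<integral>\<^sup>+x. ennreal ((g x)\<^sup>2) \<partial>\<nu>)"
        by (rule nn_integral_cong) simp
      also have "\<dots> = ennreal (\<integral>x. (g x)\<^sup>2 \<partial>\<nu>)"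
        by (rule nn_integral_eq_integral[OF ig]) simp
      finally show ?thesis by simp
    qed
  qed
  moreover have "AE x in density \<nu> (\<lambda>x. ennreal ((g x)\<^sup>2)). complex_of_real x \<in> spectrum_on (jacobi V) ell2"
    using supp' by (subst AE_density) auto
  moreover have "ell2_inner (seq_of v) ((jacobi V ^^ k) (seq_of v)) =
      complex_of_real (\<integral>x. x ^ k \<partial>density \<nu> (\<lambda>x. ennreal ((g x)\<^sup>2)))" for k
  proof -
    let ?z = "ell2_inner (seq_of v) ((jacobi V ^^ k) (seq_of v))"
    \<comment> \<open>Symmetry makes the moments real, so the real inner product determines
      them.\<close>
    have "cnj ?z = ?z"
      unfolding ell2_inner_cnj by (rule ell2_inner_jacobi_pow[OF V]) auto
    then have "Im ?z = 0"
      by (simp add: complex_eq_iff)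
    moreover have "Re ?z = (\<integral>x. x ^ k * (g x)\<^sup>2 \<partial>\<nu>)"
      using v[of k] unfolding inner_l2_eq seq_of_funpow_jacobi[OF V] .
    moreover have "(\<integral>x. x ^ k \<partial>density \<nu> (\<lambda>x. ennreal ((g x)\<^sup>2))) = (\<integral>x. (g x)\<^sup>2 *\<^sub>R x ^ k \<partial>\<nu>)"
      by (rule integral_density) (auto intro!: continuous_measurable continuous_intros)
    ultimately show ?thesis
      by (simp add: complex_eq_iff mult.commute)
  qed
  ultimately show ?thesis
    unfolding spectral_measure_def by simp
qed

lemma poly_op_moments: "poly_op H p u \<bullet> (H ^^ k) (poly_op H p u) = (\<integral>x. x ^ k * (poly p x)\<^sup>2 \<partial>\<nu>)"
  unfolding poly_op_monom_mult[OF H_linear, symmetric] poly_op_inner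
  by (rule Bochner_Integration.integral_cong) (simp_all add: poly_monom power2_eq_square)

end

text \<open>The vector has spectral measure \<open>g\<^sup>2 d\<nu>\<close>, which is absolutely
  continuous with respect to \<open>\<nu>\<close>. Both \<open>H - E0\<close> and its inverse will
  be shown in this way to preserve the subspace.\<close>

lemma ac_subspace_density:
  assumes V: "\<forall>n. \<bar>V n\<bar> \<le> K" and \<nu>: "spectral_measure (jacobi V) (seq_of u) \<nu>" "absolutely_continuous lborel \<nu>"
    and g: "continuous_on UNIV g" and v: "\<And>k. v \<bullet> (jacobi_l2 V ^^ k) v = (\<integral>x. x ^ k * (g x)\<^sup>2 \<partial>\<nu>)"
  shows "seq_of v \<in> ac_subspace (jacobi V)"
proof -
  interpret cyclic_vector \<nu> "K + 2" V K u
    by (rule cyclic_vectorI[OF V \<nu>(1)])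
  have "spectral_measure (jacobi V) (seq_of v) (density \<nu> (\<lambda>x. ennreal ((g x)\<^sup>2)))"
    by (rule spectral_measure_density[OF g v]) (use \<nu>(1) in \<open>simp add: spectral_measure_def\<close>)
  moreover have "absolutely_continuous lborel (density \<nu> (\<lambda>x. ennreal ((g x)\<^sup>2)))"
  proof -
    have [measurable]: "g \<in> borel_measurable \<nu>"
      by (rule continuous_measurable[OF g])
    have "absolutely_continuous \<nu> (density \<nu> (\<lambda>x. ennreal ((g x)\<^sup>2)))"
      by (rule absolutely_continuousI_density) measurable
    then show ?thesis
      using \<nu>(2) unfolding absolutely_continuous_def by (rule subset_trans[rotated])
  qed
  ultimately show ?thesis
    unfolding ac_subspace_def by auto
qed

text \<open>If the absolutely continuous spectral measures do not charge a neighbourhood of \<open>E0\<close>, then the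
  functional calculus inverts \<open>H - E0\<close> on the absolutely continuous subspace.\<close>

lemma not_in_ac_spectrum:
  assumes V: "\<forall>n. \<bar>V n\<bar> \<le> K" and \<epsilon>: "0 < \<epsilon>"
    and null: "\<And>u \<nu>. spectral_measure (jacobi V) (seq_of u) \<nu> \<Longrightarrow> absolutely_continuous lborel \<nu> \<Longrightarrow>
      AE x in \<nu>. \<not> \<bar>x - E0\<bar> < \<epsilon>"
  shows "complex_of_real E0 \<notin> ac_spectrum (jacobi V)"
proof -
  let ?H = "jacobi_l2 V"
  define S where "S = {w. seq_of w \<in> ac_subspace (jacobi V)}"
  have S: "seq_of ` S = ac_subspace (jacobi V)"
  proof
    show "ac_subspace (jacobi V) \<subseteq> seq_of ` S"
    proof
      fix a assume a: "a \<in> ac_subspace (jacobi V)"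
      then have "a \<in> range seq_of"
        unfolding ell2_eq_range[symmetric] ac_subspace_def by simp
      then obtain w where "a = seq_of w" by blast
      with a show "a \<in> seq_of ` S" by (simp add: S_def)
    qed
  qed (auto simp: S_def)
  have measure: "\<exists>\<nu>. spectral_measure (jacobi V) (seq_of u) \<nu> \<and> absolutely_continuous lborel \<nu>" if "u \<in> S" for u
    using that by (simp add: S_def ac_subspace_def)
  have maps: "?H u - E0 *\<^sub>R u \<in> S" and bound: "norm u \<le> 1 / \<epsilon> * norm (?H u - E0 *\<^sub>R u)"
    and surj: "\<exists>v\<in>S. ?H v - E0 *\<^sub>R v = u" if u: "u \<in> S" for u
  proof -
    obtain \<nu> where \<nu>: "spectral_measure (jacobi V) (seq_of u) \<nu>" "absolutely_continuous lborel \<nu>"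
      using measure[OF u] by blast
    interpret cyclic_vector \<nu> "K + 2" V K u
      by (rule cyclic_vectorI[OF V \<nu>(1)])
    note AE = null[OF \<nu>]
    have p: "poly_op ?H [:- E0, 1:] u = ?H u - E0 *\<^sub>R u"
    proof -
      have "[:- E0, 1:] = pCons 0 1 - smult E0 (1 :: real poly)" by simp
      then show ?thesis
        by (simp only: poly_op_diff poly_op_smult poly_op_pCons[OF H_linear] poly_op_1)
    qed
    show "?H u - E0 *\<^sub>R u \<in> S"
      unfolding S_def mem_Collect_eq p[symmetric]
      by (rule ac_subspace_density[OF V \<nu> continuous_poly poly_op_moments])
    have "\<epsilon>\<^sup>2 * (norm u)\<^sup>2 = (\<integral>x. \<epsilon>\<^sup>2 \<partial>\<nu>)"
      using norm_poly_op[of 1] by (simp add: poly_op_1)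
    also have "\<dots> \<le> (\<integral>x. (poly [:- E0, 1:] x)\<^sup>2 \<partial>\<nu>)"
    proof (rule integral_mono_AE)
      show "integrable \<nu> (\<lambda>x. (poly [:- E0, 1:] x)\<^sup>2)"
        by (rule integrable_continuous) (intro continuous_intros)
      show "AE x in \<nu>. \<epsilon>\<^sup>2 \<le> (poly [:- E0, 1:] x)\<^sup>2"
        using AE by eventually_elim (use \<epsilon> in \<open>auto simp: abs_le_square_iff[symmetric]\<close>)
    qed simp
    also have "\<dots> = (norm (?H u - E0 *\<^sub>R u))\<^sup>2"
      unfolding norm_poly_op[symmetric] p ..
    finally have "(\<epsilon> * norm u)\<^sup>2 \<le> (norm (?H u - E0 *\<^sub>R u))\<^sup>2"
      by (simp add: power_mult_distrib)
    then have "\<epsilon> * norm u \<le> norm (?H u - E0 *\<^sub>R u)"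
      by (rule power2_le_imp_le) simp
    then show "norm u \<le> 1 / \<epsilon> * norm (?H u - E0 *\<^sub>R u)"
      using \<epsilon> by (simp add: field_simps)
    \<comment> \<open>It equals \<open>1 / (x - E0)\<close> outside the interval and is continuous
      on the whole line.\<close>
    define g where "g = (\<lambda>x. (x - E0) / max (\<epsilon>\<^sup>2) ((x - E0)\<^sup>2))"
    have pos: "max (\<epsilon>\<^sup>2) ((x - E0)\<^sup>2) \<noteq> 0" for x
      using less_le_trans[OF zero_less_power[OF \<epsilon>, of 2] max.cobounded1, of "(x - E0)\<^sup>2"] by simp
    have g: "continuous_on UNIV g"
      unfolding g_def by (intro continuous_intros) (use pos in auto)
    obtain v where v: "\<And>k. v \<bullet> (?H ^^ k) v = (\<integral>x. x ^ k * (g x)\<^sup>2 \<partial>\<nu>)"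
      "\<And>E. (norm (?H v - E *\<^sub>R v - u))\<^sup>2 = (\<integral>x. ((x - E) * g x - 1)\<^sup>2 \<partial>\<nu>)"
      by (rule functional_calculus[OF g]) (rule that; assumption)
    have "v \<in> S"
      unfolding S_def mem_Collect_eq by (rule ac_subspace_density[OF V \<nu> g v(1)])
    moreover have "(\<integral>x. ((x - E0) * g x - 1)\<^sup>2 \<partial>\<nu>) = 0"
    proof (rule integral_eq_zero_AE)
      show "AE x in \<nu>. ((x - E0) * g x - 1)\<^sup>2 = 0"
        using AE
      proof eventually_elim
        case (elim x)
        have "x - E0 \<noteq> 0"
        proof
          assume "x - E0 = 0"
          then have "\<bar>x - E0\<bar> < \<epsilon>" using \<epsilon> by simp
          with elim show False by blast
        qed
        moreover have "\<epsilon>\<^sup>2 \<le> (x - E0)\<^sup>2"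
          using elim \<epsilon> by (simp add: abs_le_square_iff[symmetric])
        ultimately show ?case
          by (simp add: g_def max_def power2_eq_square)
      qed
    qed
    then have "?H v - E0 *\<^sub>R v = u"
      using v(2)[of E0] by simp
    ultimately show "\<exists>v\<in>S. ?H v - E0 *\<^sub>R v = u"
      by blast
  qed
  have lin: "linear ?H"
    by (rule bounded_linear.linear[OF bounded_linear_jacobi_l2[OF V]])
  \<comment> \<open>Closure of \<open>S\<close> under differences has not been established, so
    \<open>bound\<close> cannot be applied to \<open>a - b\<close>. Instead, symmetry and
    surjectivity make \<open>a - b\<close> orthogonal to all of \<open>S\<close>, in particular to
    \<open>a\<close> and \<open>b\<close>, hence to itself.\<close>
  have inj: "inj_on (\<lambda>w. ?H w - E0 *\<^sub>R w) S"
  proof (rule inj_onI)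
    fix a b assume ab: "a \<in> S" "b \<in> S" "?H a - E0 *\<^sub>R a = ?H b - E0 *\<^sub>R b"
    define w where "w = a - b"
    have w: "?H w - E0 *\<^sub>R w = 0"
      using ab(3) by (simp add: w_def linear_diff[OF lin] algebra_simps)
    have orth: "w \<bullet> u = 0" if u: "u \<in> S" for u
    proof -
      obtain v where v: "?H v - E0 *\<^sub>R v = u"
        using surj[OF u] by blast
      have "w \<bullet> u = (?H w - E0 *\<^sub>R w) \<bullet> v"
        unfolding v[symmetric] inner_diff_right inner_diff_left inner_jacobi_l2[OF V] by simp
      then show ?thesis
        by (simp add: w)
    qed
    have "w \<bullet> w = 0"
      using orth[OF ab(1)] orth[OF ab(2)] by (simp add: w_def inner_diff_right)
    then show "a = b"
      by (simp add: w_def)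
  qed
  have "bij_betw (\<lambda>w. ?H w - E0 *\<^sub>R w) S S"
    unfolding bij_betw_def using inj maps surj by (auto simp: image_iff)
  then show ?thesis
    unfolding ac_spectrum_def S[symmetric]
    by (rule not_in_spectrum_onI[OF V _ bound])
qed

section \<open>Measurability of the exponents\<close>

text \<open>Turns upper limits along the integers into upper limits of sequences, for which
  measurability is available.\<close>

lemma at_top_int: "(at_top :: int filter) = filtermap int sequentially"
  unfolding filter_eq_iff eventually_filtermap eventually_at_top_linorder
proof (intro allI iffI)
  fix P :: "int \<Rightarrow> bool"
  assume "\<exists>N. \<forall>n\<ge>N. P n"
  then obtain N where N: "\<forall>n\<ge>N. P n" by blast
  have "\<forall>n\<ge>nat N. P (int n)"
    using N by (simp add: nat_le_iff)
  then show "\<exists>N. \<forall>n\<ge>N. P (int n)" by blast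
next
  fix P :: "int \<Rightarrow> bool"
  assume "\<exists>N. \<forall>n\<ge>N. P (int n)"
  then obtain N where N: "\<forall>n\<ge>N. P (int n)" by blast
  have "P n" if "n \<ge> int N" for n
    using N[rule_format, of "nat n"] that by (simp add: le_nat_iff)
  then show "\<exists>N. \<forall>n\<ge>N. P n" by blast
qed

lemma at_bot_int: "(at_bot :: int filter) = filtermap (\<lambda>n. - int n) sequentially"
  unfolding filter_eq_iff eventually_filtermap eventually_at_top_linorder eventually_at_bot_linorder
proof (intro allI iffI)
  fix P :: "int \<Rightarrow> bool"
  assume "\<exists>N. \<forall>n\<le>N. P n"
  then obtain N where N: "\<forall>n\<le>N. P n" by blast
  have "P (- int n)" if "n \<ge> nat (- N)" for n
    using N that by (simp add: nat_le_iff)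
  then show "\<exists>N. \<forall>n\<ge>N. P (- int n)" by blast
next
  fix P :: "int \<Rightarrow> bool"
  assume "\<exists>N. \<forall>n\<ge>N. P (- int n)"
  then obtain N where N: "\<forall>n\<ge>N. P (- int n)" by blast
  have "P n" if "n \<le> - int N" for n
    using N[rule_format, of "nat (- n)"] that by (simp add: le_nat_iff)
  then show "\<exists>N. \<forall>n\<le>N. P n" by blast
qed

lemma int_iterate_measurable:
  assumes "invertible_transformation M T"
  shows "int_iterate M T n \<in> measurable M M"
proof -
  have pow: "(S ^^ k) \<in> measurable M M" if "S \<in> measurable M M" for S :: "'a \<Rightarrow> 'a" and k
  proof (induction k)
    case (Suc k)
    then show ?case
      using measurable_comp[OF Suc that] by (simp add: o_def)
  qed (simp add: id_def)
  have "T \<in> measurable M M" "inv_into (space M) T \<in> measurable M M"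
    using assms by (auto simp: invertible_transformation_def)
  from pow[OF this(1), of "nat n"] pow[OF this(2), of "nat (- n)"] show ?thesis
    by (cases "n \<ge> 0") (simp_all add: int_iterate_def[abs_def])
qed

text \<open>The operator norm is Lipschitz with respect to the sum of the moduli of the
  entries.\<close>

lemma onorm_matrix_continuous: "continuous_on UNIV (\<lambda>A :: real^2^2. onorm ((*v) A))"
  unfolding continuous_on_def
proof
  fix B :: "real^2^2"
  let ?e = "\<lambda>A :: real^2^2. \<Sum>i\<in>UNIV. \<Sum>j\<in>UNIV. \<bar>(A - B) $ i $ j\<bar>"
  have tri: "onorm ((*v) A) \<le> onorm ((*v) C) + onorm ((*v) (A - C))" for A C :: "real^2^2"
    using onorm_triangle[OF matrix_vector_mul_bounded_linear[of C] matrix_vector_mul_bounded_linear[of "A - C"]]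
    unfolding matrix_vector_mult_diff_rdistrib by simp
  have le: "\<bar>onorm ((*v) A) - onorm ((*v) B)\<bar> \<le> ?e A" for A
  proof -
    have "onorm ((*v) (B - A)) \<le> ?e A"
      using onorm_le_matrix_component_sum[of "B - A"]
      unfolding vector_minus_component abs_minus_commute[of "B $ _ $ _"] .
    then show ?thesis
      using tri[of A B] tri[of B A] onorm_le_matrix_component_sum[of "A - B"] by linarith
  qed
  have "(?e \<longlongrightarrow> (\<Sum>i\<in>UNIV. \<Sum>j\<in>UNIV. \<bar>(B - B) $ i $ j\<bar>)) (at B)"
    by (intro tendsto_sum tendsto_rabs tendsto_vec_nth tendsto_diff tendsto_ident_at tendsto_const)
  then have "(?e \<longlongrightarrow> 0) (at B)"
    by simp
  then have "((\<lambda>A. onorm ((*v) A) - onorm ((*v) B)) \<longlongrightarrow> 0) (at B)"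
    by (rule Lim_null_comparison[rotated]) (simp only: real_norm_def le eventually_True)
  then show "((\<lambda>A. onorm ((*v) A)) \<longlongrightarrow> onorm ((*v) B)) (at B within UNIV)"
    by (simp add: LIM_zero_cancel)
qed

lemma measurable_matrix2:
  fixes A :: "'b \<Rightarrow> real^2^2"
  assumes "\<And>i j. (\<lambda>x. A x $ i $ j) \<in> borel_measurable N"
  shows "A \<in> borel_measurable N"
proof -
  have "(\<lambda>x. A x \<bullet> b) \<in> borel_measurable N" if "b \<in> Basis" for b
  proof -
    obtain i c where "b = axis i c" "c \<in> Basis"
      using \<open>b \<in> Basis\<close> by (auto simp: Basis_vec_def)
    moreover obtain j where "c = axis j 1"
      using \<open>c \<in> Basis\<close> by (auto simp: Basis_vec_def)
    ultimately show ?thesis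
      using assms[of i j] by (simp add: inner_axis)
  qed
  then show ?thesis
    by (subst borel_measurable_euclidean_space) auto
qed

text \<open>Measurability jointly in energy and phase is what the exchange of the two almost
  everywhere quantifiers rests on.\<close>

lemma growth_rate_measurable:
  assumes T: "invertible_transformation M T" and f: "f \<in> borel_measurable M"
  shows "(\<lambda>(E, \<omega>). growth_rate M T f E \<omega> n) \<in> borel_measurable (borel \<Otimes>\<^sub>M M)"
proof -
  have fm [measurable]: "(\<lambda>\<omega>. f (int_iterate M T n \<omega>)) \<in> borel_measurable M" for n
    by (rule measurable_compose[OF int_iterate_measurable[OF T] f])
  have one: "(\<lambda>x. one_step_matrix f (fst x) (int_iterate M T n (snd x)) $ i $ j) \<in> borel_measurable (borel \<Otimes>\<^sub>M M)"
    "(\<lambda>x. matrix_inv (one_step_matrix f (fst x) (int_iterate M T n (snd x))) $ i $ j) \<in> borel_measurable (borel \<Otimes>\<^sub>M M)" for n i j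
    using exhaust_2[of i] exhaust_2[of j] unfolding matrix_inv_one_step by (auto simp: one_step_matrix_def)
  note one[measurable]
  have fw: "(\<lambda>x. forward_transfer M T f (fst x) k (snd x) $ i $ j) \<in> borel_measurable (borel \<Otimes>\<^sub>M M)" for k i j
  proof (induction k arbitrary: i j)
    case (Suc k)
    note Suc[measurable]
    show ?case
      unfolding forward_transfer.simps matrix2_mult by measurable
  qed simp
  have bw: "(\<lambda>x. backward_transfer M T f (fst x) k (snd x) $ i $ j) \<in> borel_measurable (borel \<Otimes>\<^sub>M M)" for k i j
  proof (induction k arbitrary: i j)
    case (Suc k)
    note Suc[measurable]
    show ?case
      unfolding backward_transfer.simps matrix2_mult by measurable
  qed simp
  have "(\<lambda>x. transfer_matrix M T f (fst x) n (snd x)) \<in> borel_measurable (borel \<Otimes>\<^sub>M M)"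
    unfolding transfer_matrix_def using fw bw by (intro measurable_matrix2) (cases "n \<ge> 0", auto)
  then have [measurable]: "(\<lambda>x. onorm ((*v) (transfer_matrix M T f (fst x) n (snd x)))) \<in> borel_measurable (borel \<Otimes>\<^sub>M M)"
    by (rule measurable_compose[OF _ borel_measurable_continuous_onI[OF onorm_matrix_continuous]])
  show ?thesis
    unfolding growth_rate_def split_beta by measurable
qed

lemma lyapunov_measurable:
  assumes T: "invertible_transformation M T" and f: "f \<in> borel_measurable M"
  shows "(\<lambda>(E, \<omega>). Limsup at_top (\<lambda>n. ereal (growth_rate M T f E \<omega> n))) \<in> borel_measurable (borel \<Otimes>\<^sub>M M)"
    "(\<lambda>(E, \<omega>). Limsup at_bot (\<lambda>n. ereal (growth_rate M T f E \<omega> n))) \<in> borel_measurable (borel \<Otimes>\<^sub>M M)"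
proof -
  note [measurable] = growth_rate_measurable[OF T f]
  have inj: "inj (\<lambda>n. - int n)"
    by (simp add: inj_def)
  show "(\<lambda>(E, \<omega>). Limsup at_top (\<lambda>n. ereal (growth_rate M T f E \<omega> n))) \<in> borel_measurable (borel \<Otimes>\<^sub>M M)"
    "(\<lambda>(E, \<omega>). Limsup at_bot (\<lambda>n. ereal (growth_rate M T f E \<omega> n))) \<in> borel_measurable (borel \<Otimes>\<^sub>M M)"
    unfolding at_top_int at_bot_int Limsup_filtermap_eq[OF inj_of_nat] Limsup_filtermap_eq[OF inj] by measurable
qed

lemma not_AE_False: "emeasure M (space M) = \<infinity> \<Longrightarrow> \<not> (AE x in M. False)"
  by (simp add: trivial_limit_def[symmetric] ae_filter_eq_bot_iff)

text \<open>The exponent is determined only through almost every phase, so its zeros are recognized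
  as the energies at which a section of a product measurable set is null; the measure of the section
  depends measurably on the energy.\<close>

lemma lyapunov_zero_set:
  assumes M: "sigma_finite_measure M" "emeasure M (space M) = \<infinity>"
    and meas: "(\<lambda>(E, \<omega>). Limsup F (\<lambda>n. ereal (growth_rate M T f E \<omega> n))) \<in> borel_measurable (borel \<Otimes>\<^sub>M M)"
    and L: "is_upper_lyapunov F M T f L"
  shows "{E. L E = 0} \<in> sets borel"
proof -
  interpret sigma_finite_measure M by (rule M(1))
  define Q where "Q = {x \<in> space (borel \<Otimes>\<^sub>M M). Limsup F (\<lambda>n. ereal (growth_rate M T f (fst x) (snd x) n)) \<noteq> 0}"
  have m: "(\<lambda>x. Limsup F (\<lambda>n. ereal (growth_rate M T f (fst x) (snd x) n))) \<in> borel_measurable (borel \<Otimes>\<^sub>M M)"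
    using meas by (simp add: split_beta)
  then have Q: "Q \<in> sets (borel \<Otimes>\<^sub>M M)"
    unfolding Q_def by measurable
  have sec: "Pair E -` Q = {\<omega> \<in> space M. Limsup F (\<lambda>n. ereal (growth_rate M T f E \<omega> n)) \<noteq> 0}" for E
    by (auto simp: Q_def space_pair_measure)
  have Qs: "Pair E -` Q \<in> sets M" for E
    by (rule sets_Pair1[OF Q])
  have "L E = 0 \<longleftrightarrow> emeasure M (Pair E -` Q) = 0" for E
  proof
    have ae: "AE \<omega> in M. Limsup F (\<lambda>n. ereal (growth_rate M T f E \<omega> n)) = ereal (L E)"
      using L by (simp add: is_upper_lyapunov_def)
    show "emeasure M (Pair E -` Q) = 0" if "L E = 0"
    proof -
      have "AE \<omega> in M. \<omega> \<notin> Pair E -` Q"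
        using ae by eventually_elim (simp add: sec that)
      then show ?thesis
        using AE_iff_null_sets[OF Qs[of E]] by (auto dest: null_setsD1)
    qed
    show "L E = 0" if "emeasure M (Pair E -` Q) = 0"
    proof (rule ccontr)
      assume "L E \<noteq> 0"
      have "AE \<omega> in M. \<omega> \<notin> Pair E -` Q"
        using Qs that by (intro AE_not_in) (simp add: null_sets_def)
      with ae AE_space have "AE \<omega> in M. False"
      proof eventually_elim
        case (elim \<omega>)
        then show ?case using \<open>L E \<noteq> 0\<close> by (simp add: sec zero_ereal_def)
      qed
      then show False
        using M(2) by (simp add: not_AE_False)
    qed
  qed
  then have "{E. L E = 0} = {E \<in> space borel. emeasure M (Pair E -` Q) = 0}"
    by simp
  also have "\<dots> \<in> sets borel"
    using measurable_emeasure_Pair[OF Q] by measurable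
  finally show ?thesis .
qed

lemma lyapunov_nonneg:
  assumes M: "emeasure M (space M) = \<infinity>" and F: "F \<noteq> bot" and L: "is_upper_lyapunov F M T f L"
  shows "0 \<le> L E"
proof -
  have ae: "AE \<omega> in M. Limsup F (\<lambda>n. ereal (growth_rate M T f E \<omega> n)) = ereal (L E)"
    using L by (simp add: is_upper_lyapunov_def)
  have "\<exists>\<omega>. Limsup F (\<lambda>n. ereal (growth_rate M T f E \<omega> n)) = ereal (L E)"
  proof (rule ccontr)
    assume "\<not> ?thesis"
    with ae have "AE \<omega> in M. False" by (simp only: not_ex)
    then show False
      using M by (simp add: not_AE_False)
  qed
  then obtain \<omega> where \<omega>: "Limsup F (\<lambda>n. ereal (growth_rate M T f E \<omega> n)) = ereal (L E)" by blast
  have "0 \<le> Liminf F (\<lambda>n. ereal (growth_rate M T f E \<omega> n))"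
    by (rule Liminf_bounded) (simp add: growth_rate_nonneg zero_ereal_def)
  also have "\<dots> \<le> ereal (L E)"
    unfolding \<omega>[symmetric] by (rule Liminf_le_Limsup[OF F])
  finally show ?thesis by simp
qed

section \<open>Conclusion for a single phase and proof of the theorem\<close>

lemma int_iterate_space:
  assumes "invertible_transformation M T" "\<omega> \<in> space M"
  shows "int_iterate M T n \<omega> \<in> space M"
  using measurable_space[OF int_iterate_measurable[OF assms(1)] assms(2)] .

lemma schroedinger_eq_jacobi: "schroedinger M T f \<omega> = jacobi (\<lambda>n. f (int_iterate M T n \<omega>))"
  by (rule ext) (simp add: schroedinger_def jacobi_def)

text \<open>A nonzero \<open>\<phi>\<close> would force zero growth on one side. The side is not
  known beforehand, hence positivity is required at both ends.\<close>

lemma no_poly_bounded_eigenfunction: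
  fixes M :: "'a measure" and T :: "'a \<Rightarrow> 'a" and f :: "'a \<Rightarrow> real" and \<omega> :: 'a
  defines "V \<equiv> \<lambda>n. f (int_iterate M T n \<omega>)"
  assumes g0: "\<exists>g. poly_bounded g \<and> (\<forall>n. jacobi V g n - complex_of_real E * g n = (if n = 0 then 1 else 0))"
    and g1: "\<exists>g. poly_bounded g \<and> (\<forall>n. jacobi V g n - complex_of_real E * g n = (if n = 1 then 1 else 0))"
    and pos: "0 < Limsup at_top (\<lambda>n. ereal (growth_rate M T f E \<omega> n))"
      "0 < Limsup at_bot (\<lambda>n. ereal (growth_rate M T f E \<omega> n))"
    and \<phi>: "poly_bounded \<phi>" "\<forall>n. jacobi V \<phi> n = complex_of_real E * \<phi> n"
  shows "\<phi> n = 0"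
proof (rule ccontr)
  assume n: "\<phi> n \<noteq> 0"
  obtain a where a: "poly_bounded a" "\<And>n. jacobi V a n - complex_of_real E * a n = (if n = 0 then 1 else 0)"
    using g0 by blast
  obtain b where b: "poly_bounded b" "\<And>n. jacobi V b n - complex_of_real E * b n = (if n = 1 then 1 else 0)"
    using g1 by blast
  from solutions_poly_bounded[of a V "complex_of_real E" b \<phi> n, OF a b \<phi>(1) \<phi>(2)[rule_format] n]
  show False
  proof
    assume "\<forall>u. (\<forall>n. jacobi V u n = complex_of_real E * u n) \<longrightarrow> (\<exists>C. \<forall>n\<in>{1..}. cmod (u n) \<le> C * (1 + (real_of_int n)\<^sup>2)\<^sup>2)"
    from transfer_growth_right[OF this[unfolded V_def]] pos(1) show False by simp
  next
    assume "\<forall>u. (\<forall>n. jacobi V u n = complex_of_real E * u n) \<longrightarrow> (\<exists>C. \<forall>n\<in>{..-1}. cmod (u n) \<le> C * (1 + (real_of_int n)\<^sup>2)\<^sup>2)"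
    from transfer_growth_left[OF this[unfolded V_def]] pos(2) show False by simp
  qed
qed

theorem theorem6p7:
  fixes M :: "'a measure"
    and T :: "'a \<Rightarrow> 'a"
    and f :: "'a \<Rightarrow> real"
    and \<Sigma>ac :: "real set"
    and Lplus Lminus :: "real \<Rightarrow> real"
  assumes "sigma_finite_measure M"
    and "emeasure M (space M) = \<infinity>"
    and "invertible_transformation M T"
    and "nonsingular_transformation M T"
    and "ergodic_transformation M T"
    and "conservative_transformation M T"
    and "f \<in> borel_measurable M"
    and "bounded (f ` space M)"
    and "compact \<Sigma>ac"
    and "AE \<omega> in M. ac_spectrum (schroedinger M T f \<omega>) = complex_of_real ` \<Sigma>ac"
    and "is_upper_lyapunov at_top M T f Lplus"
    and "is_upper_lyapunov at_bot M T f Lminus"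
  shows "\<Sigma>ac \<subseteq> essential_closure {E. Lplus E = 0 \<or> Lminus E = 0}"
proof
  fix E0 assume E0: "E0 \<in> \<Sigma>ac"
  let ?Z = "{E. Lplus E = 0 \<or> Lminus E = 0}"
  let ?P = "\<lambda>E \<omega>. Limsup at_top (\<lambda>n. ereal (growth_rate M T f E \<omega> n))"
  let ?N = "\<lambda>E \<omega>. Limsup at_bot (\<lambda>n. ereal (growth_rate M T f E \<omega> n))"
  note meas = lyapunov_measurable[OF assms(3,7)]
  show "E0 \<in> essential_closure ?Z"
  proof (rule ccontr)
    assume "E0 \<notin> essential_closure ?Z"
    then obtain \<epsilon> where \<epsilon>: "\<epsilon> > 0" and null: "emeasure lebesgue (?Z \<inter> {E0 - \<epsilon><..<E0 + \<epsilon>}) = 0"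
      by (auto simp: essential_closure_def not_gr_zero)
    \<comment> \<open>\<open>emeasure\<close> is zero by default on sets that are not measurable;
      only measurability turns \<open>null\<close> into a statement about almost every
      energy.\<close>
    have "?Z = {E. Lplus E = 0} \<union> {E. Lminus E = 0}" by blast
    also have "\<dots> \<in> sets borel"
      by (intro sets.Un lyapunov_zero_set[OF assms(1,2) meas(1) assms(11)] lyapunov_zero_set[OF assms(1,2) meas(2) assms(12)])
    finally have Z: "?Z \<inter> {E0 - \<epsilon><..<E0 + \<epsilon>} \<in> sets borel"
      by auto
    then have "?Z \<inter> {E0 - \<epsilon><..<E0 + \<epsilon>} \<in> null_sets lborel"
      using null by (simp add: null_sets_def)
    then have "AE E in lborel. E \<notin> ?Z \<inter> {E0 - \<epsilon><..<E0 + \<epsilon>}"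
      by (rule AE_not_in)
    then have ae: "AE E in lborel. AE \<omega> in M. \<bar>E - E0\<bar> < \<epsilon> \<longrightarrow> 0 < ?P E \<omega> \<and> 0 < ?N E \<omega>"
    proof eventually_elim
      case (elim E)
      show ?case
      proof (cases "\<bar>E - E0\<bar> < \<epsilon>")
        case True
        then have "Lplus E \<noteq> 0" "Lminus E \<noteq> 0"
          using elim by (auto simp: abs_less_iff)
        then have L: "0 < Lplus E" "0 < Lminus E"
          using lyapunov_nonneg[OF assms(2) _ assms(11), of E] lyapunov_nonneg[OF assms(2) _ assms(12), of E]
          by auto
        have "AE \<omega> in M. ?P E \<omega> = ereal (Lplus E)" "AE \<omega> in M. ?N E \<omega> = ereal (Lminus E)"
          using assms(11,12) by (simp_all add: is_upper_lyapunov_def)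
        then show ?thesis
          by eventually_elim (simp add: L)
      qed simp
    qed
    interpret sigma_finite_measure M by (rule assms(1))
    interpret pair_sigma_finite lborel M ..
    \<comment> \<open>The exceptional phases depend on the energy; for the exchange of quantifiers
      the good pairs must form a measurable set in the product.\<close>
    have "{x \<in> space (lborel \<Otimes>\<^sub>M M). \<bar>fst x - E0\<bar> < \<epsilon> \<longrightarrow> 0 < ?P (fst x) (snd x) \<and> 0 < ?N (fst x) (snd x)} \<in> sets (lborel \<Otimes>\<^sub>M M)"
    proof -
      have s: "sets (lborel \<Otimes>\<^sub>M M) = sets (borel \<Otimes>\<^sub>M M)"
        by (intro sets_pair_measure_cong) simp_all
      have [measurable]: "(\<lambda>x. ?P (fst x) (snd x)) \<in> borel_measurable (lborel \<Otimes>\<^sub>M M)"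
        "(\<lambda>x. ?N (fst x) (snd x)) \<in> borel_measurable (lborel \<Otimes>\<^sub>M M)"
        using meas by (simp_all add: split_beta measurable_cong_sets[OF s refl])
      show ?thesis by measurable
    qed
    from AE_commute[OF this] ae
    have "AE \<omega> in M. AE E in lborel. \<bar>E - E0\<bar> < \<epsilon> \<longrightarrow> 0 < ?P E \<omega> \<and> 0 < ?N E \<omega>"
      by simp
    with assms(10) AE_space have good: "AE \<omega> in M. \<omega> \<in> space M \<and> ac_spectrum (schroedinger M T f \<omega>) = complex_of_real ` \<Sigma>ac \<and>
        (AE E in lborel. \<bar>E - E0\<bar> < \<epsilon> \<longrightarrow> 0 < ?P E \<omega> \<and> 0 < ?N E \<omega>)" (is "AE \<omega> in M. ?good \<omega>")
      by eventually_elim (intro conjI)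
    \<comment> \<open>One phase suffices, because almost every phase has the same absolutely
      continuous spectrum.\<close>
    have "\<exists>\<omega>. ?good \<omega>"
    proof (rule ccontr)
      assume "\<nexists>\<omega>. ?good \<omega>"
      then have "AE \<omega> in M. False"
        using good by (simp only: not_ex)
      then show False
        using assms(2) by (simp add: not_AE_False)
    qed
    then obtain \<omega> where \<omega>: "\<omega> \<in> space M" "ac_spectrum (schroedinger M T f \<omega>) = complex_of_real ` \<Sigma>ac"
      "AE E in lborel. \<bar>E - E0\<bar> < \<epsilon> \<longrightarrow> 0 < ?P E \<omega> \<and> 0 < ?N E \<omega>"
      by (elim exE conjE)
    define V where "V = (\<lambda>n. f (int_iterate M T n \<omega>))"
    obtain K where "\<forall>y\<in>f ` space M. \<bar>y\<bar> \<le> K"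
      using assms(8) unfolding bounded_real by blast
    then have V: "\<forall>n. \<bar>V n\<bar> \<le> K"
      using int_iterate_space[OF assms(3) \<omega>(1)] by (simp add: V_def)
    have noeig: "AE E in lborel. \<bar>E - E0\<bar> < \<epsilon> \<longrightarrow>
        (\<forall>\<phi>. poly_bounded \<phi> \<longrightarrow> (\<forall>n. jacobi V \<phi> n = complex_of_real E * \<phi> n) \<longrightarrow> (\<forall>n. \<phi> n = 0))"
      using \<omega>(3) green_ae[of V 0] green_ae[of V 1]
    proof eventually_elim
      case (elim E)
      show ?case
      proof (intro impI allI)
        fix \<phi> n
        assume "\<bar>E - E0\<bar> < \<epsilon>" "poly_bounded \<phi>" "\<forall>n. jacobi V \<phi> n = complex_of_real E * \<phi> n"
        then show "\<phi> n = 0"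
          using no_poly_bounded_eigenfunction[of f M T \<omega> E \<phi> n] elim unfolding V_def by simp
      qed
    qed
    have "complex_of_real E0 \<notin> ac_spectrum (jacobi V)"
    proof (rule not_in_ac_spectrum[OF V \<epsilon>])
      fix u \<nu>
      assume \<nu>: "spectral_measure (jacobi V) (seq_of u) \<nu>" "absolutely_continuous lborel \<nu>"
      interpret cyclic_vector \<nu> "K + 2" V K u
        by (rule cyclic_vectorI[OF V \<nu>(1)])
      \<comment> \<open>Absolute continuity enters here: \<open>noeig\<close> holds at Lebesgue
        almost every energy, and \<open>\<nu>\<close> inherits it.\<close>
      show "AE x in \<nu>. \<not> \<bar>x - E0\<bar> < \<epsilon>"
        by (rule null_interval, rule absolutely_continuous_AE[OF _ \<nu>(2) noeig]) simp
    qed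
    moreover have "complex_of_real E0 \<in> ac_spectrum (jacobi V)"
      using \<omega>(2) E0 unfolding schroedinger_eq_jacobi V_def by simp
    ultimately show False by blast
  qed
qed

end
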